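(* For an $(M,K)$ reversely degraded broadcast channel, the common-message-secrecy-capacity is $$C^{\mathrm{common}}_{K,M}=\max_{\prod_{j=1}^M p(x_j)}\ \min_{i\in\{1,\dots,K\}}\ \sum_{j=1}^M I(X_j;Y_{ij}\mid Y_{ej}).$$
   Context: An $(M,K)$ product broadcast channel: one sender, $K$ intended receivers, one eavesdropper (index $e$), and $M$ parallel channels with finite input alphabet $\mathcal{X}$ and finite output alphabet $\mathcal{Y}$, memoryless and mutually independent: $\Pr(\{y_{1j}^n,\dots,y_{Kj}^n,y_{ej}^n\}_{j=1}^M\mid\{x_j^n\}_{j=1}^M)=\prod_{j=1}^M\prod_{t=1}^n \Pr(y_{1j}(t),\dots,y_{Kj}(t),y_{ej}(t)\mid x_j(t))$. It is reversely degraded if for each channel $j$ there is a permutation $\pi_j(1),\dots,\pi_j(K+1)$ of $\{1,\dots,K,e\}$ such that $X_j\to Y_{\pi_j(1)j}\to Y_{\pi_j(2)j}\to\cdots\to Y_{\pi_j(K+1)j}$ is a Markov chain (the order may differ across channels); mutual informations are evaluated under this channel law. An $(n,2^{nR})$ code consists of a message set $\{1,\dots,2^{nR}\}$, a possibly stochastic encoder mapping a message $W$ to $(x_1^n,\dots,x_M^n)$, and decoders producing $\hat W_i$ from $(y_{i1}^n,\dots,y_{iM}^n)$, $i=1,\dots,K$. A rate $R$ is an achievable common-message-secrecy-rate if for every $\varepsilon>0$ there is a length-$n$ code with $\Pr(W\neq\hat W_i)\le\varepsilon$ for all $i$ and $\frac1n H(W\mid Y_{e1}^n,\dots,Y_{eM}^n)\ge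 R-\varepsilon$; the common-message-secrecy-capacity is the supremum of achievable rates. *)

theory Defs
  imports Complex_Main "HOL-Library.FuncSet"
begin

(* Receivers are indexed 0..K-1; the eavesdropper e has index K.
   A per-channel output is a vector v : nat => 'y in PiE {..K} UNIV,
   v i = output of receiver i (i<K), v K = output of the eavesdropper.
   W j x v = Pr(Y_{0j},...,Y_{(K-1)j},Y_{ej} = v | X_j = x) for channel j < M. *)

type_synonym ('x,'y) bchan = "nat \<Rightarrow> 'x \<Rightarrow> (nat \<Rightarrow> 'y) \<Rightarrow> real"

definition outs :: "nat \<Rightarrow> (nat \<Rightarrow> 'y) set" where
  "outs K = PiE {..K} (\<lambda>_. UNIV)"

definition valid_channel :: "nat \<Rightarrow> nat \<Rightarrow> ('x::finite,'y::finite) bchan \<Rightarrow> bool" where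
  "valid_channel M K W \<longleftrightarrow>
     (\<forall>j<M. \<forall>x. (\<forall>v\<in>outs K. W j x v \<ge> 0) \<and> (\<Sum>v\<in>outs K. W j x v) = 1)"

definition is_dist :: "('x::finite \<Rightarrow> real) \<Rightarrow> bool" where
  "is_dist p \<longleftrightarrow> (\<forall>x. p x \<ge> 0) \<and> (\<Sum>x\<in>UNIV. p x) = 1"

definition margXS :: "nat \<Rightarrow> ('x::finite \<Rightarrow> real) \<Rightarrow> ('x \<Rightarrow> (nat \<Rightarrow> 'y::finite) \<Rightarrow> real)
      \<Rightarrow> nat set \<Rightarrow> 'x \<Rightarrow> (nat \<Rightarrow> 'y) \<Rightarrow> real" where
  "margXS K p Wj S x u = (\<Sum>v\<in>{v\<in>outs K. restrict v S = u}. p x * Wj x v)"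

definition margS :: "nat \<Rightarrow> ('x::finite \<Rightarrow> real) \<Rightarrow> ('x \<Rightarrow> (nat \<Rightarrow> 'y::finite) \<Rightarrow> real)
      \<Rightarrow> nat set \<Rightarrow> (nat \<Rightarrow> 'y) \<Rightarrow> real" where
  "margS K p Wj S u = (\<Sum>x\<in>UNIV. margXS K p Wj S x u)"

definition markov_chain_order :: "nat \<Rightarrow> ('x::finite \<Rightarrow> real) \<Rightarrow> ('x \<Rightarrow> (nat \<Rightarrow> 'y::finite) \<Rightarrow> real)
      \<Rightarrow> (nat \<Rightarrow> nat) \<Rightarrow> bool" where
  "markov_chain_order K p Wj \<pi> \<longleftrightarrow>
     (\<forall>k<K. \<forall>x. \<forall>v\<in>outs K.
        let A = \<pi> ` {..<k}; c = \<pi> k; d = \<pi> (Suc k) in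
        margXS K p Wj (A \<union> {c, d}) x (restrict v (A \<union> {c, d})) * margS K p Wj {c} (restrict v {c})
        = margXS K p Wj (A \<union> {c}) x (restrict v (A \<union> {c})) * margS K p Wj {c, d} (restrict v {c, d}))"

definition reversely_degraded :: "nat \<Rightarrow> nat \<Rightarrow> ('x::finite,'y::finite) bchan \<Rightarrow> bool" where
  "reversely_degraded M K W \<longleftrightarrow>
     (\<forall>j<M. \<exists>\<pi>. bij_betw \<pi> {..K} {..K} \<and>
        (\<forall>p. is_dist p \<longrightarrow> markov_chain_order K p (W j) \<pi>))"

definition cmi :: "('a::finite \<Rightarrow> 'b::finite \<Rightarrow> 'c::finite \<Rightarrow> real) \<Rightarrow> real" where
  "cmi q = (\<Sum>x\<in>UNIV. \<Sum>y\<in>UNIV. \<Sum>z\<in>UNIV.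
     if q x y z = 0 then 0
     else q x y z * log 2 (q x y z * (\<Sum>x'\<in>UNIV. \<Sum>y'\<in>UNIV. q x' y' z)
            / ((\<Sum>y'\<in>UNIV. q x y' z) * (\<Sum>x'\<in>UNIV. q x' y z))))"

definition joint_XYiYe :: "nat \<Rightarrow> ('x::finite,'y::finite) bchan \<Rightarrow> nat \<Rightarrow> nat
      \<Rightarrow> ('x \<Rightarrow> real) \<Rightarrow> 'x \<Rightarrow> 'y \<Rightarrow> 'y \<Rightarrow> real" where
  "joint_XYiYe K W j i p x y z = p x * (\<Sum>v\<in>{v\<in>outs K. v i = y \<and> v K = z}. W j x v)"

definition secrecy_objective :: "nat \<Rightarrow> nat \<Rightarrow> ('x::finite,'y::finite) bchan
      \<Rightarrow> (nat \<Rightarrow> 'x \<Rightarrow> real) \<Rightarrow> real" where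
  "secrecy_objective M K W P =
     Min ((\<lambda>i. \<Sum>j<M. cmi (joint_XYiYe K W j i (P j))) ` {..<K})"

definition codewords :: "nat \<Rightarrow> nat \<Rightarrow> ((nat \<times> nat) \<Rightarrow> 'x) set" where
  "codewords M n = PiE ({..<M} \<times> {..<n}) (\<lambda>_. UNIV)"

definition outwords :: "nat \<Rightarrow> nat \<Rightarrow> nat \<Rightarrow> ((nat \<times> nat) \<Rightarrow> (nat \<Rightarrow> 'y)) set" where
  "outwords M n K = PiE ({..<M} \<times> {..<n}) (\<lambda>_. outs K)"

(* memoryless, independent channels *)
definition chan_prob :: "nat \<Rightarrow> nat \<Rightarrow> ('x,'y) bchan
      \<Rightarrow> ((nat \<times> nat) \<Rightarrow> 'x) \<Rightarrow> ((nat \<times> nat) \<Rightarrow> (nat \<Rightarrow> 'y)) \<Rightarrow> real" where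
  "chan_prob M n W xs out = (\<Prod>jt\<in>{..<M} \<times> {..<n}. W (fst jt) (xs jt) (out jt))"

definition obs :: "nat \<Rightarrow> nat \<Rightarrow> nat \<Rightarrow> ((nat \<times> nat) \<Rightarrow> (nat \<Rightarrow> 'y)) \<Rightarrow> ((nat \<times> nat) \<Rightarrow> 'y)" where
  "obs M n i out = restrict (\<lambda>jt. out jt i) ({..<M} \<times> {..<n})"

definition num_msgs :: "nat \<Rightarrow> real \<Rightarrow> nat" where
  "num_msgs n R = nat \<lceil>2 powr (real n * R)\<rceil>"

(* stochastic encoder: enc w xs = Pr(codeword xs | message w), messages 1..N *)
definition valid_encoder :: "nat \<Rightarrow> nat \<Rightarrow> nat \<Rightarrow> (nat \<Rightarrow> ((nat \<times> nat) \<Rightarrow> 'x::finite) \<Rightarrow> real) \<Rightarrow> bool" where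
  "valid_encoder M n N enc \<longleftrightarrow>
     (\<forall>w\<in>{1..N}. (\<forall>xs\<in>codewords M n. enc w xs \<ge> 0) \<and> (\<Sum>xs\<in>codewords M n. enc w xs) = 1)"

definition err_prob :: "nat \<Rightarrow> nat \<Rightarrow> nat \<Rightarrow> ('x::finite,'y::finite) bchan \<Rightarrow> nat
      \<Rightarrow> (nat \<Rightarrow> ((nat \<times> nat) \<Rightarrow> 'x) \<Rightarrow> real) \<Rightarrow> (nat \<Rightarrow> ((nat \<times> nat) \<Rightarrow> 'y) \<Rightarrow> nat) \<Rightarrow> nat \<Rightarrow> real" where
  "err_prob M K n W N enc dec i =
     (1 / real N) * (\<Sum>w\<in>{1..N}. \<Sum>xs\<in>codewords M n. enc w xs *
        (\<Sum>out\<in>{out\<in>outwords M n K. dec i (obs M n i out) \<noteq> w}. chan_prob M n W xs out))"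

definition pWYe :: "nat \<Rightarrow> nat \<Rightarrow> nat \<Rightarrow> ('x::finite,'y::finite) bchan \<Rightarrow> nat
      \<Rightarrow> (nat \<Rightarrow> ((nat \<times> nat) \<Rightarrow> 'x) \<Rightarrow> real) \<Rightarrow> nat \<Rightarrow> ((nat \<times> nat) \<Rightarrow> 'y) \<Rightarrow> real" where
  "pWYe M K n W N enc w ye =
     (1 / real N) * (\<Sum>xs\<in>codewords M n. enc w xs *
        (\<Sum>out\<in>{out\<in>outwords M n K. obs M n K out = ye}. chan_prob M n W xs out))"

definition equivocation :: "nat \<Rightarrow> nat \<Rightarrow> nat \<Rightarrow> ('x::finite,'y::finite) bchan \<Rightarrow> nat
      \<Rightarrow> (nat \<Rightarrow> ((nat \<times> nat) \<Rightarrow> 'x) \<Rightarrow> real) \<Rightarrow> real" where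
  "equivocation M K n W N enc =
     - (\<Sum>w\<in>{1..N}. \<Sum>ye\<in>(codewords M n :: ((nat \<times> nat) \<Rightarrow> 'y) set).
          if pWYe M K n W N enc w ye = 0 then 0
          else pWYe M K n W N enc w ye *
               log 2 (pWYe M K n W N enc w ye / (\<Sum>w'\<in>{1..N}. pWYe M K n W N enc w' ye)))"

definition achievable_common_secrecy_rate :: "nat \<Rightarrow> nat \<Rightarrow> ('x::finite,'y::finite) bchan \<Rightarrow> real \<Rightarrow> bool" where
  "achievable_common_secrecy_rate M K W R \<longleftrightarrow>
     (\<forall>\<epsilon>>0. \<exists>n>0. \<exists>(enc :: nat \<Rightarrow> ((nat \<times> nat) \<Rightarrow> 'x) \<Rightarrow> real)
                       (dec :: nat \<Rightarrow> ((nat \<times> nat) \<Rightarrow> 'y) \<Rightarrow> nat).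
        valid_encoder M n (num_msgs n R) enc \<and>
        (\<forall>i<K. err_prob M K n W (num_msgs n R) enc dec i \<le> \<epsilon>) \<and>
        equivocation M K n W (num_msgs n R) enc / real n \<ge> R - \<epsilon>)"

definition common_secrecy_capacity :: "nat \<Rightarrow> nat \<Rightarrow> ('x::finite,'y::finite) bchan \<Rightarrow> real" where
  "common_secrecy_capacity M K W = Sup {R. achievable_common_secrecy_rate M K W R}"

end

theory Submission
  imports Defs "HOL-Analysis.Analysis"
begin

text \<open>Converse. For any code, Fano's inequality and memorylessness bound the equivocation by the sum over
  all letters of \<open>I(X; Y\<^sub>i | Y\<^sub>e)\<close>. Comparing each letter with the conditional law of \<open>Y\<^sub>i\<close> given \<open>Y\<^sub>e\<close> under
  the time-averaged input law bounds this sum by \<open>n\<close> times the objective at that law, so one and the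
  same product law works for all receivers.

  Achievability. Channel \<open>j\<close> gets its own random codebook, with about \<open>2 ^ (n I(X\<^sub>j; Y\<^sub>e\<^sub>j))\<close> words for each
  message, among which the encoder picks one at random, independently over the channels. Soft covering
  makes the law seen by the eavesdropper nearly independent of the message. Receiver \<open>i\<close> decodes the
  message only from the channels on which it is stronger than the eavesdropper, which is possible below
  the sum of \<open>I(X\<^sub>j; Y\<^sub>i\<^sub>j) - I(X\<^sub>j; Y\<^sub>e\<^sub>j)\<close> over these channels. By degradedness this sum is the sum of
  \<open>I(X\<^sub>j; Y\<^sub>i\<^sub>j | Y\<^sub>e\<^sub>j)\<close> over all channels, as the other terms vanish. Error and leakage are controlled by
  moments of the likelihood ratio of order near \<open>0\<close>, hence without typical sequences.\<close>

section \<open>Sums over finite products, entropy and moments\<close>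

text \<open>Receivers may disagree on which channels are better than the eavesdropper's. With one
  codebook and one local randomness for all channels, receiver \<open>i\<close> would have to
  resolve that randomness also where it is weaker, and the negative differences of informations
  would count against it. Separate randomness removes this loss: the whole message is attached to
  the words of every channel, and weak channels are simply ignored. The same separation makes the
  eavesdropper's law given the message a product over the channels, so that the leakages add; they
  are bounded without dividing by \<open>n\<close>.

  A moment of a likelihood ratio is 1 at order 0, and its derivative there is a mutual information
  up to the factor \<open>ln 2\<close>. A fixed small order therefore turns any slack in the rates
  into exponential decay.

  That the maximum is attained is a compactness argument. It needs continuity of the conditional
  information up to the boundary of the simplex, where the quotients inside the logarithms break
  down.\<close>

lemma sum_PiE_prod_restricted:
  fixes p f :: "'k \<Rightarrow> 'a \<Rightarrow> real"
  assumes "finite B" "\<And>k. k \<in> B \<Longrightarrow> finite (S k)" "J \<subseteq> B"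
    and "\<And>k. k \<in> B \<Longrightarrow> (\<Sum>c\<in>S k. p k c) = 1"
  shows "(\<Sum>C\<in>PiE B S. (\<Prod>k\<in>B. p k (C k)) * (\<Prod>k\<in>J. f k (C k))) = (\<Prod>k\<in>J. \<Sum>c\<in>S k. p k c * f k c)"
proof -
  have "(\<Prod>k\<in>B. p k (C k)) * (\<Prod>k\<in>J. f k (C k))
      = (\<Prod>k\<in>B. p k (C k) * (if k \<in> J then f k (C k) else 1))" for C
    using assms(1,3) by (simp add: prod.distrib prod.inter_restrict[symmetric] Int_absorb1)
  then have "(\<Sum>C\<in>PiE B S. (\<Prod>k\<in>B. p k (C k)) * (\<Prod>k\<in>J. f k (C k)))
      = (\<Prod>k\<in>B. \<Sum>c\<in>S k. p k c * (if k \<in> J then f k c else 1))"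
    using assms(1,2) by (simp add: prod_sum_PiE)
  also have "\<dots> = (\<Prod>k\<in>B. if k \<in> J then (\<Sum>c\<in>S k. p k c * f k c) else 1)"
    using assms(4) by (intro prod.cong) auto
  also have "\<dots> = (\<Prod>k\<in>J. \<Sum>c\<in>S k. p k c * f k c)"
    using assms(1,3) by (simp add: prod.inter_restrict[symmetric] Int_absorb1)
  finally show ?thesis .
qed

lemma sum_PiE_prod_one:
  fixes p :: "'k \<Rightarrow> 'a \<Rightarrow> real"
  assumes "finite B" "\<And>k. k \<in> B \<Longrightarrow> finite (S k)"
    and "\<And>k. k \<in> B \<Longrightarrow> (\<Sum>c\<in>S k. p k c) = 1"
  shows "(\<Sum>C\<in>PiE B S. \<Prod>k\<in>B. p k (C k)) = 1"
  using sum_PiE_prod_restricted[OF assms(1,2) empty_subsetI assms(3)] by simp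

lemma sum_PiE_prod_component:
  fixes p :: "'k \<Rightarrow> 'a \<Rightarrow> real"
  assumes "finite B" "\<And>k. k \<in> B \<Longrightarrow> finite (S k)" "m \<in> B"
    and "\<And>k. k \<in> B \<Longrightarrow> (\<Sum>c\<in>S k. p k c) = 1"
  shows "(\<Sum>C\<in>PiE B S. (\<Prod>k\<in>B. p k (C k)) * f (C m)) = (\<Sum>c\<in>S m. p m c * f c)"
  using sum_PiE_prod_restricted[where J = "{m}" and f = "\<lambda>_. f", OF assms(1,2) _ assms(4)] assms(3)
  by simp

text \<open>The words with a given letterwise image form again a product set, so the law of the
  image is a product too. With a projection for \<open>\<phi>\<close> this says that each receiver
  sees a memoryless channel.\<close>

lemma sum_PiE_prod_pushforward:
  fixes p :: "'k \<Rightarrow> 'a \<Rightarrow> real" and \<phi> :: "'a \<Rightarrow> 'b::finite"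
  assumes "finite I" "finite S"
  shows "(\<Sum>v\<in>PiE I (\<lambda>_. S). (\<Prod>k\<in>I. p k (v k)) * F (restrict (\<lambda>k. \<phi> (v k)) I))
       = (\<Sum>u\<in>PiE I (\<lambda>_. UNIV). (\<Prod>k\<in>I. \<Sum>a\<in>{a\<in>S. \<phi> a = u k}. p k a) * F u)"
proof -
  let ?X = "PiE I (\<lambda>_. S)" and ?U = "PiE I (\<lambda>_. UNIV) :: ('k \<Rightarrow> 'b) set"
  let ?g = "\<lambda>v. restrict (\<lambda>k. \<phi> (v k)) I"
  have fin: "finite ?X" "finite ?U"
    using assms by (auto intro!: finite_PiE)
  have fibre: "{v\<in>?X. ?g v = u} = PiE I (\<lambda>k. {a\<in>S. \<phi> a = u k})" if "u \<in> ?U" for u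
  proof (intro equalityI subsetI)
    fix v assume v: "v \<in> {v\<in>?X. ?g v = u}"
    then have "\<phi> (v k) = u k" if "k \<in> I" for k
      using that by (metis (mono_tags, lifting) mem_Collect_eq restrict_apply')
    then show "v \<in> PiE I (\<lambda>k. {a\<in>S. \<phi> a = u k})"
      using v by (auto simp: PiE_iff)
  next
    fix v assume "v \<in> PiE I (\<lambda>k. {a\<in>S. \<phi> a = u k})"
    then show "v \<in> {v\<in>?X. ?g v = u}"
      using that by (auto simp: PiE_iff extensional_def fun_eq_iff)
  qed
  have "(\<Sum>v\<in>?X. (\<Prod>k\<in>I. p k (v k)) * F (?g v))
      = (\<Sum>u\<in>?U. \<Sum>v\<in>{v\<in>?X. ?g v = u}. (\<Prod>k\<in>I. p k (v k)) * F (?g v))"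
    by (rule sum.group[symmetric]) (use fin in auto)
  also have "\<dots> = (\<Sum>u\<in>?U. (\<Sum>v\<in>{v\<in>?X. ?g v = u}. \<Prod>k\<in>I. p k (v k)) * F u)"
    by (intro sum.cong) (auto simp: sum_distrib_right)
  also have "\<dots> = (\<Sum>u\<in>?U. (\<Prod>k\<in>I. \<Sum>a\<in>{a\<in>S. \<phi> a = u k}. p k a) * F u)"
    using assms by (intro sum.cong refl) (simp add: fibre prod_sum_PiE)
  finally show ?thesis .
qed

lemma prod_pos_imp_nonzero:
  fixes f :: "'a \<Rightarrow> real"
  assumes "finite A" "(\<Prod>a\<in>A. f a) > 0" "a \<in> A"
  shows "f a \<noteq> 0"
  using assms prod_zero[of A f] by (metis less_irrefl)

text \<open>From \<open>ln z \<le> z - 1\<close>. It is Jensen's inequality for the logarithm, in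
  the form needed for Gibbs' inequality and for the converse, where \<open>z\<close> may be
  arbitrary on atoms of mass 0.\<close>

lemma sum_mult_log_le_0:
  fixes p z :: "'a \<Rightarrow> real"
  assumes "finite A" "\<And>a. a \<in> A \<Longrightarrow> p a \<ge> 0" "\<And>a. a \<in> A \<Longrightarrow> p a > 0 \<Longrightarrow> z a > 0"
    and "(\<Sum>a\<in>A. p a) = 1" "(\<Sum>a\<in>A. p a * z a) \<le> 1"
  shows "(\<Sum>a\<in>A. p a * log 2 (z a)) \<le> 0"
proof -
  have "(\<Sum>a\<in>A. p a * ln (z a)) \<le> (\<Sum>a\<in>A. p a * (z a - 1))"
  proof (rule sum_mono)
    fix a assume "a \<in> A"
    show "p a * ln (z a) \<le> p a * (z a - 1)"
    proof (cases "p a > 0")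
      case True
      then show ?thesis using assms(3)[OF \<open>a \<in> A\<close>] ln_le_minus_one by (intro mult_left_mono) auto
    qed (use assms(2)[OF \<open>a \<in> A\<close>] in auto)
  qed
  also have "\<dots> \<le> 0"
    using assms(4,5) by (simp add: right_diff_distrib sum_subtractf)
  finally have "(\<Sum>a\<in>A. p a * ln (z a)) / ln 2 \<le> 0"
    by (simp add: divide_le_0_iff)
  then show ?thesis
    by (simp add: log_def sum_divide_distrib)
qed

lemma gibbs:
  fixes p q :: "'a \<Rightarrow> real"
  assumes "finite A" "\<And>a. a \<in> A \<Longrightarrow> p a \<ge> 0" "\<And>a. a \<in> A \<Longrightarrow> q a \<ge> 0"
    and "\<And>a. a \<in> A \<Longrightarrow> p a > 0 \<Longrightarrow> q a > 0"
    and "(\<Sum>a\<in>A. p a) = 1" "(\<Sum>a\<in>A. q a) \<le> 1"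
  shows "(\<Sum>a\<in>A. p a * log 2 (p a / q a)) \<ge> 0"
proof -
  have "(\<Sum>a\<in>A. p a * log 2 (q a / p a)) \<le> 0"
  proof (rule sum_mult_log_le_0)
    have "(\<Sum>a\<in>A. p a * (q a / p a)) \<le> (\<Sum>a\<in>A. q a)"
      using assms by (intro sum_mono) auto
    then show "(\<Sum>a\<in>A. p a * (q a / p a)) \<le> 1" using assms(6) by linarith
  qed (use assms in auto)
  moreover have "p a * log 2 (q a / p a) = - (p a * log 2 (p a / q a))" if "a \<in> A" for a
    using assms(2)[OF that] assms(4)[OF that] by (cases "p a = 0") (auto simp: log_divide algebra_simps)
  ultimately show ?thesis by (simp add: sum_negf)
qed

text \<open>The two sides agree at \<open>s = 0\<close>, and \<open>\<delta>\<close> makes the derivative of the right-hand side larger there.\<close>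
lemma eventually_moment_le:
  fixes p f :: "'a \<Rightarrow> real"
  assumes "finite A" "\<And>a. a \<in> A \<Longrightarrow> p a \<ge> 0" "\<And>a. a \<in> A \<Longrightarrow> p a > 0 \<Longrightarrow> f a > 0"
    and "(\<Sum>a\<in>A. p a) = 1" "\<delta> > 0"
  shows "\<forall>\<^sub>F s in at_right 0. (\<Sum>a\<in>A. p a * f a powr s) \<le> 2 powr (s * ((\<Sum>a\<in>A. p a * log 2 (f a)) + \<delta>))"
proof -
  define E where "E = (\<Sum>a\<in>A. p a * log 2 (f a))"
  define \<psi> where "\<psi> s = (\<Sum>a\<in>A. p a * exp (s * ln (f a))) - exp (s * ((E + \<delta>) * ln 2))" for s :: real
  have "(\<psi> has_real_derivative (\<Sum>a\<in>A. p a * ln (f a)) - (E + \<delta>) * ln 2) (at 0)"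
    unfolding \<psi>_def by (auto intro!: derivative_eq_intros simp: mult.commute)
  moreover have "(\<Sum>a\<in>A. p a * ln (f a)) = E * ln 2"
    by (simp add: E_def log_def sum_distrib_right)
  moreover have "E * ln 2 - (E + \<delta>) * ln 2 < 0"
    using assms(5) by (simp add: algebra_simps)
  ultimately obtain d where d: "d > 0" "\<And>h. h > 0 \<Longrightarrow> h < d \<Longrightarrow> \<psi> (0 + h) < \<psi> 0"
    using DERIV_neg_dec_right[of \<psi> _ 0] by metis
  have "\<psi> 0 = 0"
    using assms(4) by (simp add: \<psi>_def)
  have "(\<Sum>a\<in>A. p a * f a powr s) \<le> 2 powr (s * (E + \<delta>))" if "s > 0" "s < d" for s
  proof -
    have "(\<Sum>a\<in>A. p a * f a powr s) = (\<Sum>a\<in>A. p a * exp (s * ln (f a)))"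
    proof (rule sum.cong)
      fix a assume "a \<in> A"
      then show "p a * f a powr s = p a * exp (s * ln (f a))"
        using assms(2,3)[OF \<open>a \<in> A\<close>] by (cases "p a = 0") (auto simp: powr_def)
    qed simp
    then show ?thesis
      using d(2)[OF that] \<open>\<psi> 0 = 0\<close> by (simp add: \<psi>_def powr_def algebra_simps)
  qed
  then show ?thesis
    unfolding E_def[symmetric] eventually_at_right_field using d(1) by auto
qed

section \<open>Marginal channels and codes\<close>

definition recv_chan :: "nat \<Rightarrow> ('x::finite, 'y::finite) bchan \<Rightarrow> nat \<Rightarrow> nat \<Rightarrow> 'x \<Rightarrow> 'y \<Rightarrow> real" where
  "recv_chan K W j r x y = (\<Sum>v\<in>{v\<in>outs K. v r = y}. W j x v)"

definition pair_chan :: "nat \<Rightarrow> ('x::finite, 'y::finite) bchan \<Rightarrow> nat \<Rightarrow> nat \<Rightarrow> 'x \<Rightarrow> 'y \<Rightarrow> 'y \<Rightarrow> real" where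
  "pair_chan K W j i x y z = (\<Sum>v\<in>{v\<in>outs K. v i = y \<and> v K = z}. W j x v)"

lemma joint_XYiYe_eq: "joint_XYiYe K W j i p x y z = p x * pair_chan K W j i x y z"
  by (simp add: joint_XYiYe_def pair_chan_def)

lemma finite_outs [simp]: "finite (outs K :: (nat \<Rightarrow> 'y::finite) set)"
  by (auto simp: outs_def intro!: finite_PiE)

lemma finite_codewords [simp]: "finite (codewords M n :: (nat \<times> nat \<Rightarrow> 'x::finite) set)"
  by (auto simp: codewords_def intro!: finite_PiE)

lemma finite_outwords [simp]: "finite (outwords M n K :: (nat \<times> nat \<Rightarrow> nat \<Rightarrow> 'y::finite) set)"
  by (auto simp: outwords_def intro!: finite_PiE)

lemma recv_chan_eq_sum_pair_chan: "recv_chan K W j K x z = (\<Sum>y\<in>UNIV. pair_chan K W j i x y z)"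
proof -
  have "(\<Sum>y\<in>UNIV. \<Sum>v\<in>{v\<in>{v\<in>outs K. v K = z}. v i = y}. W j x v) = (\<Sum>v\<in>{v\<in>outs K. v K = z}. W j x v)"
    by (rule sum.group) auto
  then show ?thesis
    by (simp add: recv_chan_def pair_chan_def conj_ac)
qed

lemma recv_chan_eq_sum_pair_chan': "recv_chan K W j i x y = (\<Sum>z\<in>UNIV. pair_chan K W j i x y z)"
proof -
  have "(\<Sum>z\<in>UNIV. \<Sum>v\<in>{v\<in>{v\<in>outs K. v i = y}. v K = z}. W j x v) = (\<Sum>v\<in>{v\<in>outs K. v i = y}. W j x v)"
    by (rule sum.group) auto
  then show ?thesis
    by (simp add: recv_chan_def pair_chan_def conj_ac)
qed

lemma sum_outs_pair:
  "(\<Sum>v\<in>outs K. W j x v * f (v i) (v K)) = (\<Sum>y\<in>UNIV. \<Sum>z\<in>UNIV. pair_chan K W j i x y z * f y z)"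
proof -
  have "(\<Sum>v\<in>outs K. W j x v * f (v i) (v K))
      = (\<Sum>a\<in>UNIV. \<Sum>v\<in>{v\<in>outs K. (v i, v K) = a}. W j x v * f (v i) (v K))"
    by (rule sum.group[symmetric]) auto
  also have "\<dots> = (\<Sum>a\<in>UNIV. pair_chan K W j i x (fst a) (snd a) * f (fst a) (snd a))"
    by (auto intro!: sum.cong simp: pair_chan_def sum_distrib_right)
  finally show ?thesis
    by (simp add: UNIV_Times_UNIV[symmetric] sum.cartesian_product split_beta del: UNIV_Times_UNIV)
qed

text \<open>Only one observer's coordinate enters \<open>F\<close>, so the correlation between the
  outputs of different receivers sums out and the product of marginal channels remains.\<close>

lemma sum_chan_prob_obs:
  fixes W :: "('x::finite, 'y::finite) bchan"
  shows "(\<Sum>out\<in>outwords M n K. chan_prob M n W xs out * F (obs M n r out))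
       = (\<Sum>y\<in>codewords M n. (\<Prod>k\<in>{..<M} \<times> {..<n}. recv_chan K W (fst k) r (xs k) (y k)) * F y)"
  unfolding outwords_def chan_prob_def obs_def codewords_def recv_chan_def
  by (rule sum_PiE_prod_pushforward[where \<phi> = "\<lambda>v. v r"]) auto

lemma sum_chan_prob_obs_eq:
  fixes W :: "('x::finite, 'y::finite) bchan"
  assumes "ye \<in> codewords M n"
  shows "(\<Sum>out\<in>{out\<in>outwords M n K. obs M n r out = ye}. chan_prob M n W xs out)
       = (\<Prod>k\<in>{..<M} \<times> {..<n}. recv_chan K W (fst k) r (xs k) (ye k))"
proof -
  have "(\<Sum>out\<in>{out\<in>outwords M n K. obs M n r out = ye}. chan_prob M n W xs out)
      = (\<Sum>out\<in>outwords M n K. chan_prob M n W xs out * of_bool (obs M n r out = ye))"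
    by (intro sum.mono_neutral_cong_left) auto
  also have "\<dots> = (\<Sum>y\<in>codewords M n. (\<Prod>k\<in>{..<M} \<times> {..<n}. recv_chan K W (fst k) r (xs k) (y k)) * of_bool (y = ye))"
    by (rule sum_chan_prob_obs)
  also have "\<dots> = (\<Sum>y\<in>{ye}. \<Prod>k\<in>{..<M} \<times> {..<n}. recv_chan K W (fst k) r (xs k) (y k))"
    using assms by (intro sum.mono_neutral_cong_right) auto
  finally show ?thesis by simp
qed

section \<open>Marginal laws, mutual information and its moments\<close>

locale channel =
  fixes M K :: nat and W :: "('x::finite, 'y::finite) bchan"
  assumes valid: "valid_channel M K W"
begin

lemma W_nonneg: "j < M \<Longrightarrow> v \<in> outs K \<Longrightarrow> W j x v \<ge> 0"
  and W_sum: "j < M \<Longrightarrow> (\<Sum>v\<in>outs K. W j x v) = 1"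
  using valid by (auto simp: valid_channel_def)

definition out_law :: "('x \<Rightarrow> real) \<Rightarrow> nat \<Rightarrow> nat \<Rightarrow> 'y \<Rightarrow> real" where
  "out_law p j r y = (\<Sum>x\<in>UNIV. p x * recv_chan K W j r x y)"

definition mutual_info :: "('x \<Rightarrow> real) \<Rightarrow> nat \<Rightarrow> nat \<Rightarrow> real" where
  "mutual_info p j r = (\<Sum>x\<in>UNIV. \<Sum>y\<in>UNIV. p x * recv_chan K W j r x y * log 2 (recv_chan K W j r x y / out_law p j r y))"

text \<open>Moment of the likelihood ratio under the joint law of input and output. For
  \<open>j < M\<close> and an input distribution \<open>p\<close>, its logarithm divided by
  \<open>s\<close> is the Renyi divergence of order \<open>1 + s\<close> between the joint law and
  the product of its marginals, which tends to the mutual information as \<open>s\<close> tends to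
  0.\<close>

definition info_moment :: "('x \<Rightarrow> real) \<Rightarrow> nat \<Rightarrow> nat \<Rightarrow> real \<Rightarrow> real" where
  "info_moment p j r s = (\<Sum>x\<in>UNIV. \<Sum>y\<in>UNIV. p x * recv_chan K W j r x y * (recv_chan K W j r x y / out_law p j r y) powr s)"

lemma recv_chan_nonneg: "j < M \<Longrightarrow> recv_chan K W j r x y \<ge> 0"
  unfolding recv_chan_def by (intro sum_nonneg) (auto simp: W_nonneg)

lemma pair_chan_nonneg: "j < M \<Longrightarrow> pair_chan K W j i x y z \<ge> 0"
  unfolding pair_chan_def by (intro sum_nonneg) (auto simp: W_nonneg)

lemma recv_chan_sum: "j < M \<Longrightarrow> (\<Sum>y\<in>UNIV. recv_chan K W j r x y) = 1"
  unfolding recv_chan_def by (subst sum.group) (auto simp: W_sum)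

lemma out_law_nonneg: "j < M \<Longrightarrow> is_dist p \<Longrightarrow> out_law p j r y \<ge> 0"
  unfolding out_law_def is_dist_def by (intro sum_nonneg mult_nonneg_nonneg recv_chan_nonneg) auto

lemma out_law_sum: "j < M \<Longrightarrow> is_dist p \<Longrightarrow> (\<Sum>y\<in>UNIV. out_law p j r y) = 1"
  unfolding out_law_def by (subst sum.swap) (simp add: recv_chan_sum is_dist_def flip: sum_distrib_left)

lemma out_law_pos:
  assumes "j < M" "is_dist p" "p x > 0" "recv_chan K W j r x y > 0"
  shows "out_law p j r y > 0"
proof -
  have "0 < p x * recv_chan K W j r x y" using assms by simp
  also have "\<dots> \<le> out_law p j r y"
    unfolding out_law_def
    by (rule member_le_sum[of x UNIV "\<lambda>x. p x * recv_chan K W j r x y"])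
       (use assms in \<open>auto simp: is_dist_def recv_chan_nonneg\<close>)
  finally show ?thesis .
qed

lemma chan_prob_nonneg: "out \<in> outwords M n K \<Longrightarrow> chan_prob M n W xs out \<ge> 0"
  unfolding chan_prob_def outwords_def by (intro prod_nonneg) (auto simp: W_nonneg PiE_iff)

lemma chan_prob_sum: "(\<Sum>out\<in>outwords M n K. chan_prob M n W xs out) = 1"
  unfolding chan_prob_def outwords_def by (rule sum_PiE_prod_one) (auto simp: W_sum)

end

section \<open>The joint law induced by a code\<close>

locale wiretap_code = channel M K W
  for M K :: nat and W :: "('x::finite, 'y::finite) bchan" +
  fixes n N :: nat and enc :: "nat \<Rightarrow> (nat \<times> nat \<Rightarrow> 'x) \<Rightarrow> real"
  assumes n_pos: "n > 0" and N_pos: "N > 0" and valid_enc: "valid_encoder M n N enc"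
begin

abbreviation I :: "(nat \<times> nat) set" where "I \<equiv> {..<M} \<times> {..<n}"

lemma enc_nonneg: "w \<in> {1..N} \<Longrightarrow> xs \<in> codewords M n \<Longrightarrow> enc w xs \<ge> 0"
  and enc_sum: "w \<in> {1..N} \<Longrightarrow> (\<Sum>xs\<in>codewords M n. enc w xs) = 1"
  using valid_enc by (auto simp: valid_encoder_def)

text \<open>Law of message, input block and output block for a uniform message. Equivocation and
  error probability are both expectations under it, so that one inequality can treat them
  together.\<close>

definition joint_prob :: "nat \<times> (nat \<times> nat \<Rightarrow> 'x) \<times> (nat \<times> nat \<Rightarrow> nat \<Rightarrow> 'y) \<Rightarrow> real" where
  "joint_prob = (\<lambda>(w, xs, out). 1 / real N * enc w xs * chan_prob M n W xs out)"

definition atoms :: "(nat \<times> (nat \<times> nat \<Rightarrow> 'x) \<times> (nat \<times> nat \<Rightarrow> nat \<Rightarrow> 'y)) set" where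
  "atoms = {1..N} \<times> codewords M n \<times> outwords M n K"

lemma finite_atoms: "finite atoms"
  by (simp add: atoms_def)

lemma joint_prob_nonneg: "a \<in> atoms \<Longrightarrow> joint_prob a \<ge> 0"
  by (auto simp: joint_prob_def atoms_def enc_nonneg chan_prob_nonneg)

lemma sum_joint_prob:
  "(\<Sum>a\<in>atoms. joint_prob a * (case a of (w, xs, out) \<Rightarrow> f w xs out))
   = (\<Sum>w\<in>{1..N}. \<Sum>xs\<in>codewords M n. 1 / real N * enc w xs * (\<Sum>out\<in>outwords M n K. chan_prob M n W xs out * f w xs out))"
  by (simp add: atoms_def joint_prob_def sum.cartesian_product sum_distrib_left split_beta mult_ac)

lemma joint_prob_sum: "(\<Sum>a\<in>atoms. joint_prob a) = 1"
proof -
  have "(\<Sum>a\<in>atoms. joint_prob a) = (\<Sum>w\<in>{1..N}. 1 / real N * (\<Sum>xs\<in>codewords M n. enc w xs))"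
    using sum_joint_prob[of "\<lambda>_ _ _. 1"] by (simp add: chan_prob_sum sum_distrib_left split_def)
  then show ?thesis
    using N_pos by (simp add: enc_sum)
qed

definition pYe :: "(nat \<times> nat \<Rightarrow> 'y) \<Rightarrow> real" where
  "pYe ye = (\<Sum>w\<in>{1..N}. pWYe M K n W N enc w ye)"

lemma pWYe_eq:
  assumes "ye \<in> codewords M n"
  shows "pWYe M K n W N enc w ye
    = (\<Sum>xs\<in>codewords M n. 1 / real N * enc w xs * (\<Prod>k\<in>I. recv_chan K W (fst k) K (xs k) (ye k)))"
  unfolding pWYe_def sum_chan_prob_obs_eq[OF assms] by (simp add: sum_distrib_left mult_ac)

lemma pWYe_nonneg: "w \<in> {1..N} \<Longrightarrow> pWYe M K n W N enc w ye \<ge> 0"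
  unfolding pWYe_def
  by (intro mult_nonneg_nonneg sum_nonneg) (auto simp: enc_nonneg chan_prob_nonneg)

lemma sum_joint_prob_obs_Ye:
  "(\<Sum>a\<in>atoms. joint_prob a * (case a of (w, xs, out) \<Rightarrow> f w (obs M n K out)))
   = (\<Sum>w\<in>{1..N}. \<Sum>ye\<in>codewords M n. pWYe M K n W N enc w ye * f w ye)"
proof -
  have "(\<Sum>xs\<in>codewords M n. 1 / real N * enc w xs * (\<Sum>out\<in>outwords M n K. chan_prob M n W xs out * f w (obs M n K out)))
     = (\<Sum>ye\<in>codewords M n. pWYe M K n W N enc w ye * f w ye)" for w
    unfolding sum_chan_prob_obs
    by (simp add: pWYe_eq sum_distrib_left sum_distrib_right sum.swap[of _ "codewords M n :: (nat \<times> nat \<Rightarrow> 'y) set"] mult_ac)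
  then show ?thesis
    by (subst sum_joint_prob) simp
qed

lemma pYe_sum: "(\<Sum>ye\<in>codewords M n. pYe ye) = 1"
  using sum_joint_prob_obs_Ye[of "\<lambda>_ _. 1"] joint_prob_sum
  by (simp add: pYe_def split_def sum.swap[of _ "codewords M n :: (nat \<times> nat \<Rightarrow> 'y) set"])

lemma equivocation_eq:
  "equivocation M K n W N enc =
   - (\<Sum>a\<in>atoms. joint_prob a * (case a of (w, xs, out) \<Rightarrow>
        log 2 (pWYe M K n W N enc w (obs M n K out) / pYe (obs M n K out))))"
proof -
  have "(if q = 0 then 0 else q * c) = q * c" for q c :: real
    by simp
  then show ?thesis
    unfolding equivocation_def sum_joint_prob_obs_Ye[of "\<lambda>w ye. log 2 (pWYe M K n W N enc w ye / pYe ye)"]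
    by (simp add: pYe_def)
qed

lemma err_prob_eq:
  "err_prob M K n W N enc dec i =
   (\<Sum>a\<in>atoms. joint_prob a * (case a of (w, xs, out) \<Rightarrow> of_bool (dec i (obs M n i out) \<noteq> w)))"
proof -
  have "(\<Sum>out\<in>{out\<in>outwords M n K. dec i (obs M n i out) \<noteq> w}. chan_prob M n W xs out)
     = (\<Sum>out\<in>outwords M n K. chan_prob M n W xs out * of_bool (dec i (obs M n i out) \<noteq> w))" for w xs
    by (intro sum.mono_neutral_cong_left) auto
  then show ?thesis
    by (subst sum_joint_prob) (simp add: err_prob_def sum_distrib_left mult_ac)
qed

section \<open>Converse\<close>

definition pX :: "nat \<Rightarrow> nat \<Rightarrow> 'x \<Rightarrow> real" where
  "pX j t x = (\<Sum>w\<in>{1..N}. \<Sum>xs\<in>codewords M n. 1 / real N * enc w xs * of_bool (xs (j, t) = x))"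

definition pX_avg :: "nat \<Rightarrow> 'x \<Rightarrow> real" where
  "pX_avg j x = 1 / real n * (\<Sum>t<n. pX j t x)"

lemma sum_pX: "(\<Sum>w\<in>{1..N}. \<Sum>xs\<in>codewords M n. 1 / real N * enc w xs * f (xs (j, t))) = (\<Sum>x\<in>UNIV. pX j t x * f x)"
proof -
  have "(\<Sum>x\<in>UNIV. pX j t x * f x)
      = (\<Sum>w\<in>{1..N}. \<Sum>xs\<in>codewords M n. 1 / real N * enc w xs * (\<Sum>x\<in>UNIV. of_bool (xs (j, t) = x) * f x))"
    unfolding pX_def sum_distrib_right sum_distrib_left mult.assoc
    by (subst sum.swap, rule sum.cong[OF refl], subst sum.swap) (rule refl)
  moreover have "(\<Sum>x\<in>UNIV. of_bool (x0 = x) * f x) = f x0" for x0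
    by (subst sum.remove[of _ x0]) auto
  ultimately show ?thesis by (simp only:)
qed

lemma pX_nonneg: "pX j t x \<ge> 0"
  unfolding pX_def by (intro sum_nonneg) (auto simp: enc_nonneg)

lemma is_dist_pX_avg: "is_dist (pX_avg j)"
proof -
  have "(\<Sum>x\<in>UNIV. pX j t x) = 1" for t
    using sum_pX[of "\<lambda>_. 1" j t] N_pos by (simp add: sum_divide_distrib[symmetric] enc_sum)
  then have "(\<Sum>x\<in>UNIV. \<Sum>t<n. pX j t x) = real n"
    by (subst sum.swap) simp
  then show ?thesis
    unfolding is_dist_def pX_avg_def using n_pos
    by (simp add: sum_nonneg pX_nonneg flip: sum_divide_distrib)
qed

text \<open>A letter that the encoder really uses contributes its own mass to the time average.
  Hence the ratios formed with the averaged law are positive wherever the code and the channel put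
  mass.\<close>

lemma pX_avg_pos:
  assumes "w \<in> {1..N}" "xs \<in> codewords M n" "enc w xs > 0" "t < n"
  shows "pX_avg j (xs (j, t)) > 0"
proof -
  let ?x = "xs (j, t)"
  have "0 < 1 / real N * enc w xs * of_bool (xs (j, t) = ?x)"
    using assms N_pos by simp
  also have "\<dots> \<le> (\<Sum>xs'\<in>codewords M n. 1 / real N * enc w xs' * of_bool (xs' (j, t) = ?x))"
    by (rule member_le_sum[of xs]) (use assms enc_nonneg in auto)
  also have "\<dots> \<le> pX j t ?x"
    unfolding pX_def
    by (rule member_le_sum[where f = "\<lambda>w. \<Sum>xs'\<in>codewords M n. 1 / real N * enc w xs' * of_bool (xs' (j, t) = ?x)"])
       (use assms in \<open>auto intro!: sum_nonneg simp: enc_nonneg\<close>)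
  also have "\<dots> \<le> (\<Sum>t<n. pX j t ?x)"
    by (rule member_le_sum[of t "{..<n}" "\<lambda>t. pX j t ?x"]) (use assms pX_nonneg in auto)
  finally show ?thesis
    using n_pos by (simp add: pX_avg_def)
qed

section \<open>Single-letter information ratios for the averaged input law\<close>

definition avg_joint :: "nat \<Rightarrow> nat \<Rightarrow> 'x \<Rightarrow> 'y \<Rightarrow> 'y \<Rightarrow> real" where
  "avg_joint i j x y z = joint_XYiYe K W j i (pX_avg j) x y z"

text \<open>The argument of the logarithm in \<open>cmi\<close>, that is p(x,y|z) / (p(x|z) p(y|z))
  for the averaged input law.\<close>

definition info_ratio :: "nat \<Rightarrow> nat \<Rightarrow> 'x \<Rightarrow> 'y \<Rightarrow> 'y \<Rightarrow> real" where
  "info_ratio i j x y z = avg_joint i j x y z * (\<Sum>x'\<in>UNIV. \<Sum>y'\<in>UNIV. avg_joint i j x' y' z)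
     / ((\<Sum>y'\<in>UNIV. avg_joint i j x y' z) * (\<Sum>x'\<in>UNIV. avg_joint i j x' y z))"

definition cond_YZ :: "nat \<Rightarrow> nat \<Rightarrow> 'y \<Rightarrow> 'y \<Rightarrow> real" where
  "cond_YZ i j y z = (\<Sum>x'\<in>UNIV. avg_joint i j x' y z) / (\<Sum>x'\<in>UNIV. \<Sum>y'\<in>UNIV. avg_joint i j x' y' z)"

lemma avg_joint_nonneg: "j < M \<Longrightarrow> avg_joint i j x y z \<ge> 0"
  using is_dist_pX_avg[of j] by (simp add: avg_joint_def joint_XYiYe_eq pair_chan_nonneg is_dist_def)

lemma cond_YZ_nonneg: "j < M \<Longrightarrow> cond_YZ i j y z \<ge> 0"
  unfolding cond_YZ_def by (intro divide_nonneg_nonneg sum_nonneg avg_joint_nonneg)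

text \<open>Only an inequality, since a symbol \<open>z\<close> of probability 0 gives quotients by
  0, which are 0.\<close>

lemma cond_YZ_sum: "j < M \<Longrightarrow> (\<Sum>y\<in>UNIV. cond_YZ i j y z) \<le> 1"
  unfolding cond_YZ_def sum_divide_distrib[symmetric]
  by (subst sum.swap) (auto simp: divide_le_eq_1 intro!: sum_nonneg avg_joint_nonneg)

lemma avg_joint_le:
  assumes "j < M"
  shows "avg_joint i j x y z \<le> (\<Sum>y'\<in>UNIV. avg_joint i j x y' z)"
    "avg_joint i j x y z \<le> (\<Sum>x'\<in>UNIV. avg_joint i j x' y z)"
    "avg_joint i j x y z \<le> (\<Sum>x'\<in>UNIV. \<Sum>y'\<in>UNIV. avg_joint i j x' y' z)"
proof -
  show 1: "avg_joint i j x y z \<le> (\<Sum>y'\<in>UNIV. avg_joint i j x y' z)"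
    by (rule member_le_sum[of y UNIV "\<lambda>y. avg_joint i j x y z"]) (auto simp: avg_joint_nonneg assms)
  show "avg_joint i j x y z \<le> (\<Sum>x'\<in>UNIV. avg_joint i j x' y z)"
    by (rule member_le_sum[of x UNIV "\<lambda>x. avg_joint i j x y z"]) (auto simp: avg_joint_nonneg assms)
  have "(\<Sum>y'\<in>UNIV. avg_joint i j x y' z) \<le> (\<Sum>x'\<in>UNIV. \<Sum>y'\<in>UNIV. avg_joint i j x' y' z)"
    by (rule member_le_sum[of x UNIV "\<lambda>x. \<Sum>y\<in>UNIV. avg_joint i j x y z"])
       (auto intro!: sum_nonneg simp: avg_joint_nonneg assms)
  with 1 show "avg_joint i j x y z \<le> (\<Sum>x'\<in>UNIV. \<Sum>y'\<in>UNIV. avg_joint i j x' y' z)"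
    by linarith
qed

lemma info_ratio_pos:
  assumes "j < M" "pX_avg j x > 0" "pair_chan K W j i x y z > 0"
  shows "info_ratio i j x y z > 0"
proof -
  have "avg_joint i j x y z > 0"
    using assms by (simp add: avg_joint_def joint_XYiYe_eq)
  then show ?thesis
    unfolding info_ratio_def using avg_joint_le[OF assms(1), of i x y z]
    by (intro divide_pos_pos mult_pos_pos) linarith+
qed

text \<open>Bayes' rule: dividing by the ratio exchanges the law of \<open>Y_i\<close> given
  \<open>(X, Y_e)\<close> for its law given \<open>Y_e\<close> alone. The right side depends on
  \<open>x\<close> only through the eavesdropper's channel, which lets the sum over inputs collapse
  to \<open>pWYe\<close> in the converse.\<close>

lemma pair_chan_div_info_ratio:
  assumes "j < M" "pX_avg j x > 0"
  shows "pair_chan K W j i x y z / info_ratio i j x y z \<le> recv_chan K W j K x z * cond_YZ i j y z"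
proof (cases "pair_chan K W j i x y z = 0")
  case True
  then show ?thesis
    using assms by (simp add: recv_chan_nonneg cond_YZ_nonneg)
next
  case False
  then have pos: "avg_joint i j x y z > 0"
    using assms pair_chan_nonneg[of j i x y z] by (simp add: avg_joint_def joint_XYiYe_eq less_le)
  have "(\<Sum>y'\<in>UNIV. avg_joint i j x y' z) = pX_avg j x * recv_chan K W j K x z"
    by (simp add: avg_joint_def joint_XYiYe_eq recv_chan_eq_sum_pair_chan[of K W j x z i] sum_distrib_left)
  then have "pair_chan K W j i x y z / info_ratio i j x y z = recv_chan K W j K x z * cond_YZ i j y z"
    using assms False pos avg_joint_le[OF assms(1), of i x y z] 
    by (simp add: info_ratio_def cond_YZ_def avg_joint_def joint_XYiYe_eq)
  then show ?thesis by simp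
qed

text \<open>The ratio is frozen at the averaged law, so the expected logarithm is linear in the law
  of each letter, and averaging over \<open>t\<close> yields the value at \<open>pX_avg\<close>
  exactly.\<close>

lemma sum_log_info_ratio:
  "(\<Sum>a\<in>atoms. joint_prob a * (case a of (w, xs, out) \<Rightarrow>
      \<Sum>k\<in>I. log 2 (info_ratio i (fst k) (xs k) (out k i) (out k K))))
   = real n * (\<Sum>j<M. cmi (joint_XYiYe K W j i (pX_avg j)))"
proof -
  define f where "f j x = (\<Sum>y\<in>UNIV. \<Sum>z\<in>UNIV. pair_chan K W j i x y z * log 2 (info_ratio i j x y z))" for j x
  have letter: "(\<Sum>out\<in>outwords M n K. chan_prob M n W xs out * log 2 (info_ratio i j (xs (j, t)) (out (j, t) i) (out (j, t) K)))
      = f j (xs (j, t))" if "j < M" "t < n" for xs j t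
  proof -
    have "(\<Sum>out\<in>outwords M n K. chan_prob M n W xs out * log 2 (info_ratio i j (xs (j, t)) (out (j, t) i) (out (j, t) K)))
      = (\<Sum>v\<in>outs K. W j (xs (j, t)) v * log 2 (info_ratio i j (xs (j, t)) (v i) (v K)))"
      unfolding outwords_def chan_prob_def
      using sum_PiE_prod_component[where B = I and S = "\<lambda>_. outs K" and m = "(j, t)" and p = "\<lambda>k. W (fst k) (xs k)"
          and f = "\<lambda>v. log 2 (info_ratio i j (xs (j, t)) (v i) (v K))"] that
      by (auto simp: W_sum)
    then show ?thesis
      unfolding f_def sum_outs_pair[of W j "xs (j, t)" "\<lambda>y z. log 2 (info_ratio i j (xs (j, t)) y z)" i K] .
  qed
  have "(\<Sum>a\<in>atoms. joint_prob a * (case a of (w, xs, out) \<Rightarrow>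
      \<Sum>k\<in>I. log 2 (info_ratio i (fst k) (xs k) (out k i) (out k K))))
    = (\<Sum>k\<in>I. \<Sum>w\<in>{1..N}. \<Sum>xs\<in>codewords M n. 1 / real N * enc w xs *
       (\<Sum>out\<in>outwords M n K. chan_prob M n W xs out * log 2 (info_ratio i (fst k) (xs k) (out k i) (out k K))))"
    unfolding sum_joint_prob sum_distrib_left
    by (simp only: sum.swap[of _ I])
  also have "\<dots> = (\<Sum>j<M. \<Sum>t<n. \<Sum>w\<in>{1..N}. \<Sum>xs\<in>codewords M n. 1 / real N * enc w xs * f j (xs (j, t)))"
    by (simp add: sum.cartesian_product' letter)
  also have "\<dots> = (\<Sum>j<M. \<Sum>t<n. \<Sum>x\<in>UNIV. pX j t x * f j x)"
    by (simp only: sum_pX)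
  also have "\<dots> = (\<Sum>j<M. real n * (\<Sum>x\<in>UNIV. pX_avg j x * f j x))"
    using n_pos by (simp add: pX_avg_def sum_distrib_left sum_distrib_right sum.swap[of _ "UNIV :: 'x set"])
  also have "\<dots> = (\<Sum>j<M. real n * cmi (joint_XYiYe K W j i (pX_avg j)))"
  proof (intro sum.cong refl arg_cong2[where f = times])
    fix j
    have *: "(if q = 0 then 0 else q * c) = q * c" for q c :: real
      by simp
    show "(\<Sum>x\<in>UNIV. pX_avg j x * f j x) = cmi (joint_XYiYe K W j i (pX_avg j))"
      unfolding cmi_def * f_def info_ratio_def avg_joint_def
      by (simp add: joint_XYiYe_eq sum_distrib_left mult_ac)
  qed
  finally show ?thesis
    by (simp add: sum_distrib_left)
qed


text \<open>The estimate combines Fano's inequality with single-letterization: it is Jensen's inequality for the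
  logarithm of \<open>q(w|y) / (p(w|z) \<Prod> r)\<close>, where \<open>q(w|y)\<close> guesses the decoded message with probability
  \<open>1 - \<epsilon>\<close> and \<open>r\<close> is the single-letter information ratio of the time-averaged input law. Averaging
  inside \<open>r\<close> makes a separate concavity argument unnecessary.\<close>
lemma equivocation_le:
  assumes err: "err_prob M K n W N enc dec i \<le> \<epsilon>" and eps: "0 < \<epsilon>" "\<epsilon> < 1"
  shows "equivocation M K n W N enc
    \<le> real n * (\<Sum>j<M. cmi (joint_XYiYe K W j i (pX_avg j))) - log 2 (1 - \<epsilon>) + \<epsilon> * log 2 (real N / \<epsilon>)"
proof -
  \<comment> \<open>The mass \<open>\<epsilon>\<close> is spread over all \<open>N\<close> messages
    to keep \<open>q\<close> positive on decoding errors. The total stays at most 1, also if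
    \<open>dec\<close> returns no element of \<open>{1..N}\<close>.\<close>
  define q where "q w y = (if dec i y = w then 1 - \<epsilon> else \<epsilon> / real N)" for w y
  define ratio where "ratio xs u = (\<Prod>k\<in>I. info_ratio i (fst k) (xs k) (fst (u k)) (snd (u k)))"
    for xs and u :: "nat \<times> nat \<Rightarrow> 'y \<times> 'y"
  \<comment> \<open>Both observed words as one word over pairs, so that
    \<open>sum_PiE_prod_pushforward\<close> applies once to the pair; \<open>y\<close> and
    \<open>z\<close> recover the two words.\<close>
  define obs2 where "obs2 out = restrict (\<lambda>k. (out k i, out k K)) I" for out :: "nat \<times> nat \<Rightarrow> nat \<Rightarrow> 'y"
  define y where "y u = restrict (\<lambda>k. fst (u k)) I" for u :: "nat \<times> nat \<Rightarrow> 'y \<times> 'y"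
  define z where "z u = restrict (\<lambda>k. snd (u k)) I" for u :: "nat \<times> nat \<Rightarrow> 'y \<times> 'y"
  define Z where "Z w xs u = q w (y u) * pYe (z u) / (pWYe M K n W N enc w (z u) * ratio xs u)" for w xs u
  define U where "U = (PiE I (\<lambda>_. UNIV) :: (nat \<times> nat \<Rightarrow> 'y \<times> 'y) set)"
  have y_obs2: "y (obs2 out) = obs M n i out" and z_obs2: "z (obs2 out) = obs M n K out" for out
    by (auto simp: y_def z_def obs2_def obs_def)
  have z_in: "z u \<in> codewords M n" for u
    by (auto simp: z_def codewords_def)
  have q_pos: "q w v > 0" for w v
    using eps N_pos by (simp add: q_def)
  have q_sum: "(\<Sum>w\<in>{1..N}. q w v) \<le> 1" for v
  proof -
    have "(\<Sum>w\<in>{1..N}. q w v) \<le> (\<Sum>w\<in>{1..N}. of_bool (w = dec i v) * (1 - \<epsilon>) + \<epsilon> / real N)"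
      using eps N_pos by (intro sum_mono) (auto simp: q_def)
    also have "\<dots> = real (card ({1..N} \<inter> {dec i v})) * (1 - \<epsilon>) + \<epsilon>"
      using N_pos by (auto simp: sum.distrib simp flip: sum_distrib_right)
    also have "\<dots> \<le> 1 * (1 - \<epsilon>) + \<epsilon>"
      using eps card_mono[of "{dec i v}" "{1..N} \<inter> {dec i v}"] by (intro add_right_mono mult_right_mono) auto
    finally show ?thesis by simp
  qed
  have supp: "pWYe M K n W N enc w (obs M n K out) > 0" "pYe (obs M n K out) > 0" "ratio xs (obs2 out) > 0"
    "\<And>k. k \<in> I \<Longrightarrow> info_ratio i (fst k) (xs k) (out k i) (out k K) > 0"
    if a: "(w, xs, out) \<in> atoms" and pos: "joint_prob (w, xs, out) > 0" for w xs out
  proof -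
    from a have w: "w \<in> {1..N}" "xs \<in> codewords M n" "out \<in> outwords M n K"
      by (auto simp: atoms_def)
    have e: "enc w xs > 0" and c: "chan_prob M n W xs out > 0"
      using pos enc_nonneg[OF w(1,2)] chan_prob_nonneg[OF w(3), of xs] N_pos
      by (auto simp: joint_prob_def zero_less_mult_iff zero_less_divide_iff)
    have "chan_prob M n W xs out \<le> (\<Sum>out'\<in>{out'\<in>outwords M n K. obs M n K out' = obs M n K out}. chan_prob M n W xs out')"
      by (rule member_le_sum) (use w chan_prob_nonneg in auto)
    then have "0 < enc w xs * (\<Sum>out'\<in>{out'\<in>outwords M n K. obs M n K out' = obs M n K out}. chan_prob M n W xs out')"
      using e c by simp
    also have "\<dots> \<le> (\<Sum>xs\<in>codewords M n. enc w xs * (\<Sum>out'\<in>{out'\<in>outwords M n K. obs M n K out' = obs M n K out}. chan_prob M n W xs out'))"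
      by (rule member_le_sum[of xs]) (use w enc_nonneg in \<open>auto intro!: mult_nonneg_nonneg sum_nonneg chan_prob_nonneg\<close>)
    finally show p: "pWYe M K n W N enc w (obs M n K out) > 0"
      using N_pos by (simp add: pWYe_def)
    also have "pWYe M K n W N enc w (obs M n K out) \<le> pYe (obs M n K out)"
      unfolding pYe_def by (rule member_le_sum) (use w pWYe_nonneg in auto)
    finally show "pYe (obs M n K out) > 0" .
    show r: "info_ratio i (fst k) (xs k) (out k i) (out k K) > 0" if k: "k \<in> I" for k
    proof -
      obtain j t where jt: "k = (j, t)" "j < M" "t < n" using k by auto
      have o: "out k \<in> outs K" using w(3) k by (auto simp: outwords_def)
      have "W j (xs k) (out k) \<noteq> 0"
      proof
        assume "W j (xs k) (out k) = 0"
        then have "chan_prob M n W xs out = 0"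
          unfolding chan_prob_def using k jt by (intro prod_zero bexI[of _ k]) auto
        with c show False by simp
      qed
      then have "0 < W j (xs k) (out k)"
        using W_nonneg[OF jt(2) o, of "xs k"] by simp
      also have "\<dots> \<le> pair_chan K W j i (xs k) (out k i) (out k K)"
        unfolding pair_chan_def by (rule member_le_sum) (use W_nonneg jt o in auto)
      finally show ?thesis
        using info_ratio_pos[OF jt(2)] pX_avg_pos[OF w(1,2) e jt(3)] jt by simp
    qed
    then show "ratio xs (obs2 out) > 0"
      unfolding ratio_def by (intro prod_pos) (simp add: obs2_def)
  qed
  have ratio_bound: "enc w xs * (\<Prod>k\<in>I. pair_chan K W (fst k) i (xs k) (fst (u k)) (snd (u k))) / ratio xs u
      \<le> enc w xs * (\<Prod>k\<in>I. recv_chan K W (fst k) K (xs k) (snd (u k))) * (\<Prod>k\<in>I. cond_YZ i (fst k) (fst (u k)) (snd (u k)))"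
    if "w \<in> {1..N}" "xs \<in> codewords M n" for w xs and u :: "nat \<times> nat \<Rightarrow> 'y \<times> 'y"
  proof (cases "enc w xs = 0")
    case False
    then have e: "enc w xs > 0" using enc_nonneg that by (simp add: less_le)
    have "(\<Prod>k\<in>I. pair_chan K W (fst k) i (xs k) (fst (u k)) (snd (u k))) / ratio xs u
        = (\<Prod>k\<in>I. pair_chan K W (fst k) i (xs k) (fst (u k)) (snd (u k)) / info_ratio i (fst k) (xs k) (fst (u k)) (snd (u k)))"
      by (simp add: ratio_def prod_dividef)
    also have "\<dots> \<le> (\<Prod>k\<in>I. recv_chan K W (fst k) K (xs k) (snd (u k)) * cond_YZ i (fst k) (fst (u k)) (snd (u k)))"
    proof (rule prod_mono)
      fix k assume k: "k \<in> I"
      then have "pX_avg (fst k) (xs k) > 0"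
        using pX_avg_pos[OF that e, of "snd k" "fst k"] by auto
      moreover from this have "0 \<le> info_ratio i (fst k) (xs k) (fst (u k)) (snd (u k))"
        unfolding info_ratio_def using k
        by (intro divide_nonneg_nonneg mult_nonneg_nonneg sum_nonneg) (auto simp: avg_joint_nonneg)
      ultimately show "0 \<le> pair_chan K W (fst k) i (xs k) (fst (u k)) (snd (u k)) / info_ratio i (fst k) (xs k) (fst (u k)) (snd (u k)) \<and>
         pair_chan K W (fst k) i (xs k) (fst (u k)) (snd (u k)) / info_ratio i (fst k) (xs k) (fst (u k)) (snd (u k))
         \<le> recv_chan K W (fst k) K (xs k) (snd (u k)) * cond_YZ i (fst k) (fst (u k)) (snd (u k))"
        using k pair_chan_div_info_ratio by (auto simp: pair_chan_nonneg)
    qed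
    finally show ?thesis
      using e by (simp add: prod.distrib mult.assoc flip: times_divide_eq_right)
  qed simp
  have cond_prod_nonneg: "(\<Prod>k\<in>I. cond_YZ i (fst k) (fst (u k)) (snd (u k))) \<ge> 0" for u :: "nat \<times> nat \<Rightarrow> 'y \<times> 'y"
    by (intro prod_nonneg) (auto simp: cond_YZ_nonneg)
  have pYe_nonneg: "pYe v \<ge> 0" for v
    unfolding pYe_def by (intro sum_nonneg pWYe_nonneg)
  \<comment> \<open>The mean of \<open>Z\<close>. After \<open>ratio_bound\<close> the sum over
    inputs gives \<open>pWYe\<close>, which cancels; then \<open>q\<close> sums over messages,
    \<open>cond_YZ\<close> over the receiver's word and \<open>pYe\<close> over the eavesdropper's
    word, each to at most 1.\<close>
  have "(\<Sum>a\<in>atoms. joint_prob a * (case a of (w, xs, out) \<Rightarrow> Z w xs (obs2 out))) \<le> 1"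
  proof -
    have "(\<Sum>a\<in>atoms. joint_prob a * (case a of (w, xs, out) \<Rightarrow> Z w xs (obs2 out)))
      = (\<Sum>w\<in>{1..N}. \<Sum>xs\<in>codewords M n. 1 / real N * enc w xs * (\<Sum>u\<in>U. (\<Prod>k\<in>I. pair_chan K W (fst k) i (xs k) (fst (u k)) (snd (u k))) * Z w xs u))"
      unfolding sum_joint_prob
      unfolding outwords_def chan_prob_def obs2_def U_def
      by (subst sum_PiE_prod_pushforward[where \<phi> = "\<lambda>v. (v i, v K)"]) (auto simp: pair_chan_def prod_eq_iff)
    also have "\<dots> = (\<Sum>w\<in>{1..N}. \<Sum>xs\<in>codewords M n. \<Sum>u\<in>U. 1 / real N * (q w (y u) * pYe (z u) / pWYe M K n W N enc w (z u))
          * (enc w xs * (\<Prod>k\<in>I. pair_chan K W (fst k) i (xs k) (fst (u k)) (snd (u k))) / ratio xs u))"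
      by (simp add: sum_distrib_left Z_def mult_ac)
    also have "\<dots> \<le> (\<Sum>w\<in>{1..N}. \<Sum>xs\<in>codewords M n. \<Sum>u\<in>U. 1 / real N * (q w (y u) * pYe (z u) / pWYe M K n W N enc w (z u))
          * (enc w xs * (\<Prod>k\<in>I. recv_chan K W (fst k) K (xs k) (snd (u k))) * (\<Prod>k\<in>I. cond_YZ i (fst k) (fst (u k)) (snd (u k)))))"
      by (intro sum_mono mult_left_mono ratio_bound mult_nonneg_nonneg divide_nonneg_nonneg)
         (auto simp: pWYe_nonneg pYe_nonneg less_imp_le[OF q_pos])
    also have "\<dots> = (\<Sum>w\<in>{1..N}. \<Sum>u\<in>U. (q w (y u) * pYe (z u) / pWYe M K n W N enc w (z u))
          * (\<Prod>k\<in>I. cond_YZ i (fst k) (fst (u k)) (snd (u k))) * (\<Sum>xs\<in>codewords M n. 1 / real N * enc w xs * (\<Prod>k\<in>I. recv_chan K W (fst k) K (xs k) (snd (u k)))))"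
      by (subst sum.swap[of _ U]) (simp add: sum_distrib_left sum_divide_distrib mult_ac)
    also have "\<dots> = (\<Sum>w\<in>{1..N}. \<Sum>u\<in>U. (q w (y u) * pYe (z u) / pWYe M K n W N enc w (z u))
          * (\<Prod>k\<in>I. cond_YZ i (fst k) (fst (u k)) (snd (u k))) * pWYe M K n W N enc w (z u))"
      unfolding pWYe_eq[OF z_in] by (simp add: z_def)
    \<comment> \<open>Where \<open>pWYe\<close> vanishes the quotient is 0, hence only an
      inequality.\<close>
    also have "\<dots> \<le> (\<Sum>w\<in>{1..N}. \<Sum>u\<in>U. q w (y u) * (pYe (z u) * (\<Prod>k\<in>I. cond_YZ i (fst k) (fst (u k)) (snd (u k)))))"
      by (intro sum_mono) (auto simp: cond_prod_nonneg pYe_nonneg less_imp_le[OF q_pos])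
    also have "\<dots> = (\<Sum>u\<in>U. (\<Sum>w\<in>{1..N}. q w (y u)) * (pYe (z u) * (\<Prod>k\<in>I. cond_YZ i (fst k) (fst (u k)) (snd (u k)))))"
      by (subst sum.swap) (simp add: sum_distrib_right)
    also have "\<dots> \<le> (\<Sum>u\<in>U. 1 * (pYe (z u) * (\<Prod>k\<in>I. cond_YZ i (fst k) (fst (u k)) (snd (u k)))))"
      by (intro sum_mono mult_right_mono q_sum mult_nonneg_nonneg pYe_nonneg cond_prod_nonneg)
    also have "\<dots> = (\<Sum>u\<in>PiE I (\<lambda>_. UNIV). (\<Prod>k\<in>I. cond_YZ i (fst k) (fst (u k)) (snd (u k))) * pYe (restrict (\<lambda>k. snd (u k)) I))"
      by (simp add: U_def z_def mult.commute)
    also have "\<dots> = (\<Sum>v\<in>codewords M n. (\<Prod>k\<in>I. \<Sum>a\<in>{a\<in>UNIV. snd a = v k}. cond_YZ i (fst k) (fst a) (snd a)) * pYe v)"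
      unfolding codewords_def
      by (rule sum_PiE_prod_pushforward[where p = "\<lambda>k a. cond_YZ i (fst k) (fst a) (snd a)" and \<phi> = snd]) auto
    also have "\<dots> \<le> (\<Sum>v\<in>codewords M n. 1 * pYe v)"
    proof (intro sum_mono mult_right_mono pYe_nonneg prod_le_1)
      fix v :: "nat \<times> nat \<Rightarrow> 'y" and k assume k: "k \<in> I"
      have "(\<Sum>a\<in>{a\<in>UNIV. snd a = v k}. cond_YZ i (fst k) (fst a) (snd a)) = (\<Sum>b\<in>UNIV. cond_YZ i (fst k) b (v k))"
        by (rule sum.reindex_bij_witness[of _ "\<lambda>b. (b, v k)" fst]) auto
      then show "0 \<le> (\<Sum>a\<in>{a\<in>UNIV. snd a = v k}. cond_YZ i (fst k) (fst a) (snd a)) \<and>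
           (\<Sum>a\<in>{a\<in>UNIV. snd a = v k}. cond_YZ i (fst k) (fst a) (snd a)) \<le> 1"
        using k cond_YZ_sum[of "fst k" i "v k"] by (auto intro!: sum_nonneg cond_YZ_nonneg)
    qed
    finally show ?thesis
      by (simp add: pYe_sum)
  qed
  then have "(\<Sum>a\<in>atoms. joint_prob a * log 2 (case a of (w, xs, out) \<Rightarrow> Z w xs (obs2 out))) \<le> 0"
  proof (intro sum_mult_log_le_0 finite_atoms joint_prob_nonneg joint_prob_sum)
    fix a assume a: "a \<in> atoms" "joint_prob a > 0"
    obtain w xs out where a': "a = (w, xs, out)" by (cases a)
    show "(case a of (w, xs, out) \<Rightarrow> Z w xs (obs2 out)) > 0"
      using supp(1-3)[OF a[unfolded a']] q_pos by (simp add: a' Z_def z_obs2)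
  qed
  also have "(\<Sum>a\<in>atoms. joint_prob a * log 2 (case a of (w, xs, out) \<Rightarrow> Z w xs (obs2 out)))
     = (\<Sum>a\<in>atoms. joint_prob a * (case a of (w, xs, out) \<Rightarrow> log 2 (q w (obs M n i out)))
         - joint_prob a * (case a of (w, xs, out) \<Rightarrow> log 2 (pWYe M K n W N enc w (obs M n K out) / pYe (obs M n K out)))
         - joint_prob a * (case a of (w, xs, out) \<Rightarrow> \<Sum>k\<in>I. log 2 (info_ratio i (fst k) (xs k) (out k i) (out k K))))"
  proof (intro sum.cong refl)
    fix a assume a: "a \<in> atoms"
    obtain w xs out where [simp]: "a = (w, xs, out)" by (cases a)
    show "joint_prob a * log 2 (case a of (w, xs, out) \<Rightarrow> Z w xs (obs2 out))
     = joint_prob a * (case a of (w, xs, out) \<Rightarrow> log 2 (q w (obs M n i out)))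
         - joint_prob a * (case a of (w, xs, out) \<Rightarrow> log 2 (pWYe M K n W N enc w (obs M n K out) / pYe (obs M n K out)))
         - joint_prob a * (case a of (w, xs, out) \<Rightarrow> \<Sum>k\<in>I. log 2 (info_ratio i (fst k) (xs k) (out k i) (out k K)))"
    proof (cases "joint_prob a = 0")
      case False
      then have "joint_prob (w, xs, out) > 0" "(w, xs, out) \<in> atoms"
        using joint_prob_nonneg[OF a] a by auto
      note s = supp[OF this(2,1)]
      have "log 2 (ratio xs (obs2 out)) = (\<Sum>k\<in>I. log 2 (info_ratio i (fst k) (xs k) (out k i) (out k K)))"
        using s(4) by (simp add: ratio_def obs2_def log_def ln_prod sum_divide_distrib less_imp_neq[symmetric])
      then show ?thesis
        using s q_pos[of w "obs M n i out"]
        by (simp add: Z_def y_obs2 z_obs2 log_divide log_mult algebra_simps)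
    qed simp
  qed
  finally have "(\<Sum>a\<in>atoms. joint_prob a * (case a of (w, xs, out) \<Rightarrow> log 2 (q w (obs M n i out))))
      + equivocation M K n W N enc - real n * (\<Sum>j<M. cmi (joint_XYiYe K W j i (pX_avg j))) \<le> 0"
    by (simp add: sum_subtractf equivocation_eq sum_log_info_ratio)
  \<comment> \<open>Fano's part: the logarithm of \<open>q\<close> is
    \<open>log 2 (1 - \<epsilon>)\<close> on correct decisions and
    \<open>- log 2 (N / \<epsilon>)\<close> on errors, where adding the nonpositive
    \<open>log 2 (1 - \<epsilon>)\<close> only lowers the bound.\<close>
  moreover have "(\<Sum>a\<in>atoms. joint_prob a * (case a of (w, xs, out) \<Rightarrow> log 2 (q w (obs M n i out))))
      \<ge> log 2 (1 - \<epsilon>) - \<epsilon> * log 2 (real N / \<epsilon>)"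
  proof -
    have "real N / \<epsilon> \<ge> 1"
      using eps N_pos by (simp add: divide_simps)
    then have l: "log 2 (real N / \<epsilon>) \<ge> 0" by simp
    have l': "log 2 (1 - \<epsilon>) \<le> 0" using eps by simp
    have "log 2 (1 - \<epsilon>) - \<epsilon> * log 2 (real N / \<epsilon>) \<le> log 2 (1 - \<epsilon>) - err_prob M K n W N enc dec i * log 2 (real N / \<epsilon>)"
      using err l by (simp add: mult_right_mono)
    also have "\<dots> = (\<Sum>a\<in>atoms. joint_prob a * (log 2 (1 - \<epsilon>) - (case a of (w, xs, out) \<Rightarrow> of_bool (dec i (obs M n i out) \<noteq> w)) * log 2 (real N / \<epsilon>)))"
      by (simp add: err_prob_eq right_diff_distrib sum_subtractf sum_distrib_right[symmetric] joint_prob_sum mult.assoc[symmetric])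
    also have "\<dots> \<le> (\<Sum>a\<in>atoms. joint_prob a * (case a of (w, xs, out) \<Rightarrow> log 2 (q w (obs M n i out))))"
    proof (intro sum_mono mult_left_mono joint_prob_nonneg)
      fix a :: "nat \<times> (nat \<times> nat \<Rightarrow> 'x) \<times> (nat \<times> nat \<Rightarrow> nat \<Rightarrow> 'y)"
      obtain w xs out where [simp]: "a = (w, xs, out)" by (cases a)
      show "log 2 (1 - \<epsilon>) - (case a of (w, xs, out) \<Rightarrow> of_bool (dec i (obs M n i out) \<noteq> w)) * log 2 (real N / \<epsilon>)
          \<le> (case a of (w, xs, out) \<Rightarrow> log 2 (q w (obs M n i out)))"
        using eps N_pos l' by (auto simp: q_def log_divide)
    qed
    finally show ?thesis .
  qed
  ultimately show ?thesis by linarith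
qed

end

section \<open>Existence of an optimal input law\<close>

lemma continuous_on_x_log_x: "continuous_on {0..} (\<lambda>x::real. x * log 2 x)"
proof (subst continuous_on_eq_continuous_within, intro ballI)
  fix x :: real assume "x \<in> {0..}"
  then consider "x = 0" | "x > 0" by fastforce
  then show "continuous (at x within {0..}) (\<lambda>x. x * log 2 x)"
  proof cases
    case 1
    have "((\<lambda>x. x * log 2 x) \<longlongrightarrow> 0) (at 0 within {0..})"
    proof (rule Lim_null_comparison)
      have "eventually (\<lambda>x::real. x \<in> {0<..<1}) (at 0 within {0..})"
        unfolding eventually_at by (intro exI[of _ 1]) (auto simp: dist_real_def)
      then show "eventually (\<lambda>x. norm (x * log 2 x) \<le> 2 / ln 2 * sqrt x) (at 0 within {0..})"
      proof eventually_elim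
        case (elim x)
        \<comment> \<open>Applying \<open>ln u \<le> u - 1\<close> at \<open>u = 1 / sqrt x\<close>
          instead of \<open>1 / x\<close> leaves a factor \<open>sqrt x\<close>, which forces the
          limit 0.\<close>
        have "ln (1 / sqrt x) \<le> 1 / sqrt x - 1"
          using elim by (intro ln_le_minus_one) auto
        then have "- ln x \<le> 2 / sqrt x"
          using elim by (simp add: ln_div ln_sqrt)
        then have "x * (- ln x) \<le> x * (2 / sqrt x)"
          using elim by (intro mult_left_mono) auto
        also have "\<dots> = 2 * sqrt x"
          using elim real_div_sqrt[of x] by (simp add: mult.commute[of x] flip: times_divide_eq_right)
        finally have "\<bar>x * ln x\<bar> \<le> 2 * sqrt x"
          using elim by (simp add: abs_mult abs_of_nonpos)
        then show ?case
          by (simp add: log_def abs_divide divide_right_mono)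
      qed
      have "((\<lambda>x::real. 2 / ln 2 * sqrt x) \<longlongrightarrow> 2 / ln 2 * sqrt 0) (at 0 within {0..})"
        by (intro tendsto_mult tendsto_const tendsto_real_sqrt tendsto_ident_at)
      then show "((\<lambda>x::real. 2 / ln 2 * sqrt x) \<longlongrightarrow> 0) (at 0 within {0..})"
        by simp
    qed
    then show ?thesis
      using 1 by (simp add: continuous_within)
  next
    case 2
    then show ?thesis
      by (intro continuous_intros) auto
  qed
qed

text \<open>Prepares continuity: the quotient in \<open>cmi\<close> breaks down where a probability
  vanishes, while \<open>\<eta>\<close> is continuous up to 0. The formula is I(X;Y|Z) = H(X,Z) +
  H(Y,Z) - H(X,Y,Z) - H(Z), and \<open>\<eta>\<close> sums to minus an entropy.\<close>

lemma cmi_eq_entropies: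
  fixes q :: "'a::finite \<Rightarrow> 'b::finite \<Rightarrow> 'c::finite \<Rightarrow> real"
  assumes nonneg: "\<And>x y z. q x y z \<ge> 0"
  defines "\<eta> \<equiv> \<lambda>t. t * log 2 t"
  shows "cmi q = (\<Sum>x\<in>UNIV. \<Sum>y\<in>UNIV. \<Sum>z\<in>UNIV. \<eta> (q x y z)) + (\<Sum>z\<in>UNIV. \<eta> (\<Sum>x\<in>UNIV. \<Sum>y\<in>UNIV. q x y z))
     - (\<Sum>x\<in>UNIV. \<Sum>z\<in>UNIV. \<eta> (\<Sum>y\<in>UNIV. q x y z)) - (\<Sum>y\<in>UNIV. \<Sum>z\<in>UNIV. \<eta> (\<Sum>x\<in>UNIV. q x y z))"
proof -
  define a where "a x z = (\<Sum>y\<in>UNIV. q x y z)" for x z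
  define b where "b y z = (\<Sum>x\<in>UNIV. q x y z)" for y z
  define c where "c z = (\<Sum>x\<in>UNIV. \<Sum>y\<in>UNIV. q x y z)" for z
  have summand: "(if q x y z = 0 then 0 else q x y z * log 2 (q x y z * c z / (a x z * b y z)))
      = \<eta> (q x y z) + q x y z * log 2 (c z) - q x y z * log 2 (a x z) - q x y z * log 2 (b y z)" for x y z
  proof (cases "q x y z = 0")
    case False
    then have q: "q x y z > 0" using nonneg[of x y z] by simp
    have "q x y z \<le> a x z"
      unfolding a_def by (rule member_le_sum[of y UNIV "\<lambda>y. q x y z"]) (auto simp: nonneg)
    moreover have "a x z \<le> c z"
      unfolding a_def c_def by (rule member_le_sum[of x UNIV "\<lambda>x. \<Sum>y\<in>UNIV. q x y z"]) (auto simp: nonneg sum_nonneg)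
    moreover have "q x y z \<le> b y z"
      unfolding b_def by (rule member_le_sum[of x UNIV "\<lambda>x. q x y z"]) (auto simp: nonneg)
    ultimately have "a x z > 0" "b y z > 0" "c z > 0"
      using q by linarith+
    then show ?thesis
      using q by (simp add: \<eta>_def log_divide log_mult algebra_simps)
  qed (simp add: \<eta>_def)
  have C: "(\<Sum>x\<in>UNIV. \<Sum>y\<in>UNIV. \<Sum>z\<in>UNIV. q x y z * log 2 (c z)) = (\<Sum>z\<in>UNIV. \<eta> (c z))"
    unfolding \<eta>_def c_def
    by (simp add: sum_distrib_right sum.swap[of _ "UNIV :: 'c set"])
  have A: "(\<Sum>x\<in>UNIV. \<Sum>y\<in>UNIV. \<Sum>z\<in>UNIV. q x y z * log 2 (a x z)) = (\<Sum>x\<in>UNIV. \<Sum>z\<in>UNIV. \<eta> (a x z))"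
    unfolding \<eta>_def a_def
    by (simp add: sum_distrib_right sum.swap[of _ "UNIV :: 'c set"])
  have B: "(\<Sum>x\<in>UNIV. \<Sum>y\<in>UNIV. \<Sum>z\<in>UNIV. q x y z * log 2 (b y z)) = (\<Sum>y\<in>UNIV. \<Sum>z\<in>UNIV. \<eta> (b y z))"
    unfolding \<eta>_def b_def sum_distrib_right
    by (subst sum.swap, rule sum.cong[OF refl], subst sum.swap, rule refl)
  show ?thesis
    unfolding cmi_def a_def[symmetric] b_def[symmetric] c_def[unfolded a_def[symmetric], symmetric] summand
    by (simp add: sum_subtractf sum.distrib A B C)
qed

section \<open>Compactness of the input laws and continuity of the objective\<close>

lemma compact_is_dist: "compact {p :: 'x::finite \<Rightarrow> real. is_dist p}"
proof -
  have "compactin (product_topology (\<lambda>_. euclidean) UNIV) (PiE (UNIV :: 'x set) (\<lambda>_. {0..1::real}))"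
    by (simp add: compactin_PiE)
  then have cube: "compact (PiE (UNIV :: 'x set) (\<lambda>_. {0..1::real}))"
    by (simp add: euclidean_product_topology)
  have "closed ((\<Inter>x. {p :: 'x \<Rightarrow> real. 0 \<le> p x}) \<inter> {p. (\<Sum>x\<in>UNIV. p x) = 1})"
    by (intro closed_Int closed_INT ballI closed_Collect_le closed_Collect_eq continuous_intros) simp_all
  then have closed: "closed {p :: 'x \<Rightarrow> real. is_dist p}"
    by (rule back_subst[of closed]) (auto simp: is_dist_def)
  have "p x \<le> 1" if "is_dist p" for p :: "'x \<Rightarrow> real" and x
    using member_le_sum[of x UNIV p] that by (auto simp: is_dist_def)
  then have "{p :: 'x \<Rightarrow> real. is_dist p} = PiE UNIV (\<lambda>_. {0..1}) \<inter> {p. is_dist p}"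
    by (auto simp: is_dist_def)
  then show ?thesis
    using compact_Int_closed[OF cube closed] by simp
qed

lemma continuous_on_Min_image:
  fixes f :: "'i \<Rightarrow> 'a::topological_space \<Rightarrow> real"
  assumes "finite A" "A \<noteq> {}" "\<And>i. i \<in> A \<Longrightarrow> continuous_on S (f i)"
  shows "continuous_on S (\<lambda>x. Min ((\<lambda>i. f i x) ` A))"
  using assms
proof (induction A rule: finite_ne_induct)
  case (insert i A)
  then show ?case
    by (simp add: continuous_on_min)
qed simp

context channel begin

lemma joint_XYiYe_nonneg: "j < M \<Longrightarrow> is_dist p \<Longrightarrow> joint_XYiYe K W j i p x y z \<ge> 0"
  unfolding joint_XYiYe_eq is_dist_def by (intro mult_nonneg_nonneg pair_chan_nonneg) auto

lemma continuous_on_cmi: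
  assumes "j < M"
  shows "continuous_on {P. \<forall>j. is_dist (P j)} (\<lambda>P. cmi (joint_XYiYe K W j i (P j)))"
proof -
  let ?D = "{P. \<forall>j::nat. is_dist (P j :: 'x \<Rightarrow> real)}"
  have coord: "continuous_on ?D (\<lambda>P. P j x)" for x
    by (rule continuous_on_product_then_coordinatewise[OF continuous_on_product_then_coordinatewise[OF continuous_on_id]])
  then have q: "continuous_on ?D (\<lambda>P. joint_XYiYe K W j i (P j) x y z)" for x y z
    unfolding joint_XYiYe_eq by (intro continuous_intros)
  have eta: "continuous_on ?D (\<lambda>P. g P * log 2 (g P))"
    if "continuous_on ?D g" "\<And>P. P \<in> ?D \<Longrightarrow> g P \<ge> 0" for g
    using continuous_on_compose2[OF continuous_on_x_log_x that(1)] that(2) by auto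
  have "continuous_on ?D (\<lambda>P. let q = joint_XYiYe K W j i (P j); \<eta> = (\<lambda>t. t * log 2 t) in
     (\<Sum>x\<in>UNIV. \<Sum>y\<in>UNIV. \<Sum>z\<in>UNIV. \<eta> (q x y z)) + (\<Sum>z\<in>UNIV. \<eta> (\<Sum>x\<in>UNIV. \<Sum>y\<in>UNIV. q x y z))
     - (\<Sum>x\<in>UNIV. \<Sum>z\<in>UNIV. \<eta> (\<Sum>y\<in>UNIV. q x y z)) - (\<Sum>y\<in>UNIV. \<Sum>z\<in>UNIV. \<eta> (\<Sum>x\<in>UNIV. q x y z)))"
    unfolding Let_def
    by (intro continuous_on_add continuous_on_diff continuous_on_sum eta q sum_nonneg joint_XYiYe_nonneg assms) auto
  then show ?thesis
    by (rule continuous_on_cong[THEN iffD1, rotated -1])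
       (auto simp: Let_def cmi_eq_entropies joint_XYiYe_nonneg assms)
qed

text \<open>Input laws are indexed by all natural numbers, so the domain is an infinite product of
  simplices, compact by Tychonoff's theorem; a continuous objective attains its supremum
  there.\<close>

lemma secrecy_objective_attains_max:
  assumes "K \<ge> 1"
  obtains P where "\<And>j. is_dist (P j)"
    "\<And>P'. (\<forall>j<M. is_dist (P' j)) \<Longrightarrow> secrecy_objective M K W P' \<le> secrecy_objective M K W P"
proof -
  let ?D = "{P. \<forall>j::nat. is_dist (P j :: 'x \<Rightarrow> real)}"
  have "compactin (product_topology (\<lambda>_. euclidean) UNIV) (PiE (UNIV :: nat set) (\<lambda>_. {p :: 'x \<Rightarrow> real. is_dist p}))"
    by (simp add: compactin_PiE compact_is_dist)
  then have compact: "compact ?D"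
    by (simp add: euclidean_product_topology PiE_UNIV_domain Pi_def)
  \<comment> \<open>A point mass. It shows that the domain is nonempty and fills the coordinates
    from \<open>M\<close> on, about which the hypothesis on \<open>P'\<close> says nothing.\<close>
  define p0 :: "'x \<Rightarrow> real" where "p0 x = of_bool (x = undefined)" for x
  have p0: "is_dist p0"
    by (auto simp: is_dist_def p0_def)
  then have ne: "?D \<noteq> {}" by (auto intro: exI[of _ "\<lambda>_. p0"])
  have cont: "continuous_on ?D (secrecy_objective M K W)"
    unfolding secrecy_objective_def using assms
    by (intro continuous_on_Min_image continuous_on_sum continuous_on_cmi) (auto simp: lessThan_empty_iff)
  obtain P where P: "P \<in> ?D" "\<forall>P'\<in>?D. secrecy_objective M K W P' \<le> secrecy_objective M K W P"
    using continuous_attains_sup[OF compact ne cont] by (rule bexE)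
  show ?thesis
  proof
    fix P' :: "nat \<Rightarrow> 'x \<Rightarrow> real" assume P': "\<forall>j<M. is_dist (P' j)"
    have "secrecy_objective M K W P' = secrecy_objective M K W (\<lambda>j. if j < M then P' j else p0)"
      unfolding secrecy_objective_def by (intro arg_cong[where f = Min] image_cong sum.cong refl) auto
    also have "\<dots> \<le> secrecy_objective M K W P"
      using P' p0 by (intro bspec[OF P(2)]) auto
    finally show "secrecy_objective M K W P' \<le> secrecy_objective M K W P" .
  qed (use P in auto)
qed

end

section \<open>Random codes\<close>

text \<open>For \<open>\<rho> \<le> 1\<close> the power is subadditive, so \<open>\<rho> * ln (1 +
  a) \<le> ln (1 + a powr \<rho>) \<le> a powr \<rho>\<close>. This trades the logarithm in a
  divergence for a moment of order \<open>\<rho>\<close>.\<close>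

lemma ln_one_plus_le_powr:
  fixes a \<rho> :: real
  assumes "a \<ge> 0" "0 < \<rho>" "\<rho> \<le> 1"
  shows "ln (1 + a) \<le> a powr \<rho> / \<rho>"
proof -
  \<comment> \<open>Two numbers in [0, 1] with sum 1: neither decreases when raised to the power
    \<open>\<rho>\<close>.\<close>
  have "1 = 1 / (1 + a) + a / (1 + a)"
    using assms by (simp add: field_simps)
  also have "\<dots> \<le> (1 / (1 + a)) powr \<rho> + (a / (1 + a)) powr \<rho>"
  proof -
    have "b \<le> b powr \<rho>" if "0 \<le> b" "b \<le> 1" for b :: real
      using powr_mono'[of \<rho> 1 b] assms that by simp
    then show ?thesis
      using assms by (intro add_mono) (auto simp: divide_le_eq_1)
  qed
  also have "\<dots> = (1 + a powr \<rho>) / (1 + a) powr \<rho>"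
    using assms by (simp add: powr_divide add_divide_distrib)
  finally have "(1 + a) powr \<rho> \<le> 1 + a powr \<rho>"
    using assms by (simp add: le_divide_eq_1)
  then have "ln ((1 + a) powr \<rho>) \<le> ln (1 + a powr \<rho>)"
    using assms by (subst ln_le_cancel_iff) (auto simp: add_pos_nonneg)
  also have "\<dots> \<le> a powr \<rho>"
    by (rule ln_add_one_self_le_self) simp
  finally show ?thesis
    using assms by (simp add: ln_powr field_simps)
qed

lemma sum_PiE_curry:
  "(\<Sum>f\<in>PiE (A \<times> B) (\<lambda>_. UNIV). G f) = (\<Sum>F\<in>PiE A (\<lambda>_. PiE B (\<lambda>_. UNIV)). G (restrict (\<lambda>(a, b). F a b) (A \<times> B)))"
  by (rule sum.reindex_bij_witness[of _ "\<lambda>F. restrict (\<lambda>(a, b). F a b) (A \<times> B)"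
        "\<lambda>f. restrict (\<lambda>a. restrict (\<lambda>b. f (a, b)) B) A"])
     (auto simp: PiE_iff extensional_def fun_eq_iff intro!: arg_cong[where f = G])

text \<open>The probabilistic method. The chosen point must also have positive weight, because the
  support relations behind the divergence can fail for codebooks of probability 0.\<close>

lemma weighted_sum_le_imp_exists:
  fixes \<mu> G :: "'a \<Rightarrow> real"
  assumes "finite A" "\<And>a. a \<in> A \<Longrightarrow> \<mu> a \<ge> 0" "(\<Sum>a\<in>A. \<mu> a) = 1" "(\<Sum>a\<in>A. \<mu> a * G a) \<le> b"
  obtains a where "a \<in> A" "\<mu> a > 0" "G a \<le> b"
proof (rule ccontr)
  assume "\<not> thesis"
  then have G: "G a > b" if "a \<in> A" "\<mu> a > 0" for a
    using that(1) that(2) \<open>\<And>a. a \<in> A \<Longrightarrow> \<mu> a > 0 \<Longrightarrow> G a \<le> b \<Longrightarrow> thesis\<close> by force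
  obtain a where a: "a \<in> A" "\<mu> a \<noteq> 0"
    using assms(3) by (metis sum.neutral zero_neq_one)
  have "(\<Sum>a\<in>A. \<mu> a * b) < (\<Sum>a\<in>A. \<mu> a * G a)"
  proof (rule sum_strict_mono_ex1[OF assms(1)])
    show "\<forall>a\<in>A. \<mu> a * b \<le> \<mu> a * G a"
      using G assms(2) by (metis less_eq_real_def mult_eq_0_iff mult_left_mono)
    show "\<exists>a\<in>A. \<mu> a * b < \<mu> a * G a"
      using a G[OF a(1)] assms(2)[OF a(1)] by (intro bexI[of _ a]) auto
  qed
  then show False
    using assms(3,4) by (simp flip: sum_distrib_right)
qed

section \<open>The ensemble of random codebooks\<close>

locale random_code = channel M K W
  for M K :: nat and W :: "('x::finite, 'y::finite) bchan" +
  fixes P :: "nat \<Rightarrow> 'x \<Rightarrow> real" and n N :: nat and L :: "nat \<Rightarrow> nat"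
  assumes dist: "\<And>j. j < M \<Longrightarrow> is_dist (P j)" and n_pos: "n > 0" and N_pos: "N > 0"
    and L_pos: "\<And>j. j < M \<Longrightarrow> L j > 0"
begin

abbreviation I :: "(nat \<times> nat) set" where "I \<equiv> {..<M} \<times> {..<n}"

abbreviation V :: "nat \<Rightarrow> nat \<Rightarrow> 'x \<Rightarrow> 'y \<Rightarrow> real" where "V \<equiv> recv_chan K W"

abbreviation Q :: "nat \<Rightarrow> nat \<Rightarrow> 'y \<Rightarrow> real" where "Q j \<equiv> out_law (P j) j"

abbreviation moment :: "nat \<Rightarrow> nat \<Rightarrow> real \<Rightarrow> real" where "moment j \<equiv> info_moment (P j) j"

definition Xn :: "(nat \<Rightarrow> 'x) set" where "Xn = PiE {..<n} (\<lambda>_. UNIV)"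

definition Yn :: "(nat \<Rightarrow> 'y) set" where "Yn = PiE {..<n} (\<lambda>_. UNIV)"

definition pw :: "nat \<Rightarrow> (nat \<Rightarrow> 'x) \<Rightarrow> real" where "pw j c = (\<Prod>t<n. P j (c t))"

definition Vn :: "nat \<Rightarrow> nat \<Rightarrow> (nat \<Rightarrow> 'x) \<Rightarrow> (nat \<Rightarrow> 'y) \<Rightarrow> real" where
  "Vn j r c y = (\<Prod>t<n. V j r (c t) (y t))"

definition Qn :: "nat \<Rightarrow> nat \<Rightarrow> (nat \<Rightarrow> 'y) \<Rightarrow> real" where "Qn j r y = (\<Prod>t<n. Q j r (y t))"

text \<open>A codebook assigns to message \<open>w\<close>, channel \<open>j\<close> and local randomness \<open>l < L j\<close> a word of length \<open>n\<close>.\<close>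
definition B :: "(nat \<times> nat \<times> nat) set" where "B = {1..N} \<times> (SIGMA j:{..<M}. {..<L j})"

definition books :: "(nat \<times> nat \<times> nat \<Rightarrow> nat \<Rightarrow> 'x) set" where "books = PiE B (\<lambda>_. Xn)"

definition \<mu> :: "(nat \<times> nat \<times> nat \<Rightarrow> nat \<Rightarrow> 'x) \<Rightarrow> real" where
  "\<mu> C = (\<Prod>k\<in>B. pw (fst (snd k)) (C k))"

definition expect :: "((nat \<times> nat \<times> nat \<Rightarrow> nat \<Rightarrow> 'x) \<Rightarrow> real) \<Rightarrow> real" where
  "expect F = (\<Sum>C\<in>books. \<mu> C * F C)"

lemma finite_Xn [simp]: "finite Xn" and finite_Yn [simp]: "finite Yn"
  by (auto simp: Xn_def Yn_def intro!: finite_PiE)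

lemma finite_B [simp]: "finite B"
  by (auto simp: B_def)

lemma finite_books [simp]: "finite books"
  by (auto simp: books_def intro!: finite_PiE)

lemma P_nonneg: "j < M \<Longrightarrow> P j x \<ge> 0" and P_sum: "j < M \<Longrightarrow> (\<Sum>x\<in>UNIV. P j x) = 1"
  using dist by (auto simp: is_dist_def)

lemma Q_nonneg: "j < M \<Longrightarrow> Q j r y \<ge> 0"
  and Q_sum: "j < M \<Longrightarrow> (\<Sum>y\<in>UNIV. Q j r y) = 1"
  and Q_pos: "j < M \<Longrightarrow> P j x > 0 \<Longrightarrow> V j r x y > 0 \<Longrightarrow> Q j r y > 0"
  using out_law_nonneg out_law_sum out_law_pos dist by auto

lemma Vn_nonneg: "j < M \<Longrightarrow> Vn j r c y \<ge> 0"
  unfolding Vn_def by (intro prod_nonneg) (auto simp: recv_chan_nonneg)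

lemma Qn_nonneg: "j < M \<Longrightarrow> Qn j r y \<ge> 0"
  unfolding Qn_def by (intro prod_nonneg) (auto simp: Q_nonneg)

lemma pw_nonneg: "j < M \<Longrightarrow> pw j c \<ge> 0"
  unfolding pw_def by (intro prod_nonneg) (auto simp: P_nonneg)

lemma sum_pw: "(\<Sum>c\<in>Xn. pw j c * (\<Prod>t<n. f t (c t))) = (\<Prod>t<n. \<Sum>x\<in>UNIV. P j x * f t x)"
  unfolding Xn_def pw_def by (subst prod_sum_PiE) (auto simp: prod.distrib)

lemma pw_sum: "j < M \<Longrightarrow> (\<Sum>c\<in>Xn. pw j c) = 1"
  using sum_pw[of j "\<lambda>_ _. 1"] by (simp add: P_sum)

lemma sum_pw_Vn: "(\<Sum>c\<in>Xn. pw j c * Vn j r c y) = Qn j r y"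
  unfolding Vn_def Qn_def out_law_def by (rule sum_pw)

lemma Vn_sum: "j < M \<Longrightarrow> (\<Sum>y\<in>Yn. Vn j r c y) = 1"
  unfolding Vn_def Yn_def by (rule sum_PiE_prod_one) (auto simp: recv_chan_sum)

lemma Qn_sum: "j < M \<Longrightarrow> (\<Sum>y\<in>Yn. Qn j r y) = 1"
  unfolding Qn_def Yn_def by (rule sum_PiE_prod_one) (auto simp: Q_sum)

lemma \<mu>_nonneg: "\<mu> C \<ge> 0"
  unfolding \<mu>_def by (intro prod_nonneg) (auto simp: B_def pw_nonneg)

lemma expect_prod:
  assumes "J \<subseteq> B"
  shows "expect (\<lambda>C. \<Prod>k\<in>J. f k (C k)) = (\<Prod>k\<in>J. \<Sum>c\<in>Xn. pw (fst (snd k)) c * f k c)"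
  unfolding expect_def books_def \<mu>_def
  by (rule sum_PiE_prod_restricted) (use assms in \<open>auto simp: B_def pw_sum\<close>)

lemma \<mu>_sum: "(\<Sum>C\<in>books. \<mu> C) = 1"
  using expect_prod[of "{}"] by (simp add: expect_def)

lemma expect_mono: "(\<And>C. C \<in> books \<Longrightarrow> F C \<le> G C) \<Longrightarrow> expect F \<le> expect G"
  unfolding expect_def by (intro sum_mono mult_left_mono \<mu>_nonneg)

lemma expect_add: "expect (\<lambda>C. F C + G C) = expect F + expect G"
  and expect_diff: "expect (\<lambda>C. F C - G C) = expect F - expect G"
  and expect_cmult: "expect (\<lambda>C. a * F C) = a * expect F"
  and expect_divide: "expect (\<lambda>C. F C / a) = expect F / a"
  by (simp_all add: expect_def algebra_simps sum.distrib sum_subtractf sum_distrib_left sum_divide_distrib)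

lemma expect_sum: "expect (\<lambda>C. \<Sum>a\<in>S. F a C) = (\<Sum>a\<in>S. expect (F a))"
  unfolding expect_def sum_distrib_left by (rule sum.swap)

lemma expect_single:
  assumes "k \<in> B"
  shows "expect (\<lambda>C. f (C k)) = (\<Sum>c\<in>Xn. pw (fst (snd k)) c * f c)"
  using expect_prod[of "{k}" "\<lambda>_. f"] assms by simp

lemma expect_pair:
  assumes "k \<in> B" "k' \<in> B" "k \<noteq> k'"
  shows "expect (\<lambda>C. f (C k) * g (C k')) = (\<Sum>c\<in>Xn. pw (fst (snd k)) c * f c) * (\<Sum>c\<in>Xn. pw (fst (snd k')) c * g c)"
  using expect_prod[of "{k, k'}" "\<lambda>m. if m = k then f else g"] assms by simp

lemma expect_block:
  assumes "w \<in> {1..N}" "l \<in> PiE S (\<lambda>j. {..<L j})" "S \<subseteq> {..<M}"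
  shows "expect (\<lambda>C. \<Prod>j\<in>S. f j (C (w, j, l j))) = (\<Prod>j\<in>S. \<Sum>c\<in>Xn. pw j c * f j c)"
proof -
  have "inj_on (\<lambda>j. (w, j, l j)) S"
    by (auto simp: inj_on_def)
  moreover have "(\<lambda>j. (w, j, l j)) ` S \<subseteq> B"
    using assms by (auto simp: B_def PiE_iff)
  ultimately show ?thesis
    using expect_prod[of "(\<lambda>j. (w, j, l j)) ` S" "\<lambda>k. f (fst (snd k))"] by (simp add: prod.reindex)
qed

text \<open>Words of different messages occupy disjoint cells of the codebook. A wrong message is
  therefore independent of the transmitted words even if some of the local indices coincide.\<close>

lemma expect_block_pair:
  assumes "w \<in> {1..N}" "l \<in> PiE S (\<lambda>j. {..<L j})" "S \<subseteq> {..<M}"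
    and "w' \<in> {1..N}" "l' \<in> PiE S' (\<lambda>j. {..<L j})" "S' \<subseteq> {..<M}" and "w \<noteq> w'"
  shows "expect (\<lambda>C. (\<Prod>j\<in>S. f j (C (w, j, l j))) * (\<Prod>j\<in>S'. g j (C (w', j, l' j))))
     = (\<Prod>j\<in>S. \<Sum>c\<in>Xn. pw j c * f j c) * (\<Prod>j\<in>S'. \<Sum>c\<in>Xn. pw j c * g j c)"
proof -
  let ?J = "(\<lambda>j. (w, j, l j)) ` S" and ?J' = "(\<lambda>j. (w', j, l' j)) ` S'"
  have inj: "inj_on (\<lambda>j. (w, j, l j)) S" "inj_on (\<lambda>j. (w', j, l' j)) S'"
    by (auto simp: inj_on_def)
  have fin: "finite S" "finite S'"
    using assms finite_subset by blast+
  have disj: "?J \<inter> ?J' = {}"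
    using assms by auto
  have "?J \<union> ?J' \<subseteq> B"
    using assms by (auto simp: B_def PiE_iff)
  from expect_prod[OF this, of "\<lambda>k. if fst k = w then f (fst (snd k)) else g (fst (snd k))"] show ?thesis
    using fin disj inj \<open>w \<noteq> w'\<close> by (simp add: prod.union_disjoint prod.reindex)
qed

subsection \<open>Decoding\<close>

abbreviation Lset :: "nat set \<Rightarrow> (nat \<Rightarrow> nat) set" where "Lset S \<equiv> PiE S (\<lambda>j. {..<L j})"

lemma finite_Lset: "S \<subseteq> {..<M} \<Longrightarrow> finite (Lset S)"
  by (intro finite_PiE) (auto intro: finite_subset)

lemma card_Lset: "S \<subseteq> {..<M} \<Longrightarrow> real (card (Lset S)) = (\<Prod>j\<in>S. real (L j))"
  by (subst card_PiE) (auto intro: finite_subset)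

lemma card_Lset_pos: "real (card (Lset {..<M})) > 0"
  by (subst card_Lset) (auto intro!: prod_pos simp: L_pos)

definition cw :: "(nat \<times> nat \<times> nat \<Rightarrow> nat \<Rightarrow> 'x) \<Rightarrow> nat \<Rightarrow> (nat \<Rightarrow> nat) \<Rightarrow> nat \<times> nat \<Rightarrow> 'x" where
  "cw C w l = restrict (\<lambda>(j, t). C (w, j, l j) t) I"

text \<open>A sum over the local indices rather than a uniform law on a set of words, since several
  \<open>l\<close> may produce the same word.\<close>

definition enc :: "(nat \<times> nat \<times> nat \<Rightarrow> nat \<Rightarrow> 'x) \<Rightarrow> nat \<Rightarrow> (nat \<times> nat \<Rightarrow> 'x) \<Rightarrow> real" where
  "enc C w xs = (\<Sum>l\<in>Lset {..<M}. 1 / real (card (Lset {..<M})) * of_bool (cw C w l = xs))"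

definition outrow :: "(nat \<times> nat \<Rightarrow> 'y) \<Rightarrow> nat \<Rightarrow> nat \<Rightarrow> 'y" where
  "outrow y j = restrict (\<lambda>t. y (j, t)) {..<n}"

text \<open>A threshold test on the likelihood ratio of the channels in \<open>A\<close>, multiplied
  out to avoid division by 0.\<close>

definition accepts :: "(nat \<times> nat \<times> nat \<Rightarrow> nat \<Rightarrow> 'x) \<Rightarrow> nat set \<Rightarrow> real \<Rightarrow> nat \<Rightarrow> nat \<Rightarrow> (nat \<Rightarrow> nat) \<Rightarrow> (nat \<times> nat \<Rightarrow> 'y) \<Rightarrow> bool" where
  "accepts C A \<Gamma> i w l y \<longleftrightarrow> \<Gamma> * (\<Prod>j\<in>A. Qn j i (outrow y j)) \<le> (\<Prod>j\<in>A. Vn j i (C (w, j, l j)) (outrow y j))"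

text \<open>The local indices are quantified away: accepting the right message with wrong indices is
  no error. If no message or several messages pass, \<open>THE\<close> returns an unspecified value;
  the bound \<open>decode_error_le\<close> counts these cases as errors.\<close>

definition decode :: "(nat \<times> nat \<times> nat \<Rightarrow> nat \<Rightarrow> 'x) \<Rightarrow> nat set \<Rightarrow> real \<Rightarrow> nat \<Rightarrow> (nat \<times> nat \<Rightarrow> 'y) \<Rightarrow> nat" where
  "decode C A \<Gamma> i y = (THE w. w \<in> {1..N} \<and> (\<exists>l\<in>Lset A. accepts C A \<Gamma> i w l y))"

lemma sum_enc:
  "(\<Sum>xs\<in>codewords M n. enc C w xs * F xs) = 1 / real (card (Lset {..<M})) * (\<Sum>l\<in>Lset {..<M}. F (cw C w l))"
proof -
  have cw: "cw C w l \<in> codewords M n" for l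
    by (auto simp: cw_def codewords_def)
  have "(\<Sum>xs\<in>codewords M n. enc C w xs * F xs)
      = (\<Sum>l\<in>Lset {..<M}. 1 / real (card (Lset {..<M})) * (\<Sum>xs\<in>codewords M n. of_bool (cw C w l = xs) * F xs))"
    unfolding enc_def sum_distrib_right sum_distrib_left mult.assoc by (rule sum.swap)
  moreover have "(\<Sum>xs\<in>codewords M n. of_bool (cw C w l = xs) * F xs) = F (cw C w l)" for l
    using cw[of l] by (subst sum.remove[of _ "cw C w l"]) auto
  ultimately show ?thesis
    by (simp only: sum_distrib_left)
qed

lemma valid_encoder_enc: "valid_encoder M n N (enc C)"
  unfolding valid_encoder_def
proof (intro ballI conjI)
  fix w xs
  show "0 \<le> enc C w xs"
    unfolding enc_def by (intro sum_nonneg) auto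
  show "(\<Sum>xs\<in>codewords M n. enc C w xs) = 1"
    using sum_enc[of C w "\<lambda>_. 1"] card_Lset_pos by simp
qed

lemma prod_I: "(\<Prod>k\<in>I. f (fst k) (snd k)) = (\<Prod>j<M. \<Prod>t<n. f j t)"
  by (simp add: prod.cartesian_product split_beta)

lemma prod_V_cw: "(\<Prod>k\<in>I. V (fst k) r (cw C w l k) (y k)) = (\<Prod>j<M. Vn j r (C (w, j, l j)) (outrow y j))"
proof -
  have "(\<Prod>k\<in>I. V (fst k) r (cw C w l k) (y k)) = (\<Prod>k\<in>I. V (fst k) r (C (w, fst k, l (fst k)) (snd k)) (y (fst k, snd k)))"
    by (intro prod.cong) (auto simp: cw_def)
  then show ?thesis
    using prod_I[of "\<lambda>j t. V j r (C (w, j, l j) t) (y (j, t))"] by (simp add: Vn_def outrow_def)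
qed

lemma prod_Q_row: "(\<Prod>j<M. Qn j r (outrow y j)) = (\<Prod>k\<in>I. Q (fst k) r (y k))"
  using prod_I[of "\<lambda>j t. Q j r (y (j, t))"] by (simp add: Qn_def outrow_def)

lemma sum_prod_Q: "(\<Sum>y\<in>codewords M n. \<Prod>j<M. Qn j r (outrow y j)) = 1"
  unfolding prod_Q_row codewords_def by (rule sum_PiE_prod_one) (auto simp: Q_sum)

lemma err_prob_enc:
  "err_prob M K n W N (enc C) dec i = 1 / real N * (\<Sum>w\<in>{1..N}. 1 / real (card (Lset {..<M})) * (\<Sum>l\<in>Lset {..<M}.
     \<Sum>y\<in>codewords M n. (\<Prod>j<M. Vn j i (C (w, j, l j)) (outrow y j)) * of_bool (dec i y \<noteq> w)))"
proof -
  have "(\<Sum>out\<in>{out\<in>outwords M n K. dec i (obs M n i out) \<noteq> w}. chan_prob M n W xs out)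
     = (\<Sum>out\<in>outwords M n K. chan_prob M n W xs out * of_bool (dec i (obs M n i out) \<noteq> w))" for w xs
    by (intro sum.mono_neutral_cong_left) auto
  moreover have "(\<Sum>out\<in>outwords M n K. chan_prob M n W xs out * of_bool (dec i (obs M n i out) \<noteq> w))
      = (\<Sum>y\<in>codewords M n. (\<Prod>k\<in>I. V (fst k) i (xs k) (y k)) * of_bool (dec i y \<noteq> w) :: real)" for w xs
    by (rule sum_chan_prob_obs)
  ultimately show ?thesis
    unfolding err_prob_def by (simp only: sum_enc prod_V_cw)
qed

lemma decode_error_le:
  assumes w: "w \<in> {1..N}" and l: "l \<in> Lset {..<M}" and A: "A \<subseteq> {..<M}"
  shows "(of_bool (decode C A \<Gamma> i y \<noteq> w) :: real)
    \<le> of_bool (\<not> accepts C A \<Gamma> i w l y) + (\<Sum>w'\<in>{1..N} - {w}. \<Sum>l'\<in>Lset A. of_bool (accepts C A \<Gamma> i w' l' y))"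
proof (cases "accepts C A \<Gamma> i w l y \<and> (\<forall>w'\<in>{1..N} - {w}. \<forall>l'\<in>Lset A. \<not> accepts C A \<Gamma> i w' l' y)")
  case True
  \<comment> \<open>The test reads \<open>l\<close> only on \<open>A\<close>, while the decoder
    searches \<open>Lset A\<close>; restricting \<open>l\<close> bridges the two.\<close>
  have "accepts C A \<Gamma> i w (restrict l A) y"
    using True by (simp add: accepts_def)
  moreover have "restrict l A \<in> Lset A"
    using l A by (auto simp: PiE_iff)
  ultimately have "decode C A \<Gamma> i y = w"
    unfolding decode_def using True w by (intro the_equality conjI bexI[of _ "restrict l A"]) blast+
  then show ?thesis
    by (simp add: sum_nonneg)
next
  case False
  have nn: "(\<Sum>w'\<in>{1..N} - {w}. \<Sum>l'\<in>Lset A. (of_bool (accepts C A \<Gamma> i w' l' y) :: real)) \<ge> 0"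
    by (intro sum_nonneg) auto
  show ?thesis
  proof (cases "accepts C A \<Gamma> i w l y")
    case True
    with False obtain w' l' where wl: "w' \<in> {1..N} - {w}" "l' \<in> Lset A" "accepts C A \<Gamma> i w' l' y"
      by blast
    have "1 = (of_bool (accepts C A \<Gamma> i w' l' y) :: real)" using wl by simp
    also have "\<dots> \<le> (\<Sum>l'\<in>Lset A. of_bool (accepts C A \<Gamma> i w' l' y))"
      by (rule member_le_sum) (use wl finite_Lset[OF A] in auto)
    also have "\<dots> \<le> (\<Sum>w'\<in>{1..N} - {w}. \<Sum>l'\<in>Lset A. of_bool (accepts C A \<Gamma> i w' l' y))"
      by (rule member_le_sum[of w' _ "\<lambda>w'. \<Sum>l'\<in>Lset A. of_bool (accepts C A \<Gamma> i w' l' y)"]) (use wl in \<open>auto intro!: sum_nonneg\<close>)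
    finally show ?thesis
      by (intro order.trans[OF of_bool_less_eq_one]) simp
  qed (use nn in auto)
qed

text \<open>Chernoff's bound: if the transmitted words are rejected, their likelihood ratio V / Q on
  \<open>A\<close> is below \<open>\<Gamma>\<close>, so the indicator is at most
  \<open>(\<Gamma> * Q / V) powr s\<close>. Averaging over words and outputs factorizes this into
  single letters, each giving a moment of order \<open>- s\<close>.\<close>

lemma expect_miss_le:
  assumes w: "w \<in> {1..N}" and l: "l \<in> Lset {..<M}" and A: "A \<subseteq> {..<M}" and \<Gamma>: "\<Gamma> > 0" and s: "s > 0"
  shows "expect (\<lambda>C. \<Sum>y\<in>codewords M n. (\<Prod>j<M. Vn j i (C (w, j, l j)) (outrow y j)) * of_bool (\<not> accepts C A \<Gamma> i w l y))
    \<le> \<Gamma> powr s * (\<Prod>j\<in>A. moment j i (- s) ^ n)"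
proof -
  \<comment> \<open>Extended by 1 outside \<open>A\<close>, so that all channels form one product;
    there the sum over inputs and outputs is 1.\<close>
  define h where "h j x y = (if j \<in> A then (V j i x y / Q j i y) powr (- s) else 1)" for j x y
  define Hn where "Hn j c y = (\<Prod>t<n. V j i (c t) (y t) * h j (c t) (y t))" for j c y
  have "expect (\<lambda>C. \<Sum>y\<in>codewords M n. (\<Prod>j<M. Vn j i (C (w, j, l j)) (outrow y j)) * of_bool (\<not> accepts C A \<Gamma> i w l y))
     \<le> expect (\<lambda>C. \<Sum>y\<in>codewords M n. \<Gamma> powr s * (\<Prod>j<M. Hn j (C (w, j, l j)) (outrow y j)))"
  proof (intro expect_mono sum_mono)
    fix C :: "nat \<times> nat \<times> nat \<Rightarrow> nat \<Rightarrow> 'x" and y :: "nat \<times> nat \<Rightarrow> 'y"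
    let ?v = "\<lambda>j. Vn j i (C (w, j, l j)) (outrow y j)"
    let ?q = "\<lambda>j. Qn j i (outrow y j)"
    have Hn_nonneg: "Hn j c y \<ge> 0" if "j < M" for j c y
      unfolding Hn_def h_def using that by (intro prod_nonneg) (auto simp: recv_chan_nonneg)
    show "(\<Prod>j<M. ?v j) * of_bool (\<not> accepts C A \<Gamma> i w l y) \<le> \<Gamma> powr s * (\<Prod>j<M. Hn j (C (w, j, l j)) (outrow y j))"
    proof (cases "(\<Prod>j<M. ?v j) > 0 \<and> \<not> accepts C A \<Gamma> i w l y")
      case True
      have vpos: "?v j > 0" if "j < M" for j
        using True that Vn_nonneg[OF that, of i "C (w, j, l j)" "outrow y j"] by (auto simp: less_le)
      then have vA: "(\<Prod>j\<in>A. ?v j) > 0"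
        using A by (intro prod_pos) auto
      have lt: "(\<Prod>j\<in>A. ?v j) < \<Gamma> * (\<Prod>j\<in>A. ?q j)"
        using True by (simp add: accepts_def)
      have "1 \<le> (\<Gamma> * (\<Prod>j\<in>A. ?q j) / (\<Prod>j\<in>A. ?v j)) powr s"
        using lt vA s by (intro ge_one_powr_ge_zero) (auto simp: le_divide_eq_1)
      also have "\<dots> = \<Gamma> powr s * ((\<Prod>j\<in>A. ?v j) / (\<Prod>j\<in>A. ?q j)) powr (- s)"
        using lt vA \<Gamma> by (simp add: powr_mult powr_divide powr_minus_divide zero_less_mult_iff divide_nonneg_pos)
      also have "((\<Prod>j\<in>A. ?v j) / (\<Prod>j\<in>A. ?q j)) powr (- s) = (\<Prod>j\<in>A. \<Prod>t<n. h j (C (w, j, l j) t) (outrow y j t))"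
      proof -
        have "(\<Prod>j\<in>A. ?v j) / (\<Prod>j\<in>A. ?q j) = (\<Prod>j\<in>A. \<Prod>t<n. V j i (C (w, j, l j) t) (outrow y j t) / Q j i (outrow y j t))"
          by (simp add: Vn_def Qn_def prod_dividef)
        then have "((\<Prod>j\<in>A. ?v j) / (\<Prod>j\<in>A. ?q j)) powr (- s)
            = (\<Prod>j\<in>A. \<Prod>t<n. (V j i (C (w, j, l j) t) (outrow y j t) / Q j i (outrow y j t)) powr (- s))"
          by (simp only: prod_powr_distrib)
        then show ?thesis
          by (simp add: h_def)
      qed
      also have "\<dots> = (\<Prod>j<M. \<Prod>t<n. h j (C (w, j, l j) t) (outrow y j t))"
        using A by (intro prod.mono_neutral_left) (auto simp: h_def)
      finally have "(\<Prod>j<M. ?v j) * 1 \<le> (\<Prod>j<M. ?v j) * (\<Gamma> powr s * (\<Prod>j<M. \<Prod>t<n. h j (C (w, j, l j) t) (outrow y j t)))"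
        using True by (intro mult_left_mono) auto
      then show ?thesis
        using True by (simp add: Hn_def Vn_def prod.distrib mult_ac)
    next
      case False
      moreover have "(\<Prod>j<M. ?v j) \<ge> 0"
        by (intro prod_nonneg) (auto simp: Vn_nonneg)
      ultimately have "(\<Prod>j<M. ?v j) * of_bool (\<not> accepts C A \<Gamma> i w l y) = 0"
        by auto
      moreover have "0 \<le> \<Gamma> powr s * (\<Prod>j<M. Hn j (C (w, j, l j)) (outrow y j))"
        using Hn_nonneg by (intro mult_nonneg_nonneg prod_nonneg) auto
      ultimately show ?thesis by (simp only:)
    qed
  qed
  also have "\<dots> = \<Gamma> powr s * (\<Sum>y\<in>codewords M n. \<Prod>j<M. \<Sum>c\<in>Xn. pw j c * Hn j c (outrow y j))"
    using expect_block[OF w l order.refl, of "\<lambda>j c. Hn j c (outrow _ j)"]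
    by (simp add: expect_sum expect_cmult sum_distrib_left)
  also have "\<dots> = \<Gamma> powr s * (\<Sum>y\<in>codewords M n. \<Prod>k\<in>I. \<Sum>x\<in>UNIV. P (fst k) x * (V (fst k) i x (y k) * h (fst k) x (y k)))"
  proof -
    have "(\<Sum>c\<in>Xn. pw j c * Hn j c (outrow y j)) = (\<Prod>t<n. \<Sum>x\<in>UNIV. P j x * (V j i x (y (j, t)) * h j x (y (j, t))))" for j y
      unfolding Hn_def sum_pw[of j "\<lambda>t x. V j i x (outrow y j t) * h j x (outrow y j t)"] by (simp add: outrow_def)
    moreover have "(\<Prod>k\<in>I. \<Sum>x\<in>UNIV. P (fst k) x * (V (fst k) i x (y k) * h (fst k) x (y k)))
        = (\<Prod>j<M. \<Prod>t<n. \<Sum>x\<in>UNIV. P j x * (V j i x (y (j, t)) * h j x (y (j, t))))" for y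
      using prod_I[of "\<lambda>j t. \<Sum>x\<in>UNIV. P j x * (V j i x (y (j, t)) * h j x (y (j, t)))"] by simp
    ultimately show ?thesis by (simp only:)
  qed
  also have "\<dots> = \<Gamma> powr s * (\<Prod>k\<in>I. \<Sum>y\<in>UNIV. \<Sum>x\<in>UNIV. P (fst k) x * (V (fst k) i x y * h (fst k) x y))"
    unfolding codewords_def by (subst prod_sum_PiE) auto
  also have "\<dots> = \<Gamma> powr s * (\<Prod>j<M. \<Prod>t<n. \<Sum>y\<in>UNIV. \<Sum>x\<in>UNIV. P j x * (V j i x y * h j x y))"
    using prod_I[of "\<lambda>j t. \<Sum>y\<in>UNIV. \<Sum>x\<in>UNIV. P j x * (V j i x y * h j x y)"] by simp
  also have "\<dots> = \<Gamma> powr s * (\<Prod>j<M. if j \<in> A then moment j i (- s) ^ n else 1)"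
  proof -
    have "(\<Prod>t<n. \<Sum>y\<in>UNIV. \<Sum>x\<in>UNIV. P j x * (V j i x y * h j x y)) = (if j \<in> A then moment j i (- s) ^ n else 1)" if "j < M" for j
    proof (cases "j \<in> A")
      case True
      then show ?thesis
        by (subst sum.swap) (simp add: h_def info_moment_def mult_ac)
    next
      case False
      then have "(\<Sum>y\<in>UNIV. \<Sum>x\<in>UNIV. P j x * (V j i x y * h j x y)) = 1"
        using Q_sum[OF that] by (simp add: h_def out_law_def)
      then show ?thesis
        using False by simp
    qed
    then show ?thesis by simp
  qed
  also have "\<dots> = \<Gamma> powr s * (\<Prod>j\<in>A. moment j i (- s) ^ n)"
    using A by (simp add: prod.inter_restrict[symmetric] Int_absorb1)
  finally show ?thesis .
qed

text \<open>Markov's inequality: the words of \<open>w'\<close> are independent of the output, so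
  given the output their likelihood ratio on \<open>A\<close> has mean 1 and reaches
  \<open>\<Gamma>\<close> with probability at most \<open>1 / \<Gamma>\<close>.\<close>

lemma expect_false_alarm_le:
  assumes w: "w \<in> {1..N}" and l: "l \<in> Lset {..<M}" and A: "A \<subseteq> {..<M}" and \<Gamma>: "\<Gamma> > 0"
    and w': "w' \<in> {1..N}" "w \<noteq> w'" and l': "l' \<in> Lset A"
  shows "expect (\<lambda>C. \<Sum>y\<in>codewords M n. (\<Prod>j<M. Vn j i (C (w, j, l j)) (outrow y j)) * of_bool (accepts C A \<Gamma> i w' l' y)) \<le> 1 / \<Gamma>"
proof -
  have "expect (\<lambda>C. (\<Prod>j<M. Vn j i (C (w, j, l j)) (outrow y j)) * of_bool (accepts C A \<Gamma> i w' l' y))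
      \<le> (\<Prod>j<M. Qn j i (outrow y j)) / \<Gamma>" for y
  proof (cases "(\<Prod>j\<in>A. Qn j i (outrow y j)) = 0")
    \<comment> \<open>Here the multiplied-out test accepts every word, but averaged over the
      codebooks such an output has probability 0.\<close>
    case True
    then obtain j where "j \<in> A" "Qn j i (outrow y j) = 0"
      using A finite_subset[OF A] by auto
    then have Q0: "(\<Prod>j<M. Qn j i (outrow y j)) = 0"
      using A by (intro prod_zero) auto
    have "expect (\<lambda>C. (\<Prod>j<M. Vn j i (C (w, j, l j)) (outrow y j)) * of_bool (accepts C A \<Gamma> i w' l' y))
       \<le> expect (\<lambda>C. \<Prod>j<M. Vn j i (C (w, j, l j)) (outrow y j))"
      by (intro expect_mono mult_left_le prod_nonneg) (auto simp: Vn_nonneg)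
    also have "\<dots> = (\<Prod>j<M. Qn j i (outrow y j))"
      using expect_block[OF w l order.refl, of "\<lambda>j c. Vn j i c (outrow y j)"] by (simp add: sum_pw_Vn)
    finally show ?thesis by (simp only: Q0 div_0)
  next
    case False
    have QA: "(\<Prod>j\<in>A. Qn j i (outrow y j)) > 0"
      using False A by (intro order.not_eq_order_implies_strict) (auto intro!: prod_nonneg Qn_nonneg)
    have "expect (\<lambda>C. (\<Prod>j<M. Vn j i (C (w, j, l j)) (outrow y j)) * of_bool (accepts C A \<Gamma> i w' l' y))
       \<le> expect (\<lambda>C. ((\<Prod>j<M. Vn j i (C (w, j, l j)) (outrow y j)) * (\<Prod>j\<in>A. Vn j i (C (w', j, l' j)) (outrow y j)))
             / (\<Gamma> * (\<Prod>j\<in>A. Qn j i (outrow y j))))"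
    proof (rule expect_mono)
      fix C :: "nat \<times> nat \<times> nat \<Rightarrow> nat \<Rightarrow> 'x"
      let ?v = "\<Prod>j\<in>A. Vn j i (C (w', j, l' j)) (outrow y j)"
      have "of_bool (accepts C A \<Gamma> i w' l' y) \<le> ?v / (\<Gamma> * (\<Prod>j\<in>A. Qn j i (outrow y j)))"
        using QA \<Gamma> A by (auto simp: accepts_def le_divide_eq_1 intro!: divide_nonneg_nonneg prod_nonneg Vn_nonneg mult_nonneg_nonneg Qn_nonneg)
      then have "(\<Prod>j<M. Vn j i (C (w, j, l j)) (outrow y j)) * of_bool (accepts C A \<Gamma> i w' l' y)
         \<le> (\<Prod>j<M. Vn j i (C (w, j, l j)) (outrow y j)) * (?v / (\<Gamma> * (\<Prod>j\<in>A. Qn j i (outrow y j))))"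
        by (intro mult_left_mono prod_nonneg) (auto simp: Vn_nonneg)
      then show "(\<Prod>j<M. Vn j i (C (w, j, l j)) (outrow y j)) * of_bool (accepts C A \<Gamma> i w' l' y)
         \<le> ((\<Prod>j<M. Vn j i (C (w, j, l j)) (outrow y j)) * ?v) / (\<Gamma> * (\<Prod>j\<in>A. Qn j i (outrow y j)))"
        by (simp only: times_divide_eq_right)
    qed
    also have "\<dots> = ((\<Prod>j<M. Qn j i (outrow y j)) * (\<Prod>j\<in>A. Qn j i (outrow y j))) / (\<Gamma> * (\<Prod>j\<in>A. Qn j i (outrow y j)))"
      unfolding expect_divide
      using expect_block_pair[OF w l order.refl w'(1) l' A w'(2), of "\<lambda>j c. Vn j i c (outrow y j)" "\<lambda>j c. Vn j i c (outrow y j)"]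
      by (simp only: sum_pw_Vn)
    also have "\<dots> = (\<Prod>j<M. Qn j i (outrow y j)) / \<Gamma>"
      using False by simp
    finally show ?thesis .
  qed
  then have "expect (\<lambda>C. \<Sum>y\<in>codewords M n. (\<Prod>j<M. Vn j i (C (w, j, l j)) (outrow y j)) * of_bool (accepts C A \<Gamma> i w' l' y))
     \<le> (\<Sum>y\<in>codewords M n. (\<Prod>j<M. Qn j i (outrow y j)) / \<Gamma>)"
    unfolding expect_sum by (rule sum_mono)
  also have "\<dots> = 1 / \<Gamma>"
    by (simp add: sum_prod_Q flip: sum_divide_distrib)
  finally show ?thesis .
qed

text \<open>A union bound over wrong messages and their indices on \<open>A\<close>. Only
  \<open>L j\<close> with \<open>j \<in> A\<close> enters: the randomness on ignored channels costs
  the receiver nothing.\<close>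

lemma expect_err_prob_le:
  assumes A: "A \<subseteq> {..<M}" and \<Gamma>: "\<Gamma> > 0" and s: "s > 0" and dec: "\<And>C. dec C i = decode C A \<Gamma> i"
  shows "expect (\<lambda>C. err_prob M K n W N (enc C) (dec C) i)
    \<le> \<Gamma> powr s * (\<Prod>j\<in>A. moment j i (- s) ^ n) + real N * (\<Prod>j\<in>A. real (L j)) / \<Gamma>" (is "_ \<le> ?b")
proof -
  have *: "expect (\<lambda>C. \<Sum>y\<in>codewords M n. (\<Prod>j<M. Vn j i (C (w, j, l j)) (outrow y j)) * of_bool (dec C i y \<noteq> w)) \<le> ?b"
    if w: "w \<in> {1..N}" and l: "l \<in> Lset {..<M}" for w l
  proof -
    let ?v = "\<lambda>C y. \<Prod>j<M. Vn j i (C (w, j, l j)) (outrow y j)"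
    have "expect (\<lambda>C. \<Sum>y\<in>codewords M n. ?v C y * of_bool (dec C i y \<noteq> w))
      \<le> expect (\<lambda>C. \<Sum>y\<in>codewords M n. ?v C y * (of_bool (\<not> accepts C A \<Gamma> i w l y)
           + (\<Sum>w'\<in>{1..N} - {w}. \<Sum>l'\<in>Lset A. of_bool (accepts C A \<Gamma> i w' l' y))))"
      unfolding dec by (intro expect_mono sum_mono mult_left_mono decode_error_le w l A prod_nonneg Vn_nonneg) auto
    also have "\<dots> = expect (\<lambda>C. \<Sum>y\<in>codewords M n. ?v C y * of_bool (\<not> accepts C A \<Gamma> i w l y))
       + (\<Sum>w'\<in>{1..N} - {w}. \<Sum>l'\<in>Lset A. expect (\<lambda>C. \<Sum>y\<in>codewords M n. ?v C y * of_bool (accepts C A \<Gamma> i w' l' y)))"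
    proof -
      have "(\<Sum>y\<in>codewords M n. ?v C y * (\<Sum>w'\<in>{1..N} - {w}. \<Sum>l'\<in>Lset A. of_bool (accepts C A \<Gamma> i w' l' y)))
         = (\<Sum>w'\<in>{1..N} - {w}. \<Sum>l'\<in>Lset A. \<Sum>y\<in>codewords M n. ?v C y * of_bool (accepts C A \<Gamma> i w' l' y))" for C
        unfolding sum_distrib_left
        by (subst sum.swap, rule sum.cong[OF refl], subst sum.swap, rule refl)
      then show ?thesis
        by (simp only: distrib_left sum.distrib expect_add expect_sum)
    qed
    also have "\<dots> \<le> \<Gamma> powr s * (\<Prod>j\<in>A. moment j i (- s) ^ n) + (\<Sum>w'\<in>{1..N} - {w}. \<Sum>l'\<in>Lset A. 1 / \<Gamma>)"
      by (intro add_mono sum_mono expect_miss_le expect_false_alarm_le w l A \<Gamma> s) auto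
    also have "\<dots> \<le> ?b"
    proof -
      have "(\<Sum>w'\<in>{1..N} - {w}. \<Sum>l'\<in>Lset A. 1 / \<Gamma>) = real (N - 1) * (\<Prod>j\<in>A. real (L j)) / \<Gamma>"
        using w by (simp add: card_Lset[OF A])
      also have "\<dots> \<le> real N * (\<Prod>j\<in>A. real (L j)) / \<Gamma>"
        using \<Gamma> by (intro divide_right_mono mult_right_mono prod_nonneg) auto
      finally show ?thesis by simp
    qed
    finally show ?thesis .
  qed
  have "expect (\<lambda>C. err_prob M K n W N (enc C) (dec C) i)
     = 1 / real N * (\<Sum>w\<in>{1..N}. 1 / real (card (Lset {..<M})) * (\<Sum>l\<in>Lset {..<M}.
       expect (\<lambda>C. \<Sum>y\<in>codewords M n. (\<Prod>j<M. Vn j i (C (w, j, l j)) (outrow y j)) * of_bool (dec C i y \<noteq> w))))"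
    unfolding err_prob_enc by (simp only: expect_cmult expect_sum)
  also have "\<dots> \<le> 1 / real N * (\<Sum>w\<in>{1..N}. 1 / real (card (Lset {..<M})) * (\<Sum>l\<in>Lset {..<M}. ?b))"
    by (intro mult_left_mono sum_mono *) auto
  also have "\<dots> = ?b"
    using N_pos card_Lset_pos by simp
  finally show ?thesis .
qed

subsection \<open>Soft covering\<close>

text \<open>Absolute continuity with respect to the averaged output law. A codebook of positive
  probability contains only letters of positive probability.\<close>

lemma Vn_pos_imp_Qn_pos:
  assumes "\<mu> C > 0" "(w, j, l) \<in> B" "Vn j r (C (w, j, l)) y > 0"
  shows "Qn j r y > 0"
  unfolding Qn_def
proof (rule prod_pos)
  fix t assume t: "t \<in> {..<n}"
  have j: "j < M" using assms(2) by (auto simp: B_def)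
  have "pw j (C (w, j, l)) \<noteq> 0"
    using prod_pos_imp_nonzero[OF finite_B assms(1)[unfolded \<mu>_def] assms(2)] by simp
  then have "P j (C (w, j, l) t) \<noteq> 0"
    using t prod_zero[of "{..<n}" "\<lambda>t. P j (C (w, j, l) t)"] by (auto simp: pw_def)
  moreover have "V j r (C (w, j, l) t) (y t) \<noteq> 0"
    using prod_pos_imp_nonzero[OF _ assms(3)[unfolded Vn_def] t] by simp
  ultimately show "Q j r (y t) > 0"
    using Q_pos[OF j] P_nonneg[OF j] recv_chan_nonneg[OF j] by (metis order.not_eq_order_implies_strict)
qed

definition eve_law :: "(nat \<times> nat \<times> nat \<Rightarrow> nat \<Rightarrow> 'x) \<Rightarrow> nat \<Rightarrow> nat \<Rightarrow> (nat \<Rightarrow> 'y) \<Rightarrow> real" where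
  "eve_law C w j y = 1 / real (L j) * (\<Sum>l<L j. Vn j K (C (w, j, l)) y)"

text \<open>Relative entropy, in bits, of the eavesdropper's word from the i.i.d. law
  \<open>Qn\<close>, which does not depend on the message.\<close>

definition divergence :: "(nat \<times> nat \<times> nat \<Rightarrow> nat \<Rightarrow> 'x) \<Rightarrow> nat \<Rightarrow> nat \<Rightarrow> real" where
  "divergence C w j = (\<Sum>y\<in>Yn. eve_law C w j y * log 2 (eve_law C w j y / Qn j K y))"

lemma eve_law_nonneg: "j < M \<Longrightarrow> eve_law C w j y \<ge> 0"
  unfolding eve_law_def by (intro mult_nonneg_nonneg sum_nonneg Vn_nonneg) auto

lemma eve_law_sum: "j < M \<Longrightarrow> (\<Sum>y\<in>Yn. eve_law C w j y) = 1"
  unfolding eve_law_def sum_distrib_left[symmetric]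
  by (subst sum.swap) (use L_pos[of j] in \<open>simp add: Vn_sum\<close>)

lemma eve_law_pos_imp_Qn_pos:
  assumes "\<mu> C > 0" "w \<in> {1..N}" "j < M" "eve_law C w j y > 0"
  shows "Qn j K y > 0"
proof -
  have "(\<Sum>l<L j. Vn j K (C (w, j, l)) y) \<noteq> 0"
    using assms(4) by (auto simp: eve_law_def)
  then obtain l where l: "l < L j" "Vn j K (C (w, j, l)) y \<noteq> 0"
    by (metis (no_types, lifting) lessThan_iff sum.neutral)
  then have "Vn j K (C (w, j, l)) y > 0"
    using Vn_nonneg[OF assms(3), of K "C (w, j, l)" y] by simp
  then show ?thesis
    using assms l by (intro Vn_pos_imp_Qn_pos) (auto simp: B_def)
qed

lemma divergence_nonneg:
  assumes "\<mu> C > 0" "w \<in> {1..N}" "j < M"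
  shows "divergence C w j \<ge> 0"
  unfolding divergence_def
  by (rule gibbs) (use assms in \<open>auto simp: eve_law_nonneg Qn_nonneg eve_law_sum Qn_sum intro: eve_law_pos_imp_Qn_pos\<close>)

text \<open>With \<open>b = 1 + v l / (m q)\<close>, the tangent inequality \<open>ln a \<le> ln b + (a - b) / b\<close> at \<open>a = F / q\<close>
  replaces Jensen's inequality. The second part of the bound is bilinear in a function of \<open>v l\<close> and the
  other \<open>v l'\<close>, so pairwise independent \<open>v l\<close> of mean \<open>q\<close> give it a nonpositive expectation.\<close>
lemma mixture_ln_le:
  fixes v :: "nat \<Rightarrow> real" and m :: nat
  assumes v: "\<And>l. l < m \<Longrightarrow> v l \<ge> 0" and q: "q > 0" and m: "m > 0" and \<rho>: "0 < \<rho>" "\<rho> \<le> 1"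
  defines "F \<equiv> 1 / real m * (\<Sum>l<m. v l)"
  shows "F * ln (F / q) \<le> 1 / real m * (\<Sum>l<m. real m powr (- \<rho>) / \<rho> * (v l * (v l / q) powr \<rho>)
     + ((\<Sum>l'\<in>{..<m} - {l}. v l / (1 + v l / (real m * q)) * v l') / (real m * q) - v l / (1 + v l / (real m * q))))"
proof (cases "F = 0")
  case True
  then have "v l = 0" if "l < m" for l
    using that v m sum_nonneg_eq_0_iff[of "{..<m}" v] by (simp add: F_def)
  then show ?thesis using True by simp
next
  case False
  moreover have "F \<ge> 0"
    unfolding F_def using v by (intro mult_nonneg_nonneg sum_nonneg) auto
  ultimately have F: "F > 0" by simp
  have *: "v l * ln (F / q) \<le> real m powr (- \<rho>) / \<rho> * (v l * (v l / q) powr \<rho>)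
     + ((\<Sum>l'\<in>{..<m} - {l}. v l / (1 + v l / (real m * q)) * v l') / (real m * q) - v l / (1 + v l / (real m * q)))"
    if l: "l < m" for l
  proof -
    \<comment> \<open>The contribution of the word \<open>l\<close> to \<open>F / q\<close> is kept;
      that of the other words, which has mean \<open>(m - 1) / m\<close> when every
      \<open>v l'\<close> has mean \<open>q\<close>, is replaced by 1.\<close>
    define b where "b = 1 + v l / (real m * q)"
    have b: "b \<ge> 1" using v[OF l] q by (simp add: b_def)
    have "ln (F / q) - ln b = ln (F / q / b)"
      using F q b by (subst ln_div) auto
    also have "\<dots> \<le> F / q / b - 1"
      using F q b by (intro ln_le_minus_one) auto
    also have "\<dots> = (F / q - b) / b"
      using b by (simp add: field_simps)
    finally have "ln (F / q) \<le> ln b + (F / q - b) / b" by simp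
    moreover have "ln b \<le> (v l / (real m * q)) powr \<rho> / \<rho>"
      unfolding b_def using v[OF l] q \<rho> by (intro ln_one_plus_le_powr) auto
    ultimately have "v l * ln (F / q) \<le> v l * ((v l / (real m * q)) powr \<rho> / \<rho> + (F / q - b) / b)"
      using v[OF l] by (intro mult_left_mono) auto
    moreover have "F / q - b = (\<Sum>l'\<in>{..<m} - {l}. v l') / (real m * q) - 1"
    proof -
      have "(\<Sum>l<m. v l) = v l + (\<Sum>l'\<in>{..<m} - {l}. v l')"
        using l by (intro sum.remove) auto
      then show ?thesis
        by (simp add: F_def b_def add_divide_distrib)
    qed
    moreover have "(v l / (real m * q)) powr \<rho> = real m powr (- \<rho>) * (v l / q) powr \<rho>"
      using v[OF l] q m by (simp add: powr_divide powr_mult powr_minus_divide)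
    ultimately show ?thesis
      unfolding b_def[symmetric] sum_distrib_left[symmetric]
      by (simp add: algebra_simps diff_divide_distrib)
  qed
  have "F * ln (F / q) = 1 / real m * (\<Sum>l<m. v l * ln (F / q))"
    unfolding sum_distrib_right[symmetric] by (simp add: F_def)
  also have "\<dots> \<le> 1 / real m * (\<Sum>l<m. real m powr (- \<rho>) / \<rho> * (v l * (v l / q) powr \<rho>)
     + ((\<Sum>l'\<in>{..<m} - {l}. v l / (1 + v l / (real m * q)) * v l') / (real m * q) - v l / (1 + v l / (real m * q))))"
    using * by (intro mult_left_mono sum_mono) auto
  finally show ?thesis .
qed

text \<open>Soft covering in relative entropy. For small \<open>\<rho>\<close> the moment power
  grows roughly like \<open>2 powr (n * \<rho> * I)\<close>, with I the mutual information to the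
  eavesdropper, so the bound decays once \<open>L j\<close> exceeds \<open>2 powr (n * I)\<close> by
  an exponential factor.\<close>

lemma expect_divergence_le:
  assumes w: "w \<in> {1..N}" and j: "j < M" and \<rho>: "0 < \<rho>" "\<rho> \<le> 1"
  shows "expect (\<lambda>C. divergence C w j) \<le> real (L j) powr (- \<rho>) / (\<rho> * ln 2) * moment j K \<rho> ^ n"
proof -
  define c where "c = real (L j) powr (- \<rho>) / \<rho>"
  have c: "c \<ge> 0" using \<rho> by (simp add: c_def)
  define T where "T y = (\<Sum>x\<in>Xn. pw j x * (Vn j K x y * (Vn j K x y / Qn j K y) powr \<rho>))" for y
  have T: "T y \<ge> 0" for y
    unfolding T_def by (intro sum_nonneg mult_nonneg_nonneg pw_nonneg Vn_nonneg j) auto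
  have inB: "(w, j, l) \<in> B" if "l < L j" for l
    using w j that by (auto simp: B_def)
  have main: "expect (\<lambda>C. eve_law C w j y * ln (eve_law C w j y / Qn j K y)) \<le> c * T y" for y
  proof (cases "Qn j K y = 0")
    \<comment> \<open>The quotient by 0 makes the logarithm 0. For codebooks of positive probability
      \<open>eve_law\<close> vanishes here as well.\<close>
    case True
    then show ?thesis using c T[of y] by (simp add: expect_def)
  next
    case False
    then have q: "Qn j K y > 0" using Qn_nonneg[OF j, of K y] by simp
    define g where "g v = v / (1 + v / (real (L j) * Qn j K y))" for v :: real
    define Eg where "Eg = (\<Sum>x\<in>Xn. pw j x * g (Vn j K x y))"
    have Eg: "Eg \<ge> 0"
      unfolding Eg_def g_def using q
      by (intro sum_nonneg mult_nonneg_nonneg divide_nonneg_nonneg add_nonneg_nonneg pw_nonneg Vn_nonneg j) auto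
    have "expect (\<lambda>C. eve_law C w j y * ln (eve_law C w j y / Qn j K y))
      \<le> expect (\<lambda>C. 1 / real (L j) * (\<Sum>l<L j. c * (Vn j K (C (w, j, l)) y * (Vn j K (C (w, j, l)) y / Qn j K y) powr \<rho>)
          + ((\<Sum>l'\<in>{..<L j} - {l}. g (Vn j K (C (w, j, l)) y) * Vn j K (C (w, j, l')) y) / (real (L j) * Qn j K y)
              - g (Vn j K (C (w, j, l)) y))))"
      unfolding eve_law_def c_def g_def
      by (intro expect_mono mixture_ln_le Vn_nonneg j q L_pos \<rho>)
    also have "\<dots> = 1 / real (L j) * (\<Sum>l<L j. c * T y + ((\<Sum>l'\<in>{..<L j} - {l}. Eg * Qn j K y) / (real (L j) * Qn j K y) - Eg))"
    proof -
      have 1: "expect (\<lambda>C. Vn j K (C (w, j, l)) y * (Vn j K (C (w, j, l)) y / Qn j K y) powr \<rho>) = T y" if "l < L j" for l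
        using expect_single[OF inB[OF that], of "\<lambda>x. Vn j K x y * (Vn j K x y / Qn j K y) powr \<rho>"] by (simp add: T_def)
      have 2: "expect (\<lambda>C. g (Vn j K (C (w, j, l)) y)) = Eg" if "l < L j" for l
        using expect_single[OF inB[OF that], of "\<lambda>x. g (Vn j K x y)"] by (simp add: Eg_def)
      have 3: "expect (\<lambda>C. g (Vn j K (C (w, j, l)) y) * Vn j K (C (w, j, l')) y) = Eg * Qn j K y"
        if "l < L j" "l' \<in> {..<L j} - {l}" for l l'
        using expect_pair[OF inB[OF that(1)], of "(w, j, l')" "\<lambda>x. g (Vn j K x y)" "\<lambda>x. Vn j K x y"] inB[of l'] that
        by (simp add: Eg_def sum_pw_Vn)
      show ?thesis
        unfolding expect_cmult expect_sum expect_add expect_diff expect_divide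
        by (intro arg_cong2[where f = times] arg_cong2[where f = plus] arg_cong2[where f = minus] arg_cong2[where f = divide] sum.cong refl)
           (auto simp: 1 2 3)
    qed
    \<comment> \<open>Pairwise independence has turned each cross term into a product of means.
      There are only \<open>L j - 1\<close> of them, so after division by \<open>L j\<close> they do
      not outweigh the subtracted \<open>Eg\<close>.\<close>
    also have "\<dots> \<le> 1 / real (L j) * (\<Sum>l<L j. c * T y)"
    proof (intro mult_left_mono sum_mono)
      fix l assume l: "l \<in> {..<L j}"
      have "(\<Sum>l'\<in>{..<L j} - {l}. Eg * Qn j K y) / (real (L j) * Qn j K y) = real (L j - 1) / real (L j) * Eg"
        using l q by simp
      also have "\<dots> \<le> 1 * Eg"
        using Eg by (intro mult_right_mono) (auto simp: divide_le_eq_1)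
      finally show "c * T y + ((\<Sum>l'\<in>{..<L j} - {l}. Eg * Qn j K y) / (real (L j) * Qn j K y) - Eg) \<le> c * T y"
        by simp
    qed simp
    also have "\<dots> = c * T y"
      using L_pos[OF j] by simp
    finally show ?thesis .
  qed
  have T_sum: "(\<Sum>y\<in>Yn. T y) = moment j K \<rho> ^ n"
  proof -
    have "T y = (\<Prod>t<n. \<Sum>x\<in>UNIV. P j x * (V j K x (y t) * (V j K x (y t) / Q j K (y t)) powr \<rho>))" for y
    proof -
      have "Vn j K x y * (Vn j K x y / Qn j K y) powr \<rho> = (\<Prod>t<n. V j K (x t) (y t) * (V j K (x t) (y t) / Q j K (y t)) powr \<rho>)" for x
        by (simp only: Vn_def Qn_def prod.distrib prod_dividef[symmetric] prod_powr_distrib)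
      then show ?thesis
        unfolding T_def by (simp only: sum_pw[of j "\<lambda>t x. V j K x (y t) * (V j K x (y t) / Q j K (y t)) powr \<rho>"])
    qed
    then have "(\<Sum>y\<in>Yn. T y) = (\<Prod>t<n. \<Sum>y\<in>UNIV. \<Sum>x\<in>UNIV. P j x * (V j K x y * (V j K x y / Q j K y) powr \<rho>))"
      unfolding Yn_def by (subst prod_sum_PiE) auto
    also have "\<dots> = moment j K \<rho> ^ n"
      unfolding info_moment_def by (subst sum.swap) (simp add: mult_ac)
    finally show ?thesis .
  qed
  have "expect (\<lambda>C. divergence C w j) = (\<Sum>y\<in>Yn. expect (\<lambda>C. eve_law C w j y * ln (eve_law C w j y / Qn j K y))) / ln 2"
    unfolding divergence_def log_def times_divide_eq_right
    by (simp only: expect_sum expect_divide sum_divide_distrib)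
  also have "\<dots> \<le> (\<Sum>y\<in>Yn. c * T y) / ln 2"
    by (intro divide_right_mono sum_mono main) auto
  also have "\<dots> = real (L j) powr (- \<rho>) / (\<rho> * ln 2) * moment j K \<rho> ^ n"
    unfolding sum_distrib_left[symmetric] T_sum by (simp add: c_def)
  finally show ?thesis .
qed

text \<open>The local indices are drawn independently over the channels, so the uniform mixture over
  \<open>Lset {..<M}\<close> is a product of mixtures. This is what makes the leakages of the
  channels add.\<close>

lemma pWYe_enc:
  assumes "ye \<in> codewords M n"
  shows "pWYe M K n W N (enc C) w ye = 1 / real N * (\<Prod>j<M. eve_law C w j (outrow ye j))"
proof -
  have "(\<Prod>j<M. eve_law C w j (outrow ye j))
      = 1 / real (card (Lset {..<M})) * (\<Sum>l\<in>Lset {..<M}. \<Prod>j<M. Vn j K (C (w, j, l j)) (outrow ye j))"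
    unfolding eve_law_def prod.distrib
    by (subst prod_sum_PiE) (auto simp: card_Lset prod_dividef)
  then show ?thesis
    unfolding pWYe_def sum_chan_prob_obs_eq[OF assms] sum_enc prod_V_cw by simp
qed

lemma sum_prod_eve_law:
  assumes "m < M"
  shows "(\<Sum>ye\<in>codewords M n. (\<Prod>j<M. eve_law C w j (outrow ye j)) * f (outrow ye m)) = (\<Sum>y\<in>Yn. eve_law C w m y * f y)"
proof -
  have outrow: "outrow (restrict (\<lambda>(a, b). Y a b) I) j = Y j" if "Y \<in> PiE {..<M} (\<lambda>_. Yn)" "j < M" for Y j
    using that by (auto simp: outrow_def fun_eq_iff Yn_def PiE_iff extensional_def)
  have "(\<Sum>ye\<in>codewords M n. (\<Prod>j<M. eve_law C w j (outrow ye j)) * f (outrow ye m))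
      = (\<Sum>Y\<in>PiE {..<M} (\<lambda>_. Yn). (\<Prod>j<M. eve_law C w j (Y j)) * f (Y m))"
    unfolding codewords_def sum_PiE_curry Yn_def[symmetric]
    using assms by (intro sum.cong refl) (simp add: outrow)
  also have "\<dots> = (\<Sum>y\<in>Yn. eve_law C w m y * f y)"
    by (rule sum_PiE_prod_component) (use assms in \<open>auto simp: eve_law_sum\<close>)
  finally show ?thesis .
qed

text \<open>The leakage is the average over \<open>w\<close> of the divergence of the law of
  \<open>Y_e\<close> given \<open>w\<close> from its mean, and any other reference law in place of
  the mean only increases it. With the product of the \<open>Qn\<close> as reference, the divergence
  splits into channels.\<close>

lemma equivocation_enc_ge:
  assumes \<mu>: "\<mu> C > 0"
  shows "equivocation M K n W N (enc C) \<ge> log 2 (real N) - 1 / real N * (\<Sum>w\<in>{1..N}. \<Sum>j<M. divergence C w j)"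
proof -
  interpret c: wiretap_code M K W n N "enc C"
    by unfold_locales (auto simp: n_pos N_pos valid_encoder_enc)
  let ?p = "pWYe M K n W N (enc C)"
  define q where "q ye = (\<Prod>j<M. Qn j K (outrow ye j))" for ye
  have q_pos: "q ye > 0" if "w \<in> {1..N}" "ye \<in> codewords M n" "?p w ye > 0" for w ye
    unfolding q_def
  proof (rule prod_pos)
    fix j assume j: "j \<in> {..<M}"
    have "eve_law C w j (outrow ye j) \<noteq> 0"
      using that(3) N_pos by (intro prod_pos_imp_nonzero[OF _ _ j]) (auto simp: pWYe_enc[OF that(2)] zero_less_divide_iff)
    then show "Qn j K (outrow ye j) > 0"
      using eve_law_nonneg[of j C w "outrow ye j"] j \<mu> that by (intro eve_law_pos_imp_Qn_pos) auto
  qed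
  have pYe_pos: "c.pYe ye > 0" if "w \<in> {1..N}" "?p w ye > 0" for w ye
  proof -
    have "?p w ye \<le> c.pYe ye"
      unfolding c.pYe_def by (rule member_le_sum) (use that c.pWYe_nonneg in auto)
    then show ?thesis using that by simp
  qed
  have gibbs_q: "(\<Sum>ye\<in>codewords M n. c.pYe ye * log 2 (c.pYe ye / q ye)) \<ge> 0"
  proof (rule gibbs)
    fix ye :: "nat \<times> nat \<Rightarrow> 'y" assume ye: "ye \<in> codewords M n"
    show "c.pYe ye \<ge> 0"
      unfolding c.pYe_def by (intro sum_nonneg c.pWYe_nonneg)
    show "q ye \<ge> 0"
      unfolding q_def by (intro prod_nonneg) (auto simp: Qn_nonneg)
    assume "c.pYe ye > 0"
    then obtain w where "w \<in> {1..N}" "?p w ye \<noteq> 0"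
      unfolding c.pYe_def by (metis less_irrefl sum.neutral)
    then show "q ye > 0"
      using q_pos[OF _ ye] c.pWYe_nonneg by (metis order.not_eq_order_implies_strict)
  qed (auto simp: c.pYe_sum q_def sum_prod_Q)
  have summand: "?p w ye * log 2 (?p w ye / c.pYe ye)
      = ?p w ye * (\<Sum>j<M. log 2 (eve_law C w j (outrow ye j) / Qn j K (outrow ye j))) - ?p w ye * log 2 (real N) - ?p w ye * log 2 (c.pYe ye / q ye)"
    if w: "w \<in> {1..N}" and ye: "ye \<in> codewords M n" for w ye
  proof (cases "?p w ye = 0")
    case False
    then have p: "?p w ye > 0" using c.pWYe_nonneg[OF w, of ye] by simp
    note pos = q_pos[OF w ye p] pYe_pos[OF w p]
    have e: "eve_law C w j (outrow ye j) > 0" if "j < M" for j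
    proof -
      have "(\<Prod>j<M. eve_law C w j (outrow ye j)) > 0"
        using p N_pos by (simp add: pWYe_enc[OF ye] zero_less_divide_iff)
      then have "eve_law C w j (outrow ye j) \<noteq> 0"
        using that by (intro prod_pos_imp_nonzero[of "{..<M}" "\<lambda>j. eve_law C w j (outrow ye j)" j]) auto
      then show ?thesis
        using eve_law_nonneg[OF that, of C w "outrow ye j"] by simp
    qed
    have Qp: "Qn j K (outrow ye j) > 0" if "j < M" for j
      using eve_law_pos_imp_Qn_pos[OF \<mu> w that e[OF that]] .
    have "(\<Sum>j<M. log 2 (eve_law C w j (outrow ye j) / Qn j K (outrow ye j))) = log 2 (real N * ?p w ye / q ye)"
    proof -
      have "real N * ?p w ye / q ye = (\<Prod>j<M. eve_law C w j (outrow ye j) / Qn j K (outrow ye j))"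
        using N_pos by (simp add: pWYe_enc[OF ye] q_def prod_dividef)
      moreover have "ln (\<Prod>j<M. eve_law C w j (outrow ye j) / Qn j K (outrow ye j)) = (\<Sum>j<M. ln (eve_law C w j (outrow ye j) / Qn j K (outrow ye j)))"
        using e Qp by (intro ln_prod) (auto simp: less_imp_neq[symmetric])
      ultimately show ?thesis
        by (simp add: log_def flip: sum_divide_distrib)
    qed
    also have "\<dots> = log 2 (real N) + log 2 (?p w ye) - log 2 (q ye)"
      using pos p N_pos by (simp add: log_divide log_mult)
    finally have S: "(\<Sum>j<M. log 2 (eve_law C w j (outrow ye j) / Qn j K (outrow ye j))) = log 2 (real N) + log 2 (?p w ye) - log 2 (q ye)" .
    have l: "log 2 (?p w ye / c.pYe ye) = log 2 (?p w ye) - log 2 (c.pYe ye)" "log 2 (c.pYe ye / q ye) = log 2 (c.pYe ye) - log 2 (q ye)"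
      using pos p by (simp_all add: log_divide)
    show ?thesis
      unfolding S l by (simp add: algebra_simps)
  qed simp
  have "- equivocation M K n W N (enc C) = (\<Sum>w\<in>{1..N}. \<Sum>ye\<in>codewords M n. ?p w ye * log 2 (?p w ye / c.pYe ye))"
    unfolding c.equivocation_eq c.sum_joint_prob_obs_Ye[of "\<lambda>w ye. log 2 (?p w ye / c.pYe ye)"] by simp
  also have "\<dots> = (\<Sum>w\<in>{1..N}. \<Sum>ye\<in>codewords M n. ?p w ye * (\<Sum>j<M. log 2 (eve_law C w j (outrow ye j) / Qn j K (outrow ye j))))
     - (\<Sum>w\<in>{1..N}. \<Sum>ye\<in>codewords M n. ?p w ye) * log 2 (real N)
     - (\<Sum>w\<in>{1..N}. \<Sum>ye\<in>codewords M n. ?p w ye * log 2 (c.pYe ye / q ye))"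
    by (simp add: summand sum_subtractf sum_distrib_right)
  also have "(\<Sum>w\<in>{1..N}. \<Sum>ye\<in>codewords M n. ?p w ye) = 1"
    using c.pYe_sum unfolding c.pYe_def by (subst sum.swap)
  also have "(\<Sum>w\<in>{1..N}. \<Sum>ye\<in>codewords M n. ?p w ye * log 2 (c.pYe ye / q ye))
      = (\<Sum>ye\<in>codewords M n. c.pYe ye * log 2 (c.pYe ye / q ye))"
    by (subst sum.swap) (simp only: c.pYe_def sum_distrib_right)
  also have "(\<Sum>w\<in>{1..N}. \<Sum>ye\<in>codewords M n. ?p w ye * (\<Sum>j<M. log 2 (eve_law C w j (outrow ye j) / Qn j K (outrow ye j))))
      = 1 / real N * (\<Sum>w\<in>{1..N}. \<Sum>j<M. divergence C w j)"
  proof -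
    have "(\<Sum>ye\<in>codewords M n. ?p w ye * (\<Sum>j<M. log 2 (eve_law C w j (outrow ye j) / Qn j K (outrow ye j))))
        = 1 / real N * (\<Sum>j<M. divergence C w j)" for w
    proof -
      have "(\<Sum>ye\<in>codewords M n. ?p w ye * (\<Sum>j<M. log 2 (eve_law C w j (outrow ye j) / Qn j K (outrow ye j))))
         = (\<Sum>j<M. 1 / real N * (\<Sum>ye\<in>codewords M n. (\<Prod>j<M. eve_law C w j (outrow ye j)) * log 2 (eve_law C w j (outrow ye j) / Qn j K (outrow ye j))))"
        unfolding sum_distrib_left by (subst sum.swap) (simp add: pWYe_enc mult_ac)
      then show ?thesis
        by (simp add: sum_prod_eve_law[where f = "\<lambda>y. log 2 (eve_law C w _ y / Qn _ K y)"] divergence_def sum_distrib_left)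
    qed
    then show ?thesis by (simp only: sum_distrib_left)
  qed
  finally show ?thesis using gibbs_q by simp
qed

text \<open>All error probabilities and the leakage enter one sum of nonnegative terms, so a single
  codebook of at most average cost is good for every receiver and against the eavesdropper at
  once.\<close>

lemma exists_code:
  fixes A :: "nat \<Rightarrow> nat set" and \<Gamma> :: "nat \<Rightarrow> real"
  assumes A: "\<And>i. i < K \<Longrightarrow> A i \<subseteq> {..<M}" and \<Gamma>: "\<And>i. i < K \<Longrightarrow> \<Gamma> i > 0" and s: "s > 0" and \<rho>: "0 < \<rho>" "\<rho> \<le> 1"
    and b: "(\<Sum>i<K. \<Gamma> i powr s * (\<Prod>j\<in>A i. moment j i (- s) ^ n) + real N * (\<Prod>j\<in>A i. real (L j)) / \<Gamma> i)
       + (\<Sum>j<M. real (L j) powr (- \<rho>) / (\<rho> * ln 2) * moment j K \<rho> ^ n) \<le> b"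
  obtains e d where "valid_encoder M n N e" "\<And>i. i < K \<Longrightarrow> err_prob M K n W N e d i \<le> b"
    "equivocation M K n W N e \<ge> log 2 (real N) - b"
proof -
  define dec where "dec C i = decode C (A i) (\<Gamma> i) i" for C i
  define G where "G C = (\<Sum>i<K. err_prob M K n W N (enc C) (dec C) i) + 1 / real N * (\<Sum>w\<in>{1..N}. \<Sum>j<M. divergence C w j)" for C
  have "expect G = (\<Sum>i<K. expect (\<lambda>C. err_prob M K n W N (enc C) (dec C) i)) + 1 / real N * (\<Sum>w\<in>{1..N}. \<Sum>j<M. expect (\<lambda>C. divergence C w j))"
    unfolding G_def by (simp only: expect_add expect_cmult expect_sum)
  also have "\<dots> \<le> (\<Sum>i<K. \<Gamma> i powr s * (\<Prod>j\<in>A i. moment j i (- s) ^ n) + real N * (\<Prod>j\<in>A i. real (L j)) / \<Gamma> i)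
     + 1 / real N * (\<Sum>w\<in>{1..N}. \<Sum>j<M. real (L j) powr (- \<rho>) / (\<rho> * ln 2) * moment j K \<rho> ^ n)"
    by (intro add_mono mult_left_mono sum_mono expect_err_prob_le expect_divergence_le A \<Gamma> s \<rho>) (auto simp: dec_def)
  also have "\<dots> \<le> b"
    using b N_pos by simp
  finally have "(\<Sum>C\<in>books. \<mu> C * G C) \<le> b"
    by (simp add: expect_def)
  then obtain C where C: "C \<in> books" "\<mu> C > 0" "G C \<le> b"
    using weighted_sum_le_imp_exists[OF finite_books \<mu>_nonneg \<mu>_sum] by blast
  interpret c: wiretap_code M K W n N "enc C"
    by unfold_locales (auto simp: n_pos N_pos valid_encoder_enc)
  have err_nonneg: "err_prob M K n W N (enc C) (dec C) i \<ge> 0" for i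
    unfolding c.err_prob_eq by (intro sum_nonneg mult_nonneg_nonneg c.joint_prob_nonneg) (auto split: prod.splits)
  have div_nonneg: "1 / real N * (\<Sum>w\<in>{1..N}. \<Sum>j<M. divergence C w j) \<ge> 0"
    by (intro mult_nonneg_nonneg sum_nonneg divergence_nonneg C) auto
  have "err_prob M K n W N (enc C) (dec C) i \<le> b" if "i < K" for i
  proof -
    have "err_prob M K n W N (enc C) (dec C) i \<le> (\<Sum>i<K. err_prob M K n W N (enc C) (dec C) i)"
      by (rule member_le_sum) (use that err_nonneg in auto)
    then show ?thesis using C(3) div_nonneg unfolding G_def by linarith
  qed
  moreover have "1 / real N * (\<Sum>w\<in>{1..N}. \<Sum>j<M. divergence C w j) \<le> b"
    using C(3) sum_nonneg[of "{..<K}" "\<lambda>i. err_prob M K n W N (enc C) (dec C) i", OF err_nonneg] unfolding G_def by linarith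
  ultimately show ?thesis
    using that[OF valid_encoder_enc] equivocation_enc_ge[OF C(2)] by (meson diff_left_mono order.trans)
qed

end

section \<open>Degraded channels\<close>

lemma restrict_eq_iff: "restrict f S = restrict g S \<longleftrightarrow> (\<forall>s\<in>S. f s = g s)"
  by (metis restrict_apply' restrict_ext)

section \<open>Markov chains of outputs on one channel\<close>

locale single_channel =
  fixes K :: nat and p :: "'x::finite \<Rightarrow> real" and Wj :: "'x \<Rightarrow> (nat \<Rightarrow> 'y::finite) \<Rightarrow> real" and \<pi> :: "nat \<Rightarrow> nat"
  assumes p_nonneg: "\<And>x. p x \<ge> 0" and Wj_nonneg: "\<And>x v. v \<in> outs K \<Longrightarrow> Wj x v \<ge> 0"
    and bij: "bij_betw \<pi> {..K} {..K}" and markov: "markov_chain_order K p Wj \<pi>"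
begin

text \<open>\<open>pr E x\<close> is Pr(X = x, E), and \<open>prs E\<close> below is Pr(E). Events
  replace the restricted vectors of \<open>margXS\<close>, so that one output at a time can be
  summed out.\<close>

definition pr :: "((nat \<Rightarrow> 'y) \<Rightarrow> bool) \<Rightarrow> 'x \<Rightarrow> real" where
  "pr E x = (\<Sum>v\<in>{v\<in>outs K. E v}. p x * Wj x v)"

definition prs :: "((nat \<Rightarrow> 'y) \<Rightarrow> bool) \<Rightarrow> real" where
  "prs E = (\<Sum>x\<in>UNIV. pr E x)"

lemma pr_nonneg: "pr E x \<ge> 0"
  unfolding pr_def by (intro sum_nonneg) (auto simp: p_nonneg Wj_nonneg)

lemma pr_mono: "(\<And>v. E v \<Longrightarrow> E' v) \<Longrightarrow> pr E x \<le> pr E' x"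
  unfolding pr_def by (intro sum_mono2) (auto simp: p_nonneg Wj_nonneg)

lemma pr_le_prs: "pr E x \<le> prs E"
  unfolding prs_def by (rule member_le_sum) (auto simp: pr_nonneg)

lemma pr_split: "pr E x = (\<Sum>y\<in>UNIV. pr (\<lambda>v. E v \<and> v c = y) x)"
proof -
  have "(\<Sum>y\<in>UNIV. \<Sum>v\<in>{v\<in>{v\<in>outs K. E v}. v c = y}. p x * Wj x v) = (\<Sum>v\<in>{v\<in>outs K. E v}. p x * Wj x v)"
    by (rule sum.group) auto
  then show ?thesis by (simp add: pr_def conj_assoc)
qed

lemma margXS_restrict: "margXS K p Wj S x (restrict v S) = pr (\<lambda>v'. \<forall>s\<in>S. v' s = v s) x"
  by (simp add: margXS_def pr_def restrict_eq_iff)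

lemma margS_restrict: "margS K p Wj S (restrict v S) = prs (\<lambda>v'. \<forall>s\<in>S. v' s = v s)"
  by (simp add: margS_def prs_def margXS_restrict)

lemma sum_margXS:
  assumes "\<And>v v'. restrict v S = restrict v' S \<Longrightarrow> E v = E v'"
  shows "(\<Sum>u\<in>(\<lambda>v. restrict v S) ` {v\<in>outs K. E v}. margXS K p Wj S x u) = pr E x"
proof -
  have "pr E x = (\<Sum>u\<in>(\<lambda>v. restrict v S) ` {v\<in>outs K. E v}. \<Sum>v\<in>{v\<in>{v\<in>outs K. E v}. restrict v S = u}. p x * Wj x v)"
    unfolding pr_def by (rule sum.image_gen) auto
  also have "\<dots> = (\<Sum>u\<in>(\<lambda>v. restrict v S) ` {v\<in>outs K. E v}. margXS K p Wj S x u)"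
  proof (rule sum.cong[OF refl])
    fix u assume "u \<in> (\<lambda>v. restrict v S) ` {v\<in>outs K. E v}"
    then obtain v where v: "E v" "u = restrict v S" by auto
    have "E v'" if "restrict v' S = u" for v'
      using assms[OF trans[OF that v(2)]] v(1) by simp
    then have "{v\<in>{v\<in>outs K. E v}. restrict v S = u} = {v\<in>outs K. restrict v S = u}"
      by blast
    then show "(\<Sum>v\<in>{v\<in>{v\<in>outs K. E v}. restrict v S = u}. p x * Wj x v) = margXS K p Wj S x u"
      by (simp add: margXS_def)
  qed
  finally show ?thesis by simp
qed

text \<open>The assumed Markov condition involves all earlier outputs; summing out those other than
  position \<open>a\<close> leaves the triple. The case \<open>a = k\<close> serves neighbouring
  positions in \<open>markov_pair\<close>.\<close>

lemma markov_triple: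
  assumes "a \<le> k" "k < K"
  shows "pr (\<lambda>v. v (\<pi> a) = ya \<and> v (\<pi> k) = yc \<and> v (\<pi> (Suc k)) = yd) x * prs (\<lambda>v. v (\<pi> k) = yc)
       = pr (\<lambda>v. v (\<pi> a) = ya \<and> v (\<pi> k) = yc) x * prs (\<lambda>v. v (\<pi> k) = yc \<and> v (\<pi> (Suc k)) = yd)"
proof -
  define c d S T where "c = \<pi> k" and "d = \<pi> (Suc k)" and "S = \<pi> ` {..<k} \<union> {c}" and "T = insert d S"
  have inj: "inj_on \<pi> {..K}" using bij by (rule bij_betw_imp_inj_on)
  have dK: "d \<le> K"
    using bij_betwE[OF bij] assms by (auto simp: d_def)
  have dS: "d \<notin> S"
  proof
    assume "d \<in> S"
    then have "\<exists>m\<le>k. \<pi> (Suc k) = \<pi> m"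
      unfolding S_def c_def d_def by (auto intro: less_imp_le)
    then obtain m where m: "m \<le> k" "\<pi> (Suc k) = \<pi> m" by blast
    show False
      using inj_onD[OF inj m(2)] m(1) assms by auto
  qed
  have aS: "\<pi> a \<in> S" using assms by (cases "a = k") (auto simp: S_def c_def)
  let ?E = "\<lambda>v. v (\<pi> a) = ya \<and> v c = yc" and ?E' = "\<lambda>v. v (\<pi> a) = ya \<and> v c = yc \<and> v d = yd"
  let ?U = "(\<lambda>v. restrict v S) ` {v\<in>outs K. ?E v}" and ?U' = "(\<lambda>v. restrict v T) ` {v\<in>outs K. ?E' v}"
  have eq: "margXS K p Wj T x u * prs (\<lambda>v. v c = yc) = margXS K p Wj S x (restrict u S) * prs (\<lambda>v. v c = yc \<and> v d = yd)"
    if u: "u \<in> ?U'" for u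
  proof -
    obtain v where v: "v \<in> outs K" "?E' v" "u = restrict v T" using u by auto
    have "\<pi> ` {..<k} \<union> {\<pi> k, \<pi> (Suc k)} = T" "\<pi> ` {..<k} \<union> {\<pi> k} = S"
      by (auto simp: T_def S_def c_def d_def)
    then have "margXS K p Wj T x (restrict v T) * margS K p Wj {c} (restrict v {c})
        = margXS K p Wj S x (restrict v S) * margS K p Wj {c, d} (restrict v {c, d})"
      using markov v(1) assms(2) unfolding markov_chain_order_def Let_def c_def d_def by metis
    moreover have "restrict u S = restrict v S"
      using v(3) by (auto simp: restrict_eq_iff T_def)
    ultimately show ?thesis
      using v by (simp add: margS_restrict)
  qed
  \<comment> \<open>The value at \<open>d\<close> is fixed to \<open>yd\<close>, so forgetting it is
    injective, and the update \<open>v(d := yd)\<close> inverts it.\<close>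
  have bij': "bij_betw (\<lambda>u. restrict u S) ?U' ?U"
  proof (rule bij_betwI')
    fix u u' assume "u \<in> ?U'" "u' \<in> ?U'"
    then show "(restrict u S = restrict u' S) = (u = u')"
      by (auto simp: restrict_eq_iff T_def)
  next
    fix u assume "u \<in> ?U'"
    then obtain v where v: "v \<in> outs K" "?E' v" "u = restrict v T" by auto
    then have "restrict u S = restrict v S" by (auto simp: restrict_eq_iff T_def)
    then show "restrict u S \<in> ?U" using v by auto
  next
    fix u assume "u \<in> ?U"
    then obtain v where v: "v \<in> outs K" "?E v" "u = restrict v S" by auto
    have "v(d := yd) \<in> outs K" "?E' (v(d := yd))"
      using v dK dS aS by (auto simp: outs_def PiE_iff extensional_def S_def)
    moreover have "u = restrict (restrict (v(d := yd)) T) S"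
      using v(3) dS by (auto simp: restrict_eq_iff T_def)
    ultimately show "\<exists>u'\<in>?U'. u = restrict u' S" by blast
  qed
  have "pr ?E' x * prs (\<lambda>v. v c = yc) = (\<Sum>u\<in>?U'. margXS K p Wj T x u * prs (\<lambda>v. v c = yc))"
    unfolding sum_distrib_right[symmetric]
    by (subst sum_margXS) (use aS in \<open>auto simp: restrict_eq_iff T_def S_def\<close>)
  also have "\<dots> = (\<Sum>u\<in>?U'. margXS K p Wj S x (restrict u S)) * prs (\<lambda>v. v c = yc \<and> v d = yd)"
    by (simp only: eq sum_distrib_right cong: sum.cong)
  also have "(\<Sum>u\<in>?U'. margXS K p Wj S x (restrict u S)) = (\<Sum>u\<in>?U. margXS K p Wj S x u)"
    by (rule sum.reindex_bij_betw[OF bij'])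
  also have "\<dots> = pr ?E x"
    by (rule sum_margXS) (use aS in \<open>auto simp: restrict_eq_iff S_def\<close>)
  finally show ?thesis
    by (simp add: c_def d_def)
qed

text \<open>Induction along the chain: the transition from position \<open>k\<close> to the next one
  is the same with and without knowledge of \<open>x\<close>, so the relation passes through the sum
  over the intermediate output.\<close>

lemma markov_pair:
  assumes "a < b" "b \<le> K"
  shows "pr (\<lambda>v. v (\<pi> a) = ya \<and> v (\<pi> b) = yb) x * prs (\<lambda>v. v (\<pi> a) = ya)
       = pr (\<lambda>v. v (\<pi> a) = ya) x * prs (\<lambda>v. v (\<pi> a) = ya \<and> v (\<pi> b) = yb)"
  using assms
proof (induction b arbitrary: x yb)
  case (Suc k)
  show ?case
  proof (cases "a = k")
    case True
    then show ?thesis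
      using markov_triple[of k k ya ya yb x] Suc.prems by simp
  next
    case False
    then have ak: "a < k" "k < K" using Suc.prems by auto
    \<comment> \<open>The transition probability to \<open>yb\<close>. It is 0 where
      \<open>yc\<close> has probability 0, and there the joint probabilities vanish as well.\<close>
    define R where "R yc = prs (\<lambda>v. v (\<pi> k) = yc \<and> v (\<pi> (Suc k)) = yb) / prs (\<lambda>v. v (\<pi> k) = yc)" for yc
    have triple: "pr (\<lambda>v. v (\<pi> a) = ya \<and> v (\<pi> k) = yc \<and> v (\<pi> (Suc k)) = yb) x
        = pr (\<lambda>v. v (\<pi> a) = ya \<and> v (\<pi> k) = yc) x * R yc" for x yc
    proof (cases "prs (\<lambda>v. v (\<pi> k) = yc) = 0")
      case True
      have "pr (\<lambda>v. v (\<pi> a) = ya \<and> v (\<pi> k) = yc \<and> v (\<pi> (Suc k)) = yb) x \<le> pr (\<lambda>v. v (\<pi> k) = yc) x"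
        by (rule pr_mono) auto
      also have "\<dots> \<le> 0" using pr_le_prs[of "\<lambda>v. v (\<pi> k) = yc" x] True by simp
      finally show ?thesis
        using pr_nonneg[of "\<lambda>v. v (\<pi> a) = ya \<and> v (\<pi> k) = yc \<and> v (\<pi> (Suc k)) = yb" x] True by (simp add: R_def)
    next
      case False
      then show ?thesis
        using markov_triple[of a k ya yc yb x] ak by (simp add: R_def field_simps)
    qed
    have pair: "pr (\<lambda>v. v (\<pi> a) = ya \<and> v (\<pi> (Suc k)) = yb) x = (\<Sum>yc\<in>UNIV. pr (\<lambda>v. v (\<pi> a) = ya \<and> v (\<pi> k) = yc) x * R yc)" for x
      unfolding triple[symmetric] by (subst pr_split[where c = "\<pi> k"]) (simp add: conj_ac)
    have "prs (\<lambda>v. v (\<pi> a) = ya \<and> v (\<pi> (Suc k)) = yb) = (\<Sum>yc\<in>UNIV. prs (\<lambda>v. v (\<pi> a) = ya \<and> v (\<pi> k) = yc) * R yc)"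
      unfolding prs_def pair sum_distrib_right by (rule sum.swap)
    then have "pr (\<lambda>v. v (\<pi> a) = ya) x * prs (\<lambda>v. v (\<pi> a) = ya \<and> v (\<pi> (Suc k)) = yb)
       = (\<Sum>yc\<in>UNIV. (pr (\<lambda>v. v (\<pi> a) = ya) x * prs (\<lambda>v. v (\<pi> a) = ya \<and> v (\<pi> k) = yc)) * R yc)"
      by (simp add: sum_distrib_left mult.assoc)
    also have "\<dots> = (\<Sum>yc\<in>UNIV. pr (\<lambda>v. v (\<pi> a) = ya \<and> v (\<pi> k) = yc) x * prs (\<lambda>v. v (\<pi> a) = ya) * R yc)"
      using Suc.IH[OF ak(1)] ak by simp
    also have "\<dots> = pr (\<lambda>v. v (\<pi> a) = ya \<and> v (\<pi> (Suc k)) = yb) x * prs (\<lambda>v. v (\<pi> a) = ya)"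
      unfolding pair by (subst sum_distrib_right) (simp add: mult_ac)
    finally show ?thesis by simp
  qed
qed simp

end

section \<open>Conditional information on a degraded channel\<close>

context channel begin

text \<open>Receiver \<open>i\<close> stands before or after the eavesdropper in the order of the
  channel. Before, the conditional information density is the difference of the two densities;
  after, X and \<open>Y_i\<close> are independent given \<open>Y_e\<close>, and the ratio in the
  logarithm is 1.\<close>

lemma cmi_degraded:
  assumes j: "j < M" and p: "is_dist p" and i: "i < K" and deg: "reversely_degraded M K W"
  shows "cmi (joint_XYiYe K W j i p) = 0 \<or> cmi (joint_XYiYe K W j i p) = mutual_info p j i - mutual_info p j K"
proof -
  obtain \<pi> where \<pi>: "bij_betw \<pi> {..K} {..K}" "markov_chain_order K p (W j) \<pi>"
    using deg j p unfolding reversely_degraded_def by blast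
  interpret s: single_channel K p "W j" \<pi>
    using \<pi> p W_nonneg[OF j] by unfold_locales (auto simp: is_dist_def)
  define q where "q = joint_XYiYe K W j i p"
  have q: "q x y z = s.pr (\<lambda>v. v i = y \<and> v K = z) x" for x y z
    by (simp add: q_def joint_XYiYe_def s.pr_def sum_distrib_left)
  have q': "q x y z = p x * pair_chan K W j i x y z" for x y z
    by (simp add: q_def joint_XYiYe_eq)
  have r: "p x * recv_chan K W j r x y = s.pr (\<lambda>v. v r = y) x" for r x y
    by (simp add: recv_chan_def s.pr_def sum_distrib_left)
  have o: "out_law p j r y = s.prs (\<lambda>v. v r = y)" for r y
    by (simp add: out_law_def s.prs_def r)
  have yz: "(\<Sum>x\<in>UNIV. q x y z) = s.prs (\<lambda>v. v i = y \<and> v K = z)" for y z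
    by (simp add: s.prs_def q)
  have xz: "(\<Sum>y\<in>UNIV. q x y z) = s.pr (\<lambda>v. v K = z) x" for x z
    using s.pr_split[of "\<lambda>v. v K = z" x i] by (simp add: q conj_commute)
  have q_nonneg: "q x y z \<ge> 0" for x y z
    by (simp add: q s.pr_nonneg)
  have pos: "s.pr (\<lambda>v. v i = y) x > 0" "s.pr (\<lambda>v. v K = z) x > 0" "s.prs (\<lambda>v. v i = y) > 0" "s.prs (\<lambda>v. v K = z) > 0"
    "s.prs (\<lambda>v. v i = y \<and> v K = z) > 0" if "q x y z > 0" for x y z
  proof -
    note a = that[unfolded q]
    show 1: "s.pr (\<lambda>v. v i = y) x > 0" by (rule less_le_trans[OF a s.pr_mono]) simp
    show 2: "s.pr (\<lambda>v. v K = z) x > 0" by (rule less_le_trans[OF a s.pr_mono]) simp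
    show "s.prs (\<lambda>v. v i = y) > 0" "s.prs (\<lambda>v. v K = z) > 0" "s.prs (\<lambda>v. v i = y \<and> v K = z) > 0"
      by (rule less_le_trans[OF 1 s.pr_le_prs] less_le_trans[OF 2 s.pr_le_prs] less_le_trans[OF a s.pr_le_prs])+
  qed
  have cmi: "cmi q = (\<Sum>x\<in>UNIV. \<Sum>y\<in>UNIV. \<Sum>z\<in>UNIV. if q x y z = 0 then 0 else
      q x y z * log 2 (q x y z * s.prs (\<lambda>v. v K = z) / (s.pr (\<lambda>v. v K = z) x * s.prs (\<lambda>v. v i = y \<and> v K = z))))"
    unfolding cmi_def by (simp only: xz yz s.prs_def[symmetric])
  have "i \<in> \<pi> ` {..K}" "K \<in> \<pi> ` {..K}"
    using bij_betw_imp_surj_on[OF \<pi>(1)] i by simp_all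
  then obtain a b where ab: "a \<le> K" "b \<le> K" "\<pi> a = i" "\<pi> b = K"
    by (elim imageE) simp
  then have "a \<noteq> b" using i by auto
  then consider "a < b" | "b < a" by linarith
  then show ?thesis
  proof cases
    case 1
    have mk: "q x y z * s.prs (\<lambda>v. v i = y) = s.pr (\<lambda>v. v i = y) x * s.prs (\<lambda>v. v i = y \<and> v K = z)" for x y z
      using s.markov_pair[OF 1 ab(2), of y z x] ab by (simp add: q)
    have "cmi q = (\<Sum>x\<in>UNIV. \<Sum>y\<in>UNIV. \<Sum>z\<in>UNIV.
        q x y z * log 2 (recv_chan K W j i x y / out_law p j i y) - q x y z * log 2 (recv_chan K W j K x z / out_law p j K z))"
      unfolding cmi
    proof (intro sum.cong refl)
      fix x y z
      show "(if q x y z = 0 then 0 else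
          q x y z * log 2 (q x y z * s.prs (\<lambda>v. v K = z) / (s.pr (\<lambda>v. v K = z) x * s.prs (\<lambda>v. v i = y \<and> v K = z))))
        = q x y z * log 2 (recv_chan K W j i x y / out_law p j i y) - q x y z * log 2 (recv_chan K W j K x z / out_law p j K z)"
      proof (cases "q x y z = 0")
        case False
        then have qp: "q x y z > 0" using q_nonneg[of x y z] by simp
        note ps = pos[OF qp]
        have px: "p x > 0" using qp s.p_nonneg[of x] by (auto simp: q' zero_less_mult_iff)
        have "q x y z * s.prs (\<lambda>v. v K = z) / (s.pr (\<lambda>v. v K = z) x * s.prs (\<lambda>v. v i = y \<and> v K = z))
            = (s.pr (\<lambda>v. v i = y) x / s.prs (\<lambda>v. v i = y)) / (s.pr (\<lambda>v. v K = z) x / s.prs (\<lambda>v. v K = z))"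
          using ps mk[of x y z] by (simp add: field_simps)
        also have "\<dots> = (recv_chan K W j i x y / out_law p j i y) / (recv_chan K W j K x z / out_law p j K z)"
          unfolding r[symmetric] o[symmetric] using px by simp
        finally have eq: "q x y z * s.prs (\<lambda>v. v K = z) / (s.pr (\<lambda>v. v K = z) x * s.prs (\<lambda>v. v i = y \<and> v K = z))
            = (recv_chan K W j i x y / out_law p j i y) / (recv_chan K W j K x z / out_law p j K z)" .
        have "recv_chan K W j i x y > 0" "recv_chan K W j K x z > 0" "out_law p j i y > 0" "out_law p j K z > 0"
          using ps px by (auto simp: o r[symmetric] zero_less_mult_iff)
        then have "log 2 ((recv_chan K W j i x y / out_law p j i y) / (recv_chan K W j K x z / out_law p j K z))
           = log 2 (recv_chan K W j i x y / out_law p j i y) - log 2 (recv_chan K W j K x z / out_law p j K z)"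
          by (subst log_divide) auto
        then show ?thesis
          using False by (simp only: eq if_False right_diff_distrib)
      qed simp
    qed
    also have "\<dots> = (\<Sum>x\<in>UNIV. \<Sum>y\<in>UNIV. (\<Sum>z\<in>UNIV. q x y z) * log 2 (recv_chan K W j i x y / out_law p j i y))
       - (\<Sum>x\<in>UNIV. \<Sum>z\<in>UNIV. (\<Sum>y\<in>UNIV. q x y z) * log 2 (recv_chan K W j K x z / out_law p j K z))"
    proof -
      have "(\<Sum>x\<in>UNIV. \<Sum>y\<in>UNIV. \<Sum>z\<in>UNIV. q x y z * log 2 (recv_chan K W j K x z / out_law p j K z))
         = (\<Sum>x\<in>UNIV. \<Sum>z\<in>UNIV. (\<Sum>y\<in>UNIV. q x y z) * log 2 (recv_chan K W j K x z / out_law p j K z))"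
        unfolding sum_distrib_right by (rule sum.cong[OF refl], rule sum.swap)
      then show ?thesis by (simp only: sum_subtractf sum_distrib_right)
    qed
    also have "\<dots> = mutual_info p j i - mutual_info p j K"
    proof -
      have "(\<Sum>z\<in>UNIV. q x y z) = p x * recv_chan K W j i x y" for x y
        by (simp add: q' recv_chan_eq_sum_pair_chan'[of K W j i] sum_distrib_left)
      moreover have "(\<Sum>y\<in>UNIV. q x y z) = p x * recv_chan K W j K x z" for x z
        by (simp add: r xz)
      ultimately show ?thesis by (simp only: mutual_info_def)
    qed
    finally show ?thesis by (simp add: q_def)
  next
    case 2
    have mk: "q x y z * s.prs (\<lambda>v. v K = z) = s.pr (\<lambda>v. v K = z) x * s.prs (\<lambda>v. v i = y \<and> v K = z)" for x y z
      using s.markov_pair[OF 2 ab(1), of z y x] ab by (simp add: q conj_commute)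
    have "cmi q = 0"
      unfolding cmi mk
    proof (intro sum.neutral ballI)
      fix x y z
      show "(if q x y z = 0 then 0 else q x y z * log 2 (s.pr (\<lambda>v. v K = z) x * s.prs (\<lambda>v. v i = y \<and> v K = z)
          / (s.pr (\<lambda>v. v K = z) x * s.prs (\<lambda>v. v i = y \<and> v K = z)))) = 0"
        using pos[of x y z] q_nonneg[of x y z] by (cases "q x y z = 0") auto
    qed
    then show ?thesis by (simp add: q_def)
  qed
qed

end

section \<open>The capacity\<close>

text \<open>Rounding up costs at most a factor 2. For \<open>N\<close> and the at most
  \<open>M\<close> sizes \<open>L j\<close> together this is the factor \<open>2 ^ (M + 1)\<close>
  in the error bound.\<close>

lemma nat_ceiling_bounds:
  fixes x :: real
  assumes "x \<ge> 1"
  shows "x \<le> real (nat \<lceil>x\<rceil>)" "real (nat \<lceil>x\<rceil>) \<le> 2 * x"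
  using assms by linarith+

context channel begin

section \<open>Information and moments as sums over input-output pairs\<close>

lemma sum_pair_law:
  assumes "j < M" "is_dist p"
  shows "(\<Sum>(x, y)\<in>UNIV. p x * recv_chan K W j r x y) = 1"
proof -
  have "(\<Sum>(x, y)\<in>UNIV \<times> UNIV. p x * recv_chan K W j r x y) = (\<Sum>x\<in>UNIV. \<Sum>y\<in>UNIV. p x * recv_chan K W j r x y)"
    by (rule sum.cartesian_product[symmetric])
  then show ?thesis
    using assms by (simp add: recv_chan_sum is_dist_def flip: sum_distrib_left)
qed

lemma mutual_info_eq: "mutual_info p j r = (\<Sum>(x, y)\<in>UNIV. p x * recv_chan K W j r x y * log 2 (recv_chan K W j r x y / out_law p j r y))"
  unfolding mutual_info_def by (simp only: sum.cartesian_product UNIV_Times_UNIV)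

lemma info_moment_eq: "info_moment p j r s = (\<Sum>(x, y)\<in>UNIV. p x * recv_chan K W j r x y * (recv_chan K W j r x y / out_law p j r y) powr s)"
  unfolding info_moment_def by (simp only: sum.cartesian_product UNIV_Times_UNIV)

lemma pair_law_pos:
  assumes "j < M" "is_dist p" "p x * recv_chan K W j r x y > 0"
  shows "p x > 0" "recv_chan K W j r x y > 0" "out_law p j r y > 0"
proof -
  show 1: "p x > 0" "recv_chan K W j r x y > 0"
    using assms recv_chan_nonneg[OF assms(1), of r x y] by (auto simp: is_dist_def zero_less_mult_iff dest: leD)
  show "out_law p j r y > 0"
    using out_law_pos[OF assms(1,2) 1] .
qed

lemma mutual_info_nonneg:
  assumes "j < M" "is_dist p"
  shows "mutual_info p j r \<ge> 0"
proof -
  have "(\<Sum>a\<in>UNIV. (case a of (x, y) \<Rightarrow> p x * recv_chan K W j r x y) *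
      log 2 ((case a of (x, y) \<Rightarrow> p x * recv_chan K W j r x y) / (case a of (x, y) \<Rightarrow> p x * out_law p j r y))) \<ge> 0"
  proof (rule gibbs)
    show "(\<Sum>a\<in>UNIV. case a of (x, y) \<Rightarrow> p x * recv_chan K W j r x y) = 1"
      using sum_pair_law[OF assms] .
    have "(\<Sum>(x, y)\<in>UNIV \<times> UNIV. p x * out_law p j r y) = (\<Sum>x\<in>UNIV. \<Sum>y\<in>UNIV. p x * out_law p j r y)"
      by (rule sum.cartesian_product[symmetric])
    then show "(\<Sum>a\<in>UNIV. case a of (x, y) \<Rightarrow> p x * out_law p j r y) \<le> 1"
      using assms by (simp add: out_law_sum is_dist_def flip: sum_distrib_left)
    fix a :: "'x \<times> 'y"
    obtain x y where a: "a = (x, y)" by (cases a)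
    have "p x \<ge> 0" using assms by (simp add: is_dist_def)
    then show "(case a of (x, y) \<Rightarrow> p x * recv_chan K W j r x y) \<ge> 0" "(case a of (x, y) \<Rightarrow> p x * out_law p j r y) \<ge> 0"
      using assms by (simp_all add: a recv_chan_nonneg out_law_nonneg)
    assume "(case a of (x, y) \<Rightarrow> p x * recv_chan K W j r x y) > 0"
    then show "(case a of (x, y) \<Rightarrow> p x * out_law p j r y) > 0"
      using pair_law_pos[OF assms, of x r y] by (simp add: a)
  qed simp
  also have "(\<Sum>a\<in>UNIV. (case a of (x, y) \<Rightarrow> p x * recv_chan K W j r x y) *
      log 2 ((case a of (x, y) \<Rightarrow> p x * recv_chan K W j r x y) / (case a of (x, y) \<Rightarrow> p x * out_law p j r y))) = mutual_info p j r"
    unfolding mutual_info_eq by (intro sum.cong) auto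
  finally show ?thesis .
qed

text \<open>Both parts are \<open>eventually_moment_le\<close>, the second one for the reciprocal
  ratio, whose expected logarithm is minus the mutual information.\<close>

lemma eventually_info_moment_le:
  assumes "j < M" "is_dist p" "\<delta> > 0"
  shows "\<forall>\<^sub>F s in at_right 0. info_moment p j r s \<le> 2 powr (s * (mutual_info p j r + \<delta>))"
    and "\<forall>\<^sub>F s in at_right 0. info_moment p j r (- s) \<le> 2 powr (s * (\<delta> - mutual_info p j r))"
proof -
  define q where "q = (\<lambda>(x, y). p x * recv_chan K W j r x y)"
  define f where "f = (\<lambda>(x, y). recv_chan K W j r x y / out_law p j r y)"
  have q: "q a \<ge> 0" for a
    using assms by (auto simp: q_def is_dist_def recv_chan_nonneg split: prod.splits)
  have f: "f a > 0" if "q a > 0" for a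
    using pair_law_pos[OF assms(1,2)] that by (cases a) (auto simp: q_def f_def)
  have sum: "(\<Sum>a\<in>UNIV. q a) = 1"
    unfolding q_def using sum_pair_law[OF assms(1,2)] .
  have info: "mutual_info p j r = (\<Sum>a\<in>UNIV. q a * log 2 (f a))"
    unfolding mutual_info_eq q_def f_def by (intro sum.cong) auto
  have mom: "info_moment p j r s = (\<Sum>a\<in>UNIV. q a * f a powr s)" for s
    unfolding info_moment_eq q_def f_def by (intro sum.cong) auto
  show "\<forall>\<^sub>F s in at_right 0. info_moment p j r s \<le> 2 powr (s * (mutual_info p j r + \<delta>))"
    unfolding info mom by (rule eventually_moment_le) (use q f sum assms in auto)
  have "\<forall>\<^sub>F s in at_right 0. (\<Sum>a\<in>UNIV. q a * (1 / f a) powr s) \<le> 2 powr (s * ((\<Sum>a\<in>UNIV. q a * log 2 (1 / f a)) + \<delta>))"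
    by (rule eventually_moment_le) (use q f sum assms in auto)
  moreover have "q a * log 2 (1 / f a) = - (q a * log 2 (f a))" for a
    using q[of a] f[of a] by (cases "q a = 0") (auto simp: log_divide)
  moreover have "q a * (1 / f a) powr s = q a * f a powr (- s)" for a s
    using q[of a] f[of a] by (cases "q a = 0") (auto simp: powr_divide powr_minus_divide)
  ultimately show "\<forall>\<^sub>F s in at_right 0. info_moment p j r (- s) \<le> 2 powr (s * (\<delta> - mutual_info p j r))"
    unfolding info mom by (simp add: sum_negf)
qed

lemma info_moment_nonneg: "j < M \<Longrightarrow> is_dist p \<Longrightarrow> info_moment p j r s \<ge> 0"
  unfolding info_moment_def is_dist_def by (intro sum_nonneg mult_nonneg_nonneg recv_chan_nonneg) auto

section \<open>Choice of codebook sizes and thresholds\<close>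

lemma achievable_if_less:
  fixes A :: "nat \<Rightarrow> nat set"
  assumes P: "\<And>j. j < M \<Longrightarrow> is_dist (P j)" and R: "R > 0" and A: "\<And>i. i < K \<Longrightarrow> A i \<subseteq> {..<M}"
    and less: "\<And>i. i < K \<Longrightarrow> R < (\<Sum>j\<in>A i. mutual_info (P j) j i - mutual_info (P j) j K)"
  shows "achievable_common_secrecy_rate M K W R"
proof -
  define J where "J j r = mutual_info (P j) j r" for j r
  define g where "g = Min (insert 1 ((\<lambda>i. (\<Sum>j\<in>A i. J j i - J j K) - R) ` {..<K}))"
  have g: "g > 0"
    unfolding g_def using less by (subst Min_gr_iff) (auto simp: J_def)
  have gap: "R + g \<le> (\<Sum>j\<in>A i. J j i - J j K)" if "i < K" for i
  proof -
    have "g \<le> (\<Sum>j\<in>A i. J j i - J j K) - R"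
      unfolding g_def using that by (intro Min_le) auto
    then show ?thesis by simp
  qed
  \<comment> \<open>Each channel spends \<open>\<delta>\<close> on the size of its codebook and
    \<open>\<delta>\<close> on the decoding threshold, at most \<open>2 * M * \<delta>\<close> in
    all; the last \<open>\<delta>\<close> remains as the exponent of false alarms.\<close>
  define \<delta> where "\<delta> = g / (2 * real M + 1)"
  have \<delta>: "\<delta> > 0" "g = 2 * real M * \<delta> + \<delta>"
  proof -
    show "\<delta> > 0" using g by (simp add: \<delta>_def)
    have "g = (2 * real M + 1) * \<delta>"
      using of_nat_0_le_iff[of M] by (simp add: \<delta>_def del: of_nat_0_le_iff)
    then show "g = 2 * real M * \<delta> + \<delta>" by (simp add: algebra_simps)
  qed
  have "\<forall>\<^sub>F s in at_right 0. (\<forall>i\<in>{..<K}. \<forall>j\<in>{..<M}. info_moment (P j) j i (- s) \<le> 2 powr (s * (\<delta> / 2 - J j i)))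
      \<and> (\<forall>j\<in>{..<M}. info_moment (P j) j K s \<le> 2 powr (s * (J j K + \<delta> / 2))) \<and> s \<in> {0<..<1}"
    unfolding J_def using \<delta>(1) P
    by (intro eventually_conj eventually_ball_finite ballI eventually_info_moment_le eventually_at_right_real) auto
  \<comment> \<open>One order \<open>s\<close> serves decoding and covering. The moments get the
    slack \<open>\<delta> / 2\<close>, half of that in codebook sizes and thresholds, which leaves
    the exponent \<open>s * \<delta> / 2\<close> of \<open>r\<close>.\<close>
  then obtain s where s1: "\<And>i j. i < K \<Longrightarrow> j < M \<Longrightarrow> info_moment (P j) j i (- s) \<le> 2 powr (s * (\<delta> / 2 - J j i))"
    and s2: "\<And>j. j < M \<Longrightarrow> info_moment (P j) j K s \<le> 2 powr (s * (J j K + \<delta> / 2))" and s: "0 < s" "s < 1"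
    by (auto dest!: eventually_happens'[OF trivial_limit_at_right_real])
  define r where "r = 2 powr (- (s * \<delta> / 2))"
  define r' where "r' = 2 powr (- \<delta>)"
  define b where "b n = (\<Sum>i<K. r ^ n + 2 ^ (M + 1) * r' ^ n) + (\<Sum>j<M. 1 / (s * ln 2) * r ^ n)" for n
  have r01: "0 \<le> r" "r < 1" "0 \<le> r'" "r' < 1"
    using s \<delta>(1) by (auto simp: r_def r'_def powr_less_one)
  have "b \<longlonglongrightarrow> (\<Sum>i<K. 0 + 2 ^ (M + 1) * 0) + (\<Sum>j<M. 1 / (s * ln 2) * 0)"
    unfolding b_def using r01 by (intro tendsto_intros LIMSEQ_power_zero) auto
  then have b: "b \<longlonglongrightarrow> 0" by simp
  have J_nonneg: "J j r \<ge> 0" if "j < M" for j r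
    unfolding J_def using mutual_info_nonneg P that by simp
  show ?thesis
    unfolding achievable_common_secrecy_rate_def
  proof (intro allI impI)
    fix \<epsilon> :: real assume \<epsilon>: "\<epsilon> > 0"
    have "\<forall>\<^sub>F n in sequentially. b n < \<epsilon> \<and> n > 0"
      using order_tendstoD(2)[OF b \<epsilon>] eventually_gt_at_top[of 0] by (rule eventually_conj)
    then obtain n where n: "b n < \<epsilon>" "n > 0"
      by (auto dest!: eventually_happens'[OF sequentially_bot])
    define N where "N = num_msgs n R"
    define L where "L j = nat \<lceil>2 powr (real n * (J j K + \<delta>))\<rceil>" for j
    define \<Gamma> where "\<Gamma> i = 2 powr (\<Sum>j\<in>A i. real n * (J j i - \<delta>))" for i
    have N: "2 powr (real n * R) \<le> real N" "real N \<le> 2 * 2 powr (real n * R)"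
      unfolding N_def num_msgs_def using R by (intro nat_ceiling_bounds; simp add: ge_one_powr_ge_zero)+
    have L: "2 powr (real n * (J j K + \<delta>)) \<le> real (L j)" "real (L j) \<le> 2 * 2 powr (real n * (J j K + \<delta>))" if "j < M" for j
      unfolding L_def using J_nonneg[OF that] \<delta>(1) by (intro nat_ceiling_bounds; simp add: ge_one_powr_ge_zero)+
    have N_pos: "N > 0" using N(1) by (smt (verit) of_nat_0_less_iff powr_gt_zero)
    have L_pos: "L j > 0" if "j < M" for j
      using L(1)[OF that] by (smt (verit) of_nat_0_less_iff powr_gt_zero)
    interpret rc: random_code M K W P n N L
      using P n N_pos L_pos by unfold_locales auto
    have power_powr: "(2 powr x) ^ n = 2 powr (real n * x)" for x :: real
      by (simp add: powr_realpow[symmetric] powr_powr mult.commute)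
    have miss: "\<Gamma> i powr s * (\<Prod>j\<in>A i. info_moment (P j) j i (- s) ^ n) \<le> r ^ n" if i: "i < K" for i
    proof -
      have fin: "finite (A i)" using A[OF i] finite_subset by blast
      \<comment> \<open>\<open>R > 0\<close> forces at least one channel into \<open>A i\<close>, so
        that a full factor \<open>r ^ n\<close> is gained.\<close>
      have "A i \<noteq> {}" using less[OF i] R by auto
      then have card: "card (A i) \<ge> 1" using fin by (simp add: Suc_le_eq card_gt_0_iff)
      have "(\<Prod>j\<in>A i. info_moment (P j) j i (- s) ^ n) \<le> (\<Prod>j\<in>A i. (2 powr (s * (\<delta> / 2 - J j i))) ^ n)"
        by (intro prod_mono conjI zero_le_power power_mono info_moment_nonneg P s1 i) (use A[OF i] in auto)
      also have "\<dots> = 2 powr (\<Sum>j\<in>A i. real n * (s * (\<delta> / 2 - J j i)))"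
        using fin by (simp add: power_powr powr_sum)
      finally have "\<Gamma> i powr s * (\<Prod>j\<in>A i. info_moment (P j) j i (- s) ^ n)
          \<le> \<Gamma> i powr s * 2 powr (\<Sum>j\<in>A i. real n * (s * (\<delta> / 2 - J j i)))"
        by (intro mult_left_mono) auto
      also have "\<dots> = 2 powr ((\<Sum>j\<in>A i. real n * (J j i - \<delta>)) * s + (\<Sum>j\<in>A i. real n * (s * (\<delta> / 2 - J j i))))"
        by (simp add: \<Gamma>_def powr_powr powr_add)
      also have "(\<Sum>j\<in>A i. real n * (J j i - \<delta>)) * s + (\<Sum>j\<in>A i. real n * (s * (\<delta> / 2 - J j i))) = (\<Sum>j\<in>A i. real n * (- (s * \<delta> / 2)))"
        unfolding sum_distrib_right sum.distrib[symmetric] by (intro sum.cong) (auto simp: algebra_simps)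
      also have "\<dots> = - (real (card (A i)) * (real n * (s * \<delta> / 2)))"
        by simp
      also have "2 powr \<dots> \<le> 2 powr (- (1 * (real n * (s * \<delta> / 2))))"
        using card s \<delta>(1) by (intro powr_mono le_imp_neg_le mult_right_mono) auto
      also have "\<dots> = r ^ n"
        by (simp add: r_def power_powr)
      finally show ?thesis .
    qed
    have alarm: "real N * (\<Prod>j\<in>A i. real (L j)) / \<Gamma> i \<le> 2 ^ (M + 1) * r' ^ n" if i: "i < K" for i
    proof -
      have fin: "finite (A i)" using A[OF i] finite_subset by blast
      have cardM: "card (A i) \<le> M" using card_mono[OF _ A[OF i]] by simp
      have "real N * (\<Prod>j\<in>A i. real (L j)) \<le> (2 * 2 powr (real n * R)) * (\<Prod>j\<in>A i. 2 * 2 powr (real n * (J j K + \<delta>)))"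
        using A[OF i] L N by (intro mult_mono prod_mono prod_nonneg) auto
      also have "\<dots> = 2 ^ (card (A i) + 1) * 2 powr (real n * R + (\<Sum>j\<in>A i. real n * (J j K + \<delta>)))"
        using fin by (simp add: prod.distrib powr_add powr_sum)
      finally have "real N * (\<Prod>j\<in>A i. real (L j)) / \<Gamma> i
         \<le> 2 ^ (card (A i) + 1) * 2 powr (real n * R + (\<Sum>j\<in>A i. real n * (J j K + \<delta>))) / \<Gamma> i"
        by (intro divide_right_mono) (auto simp: \<Gamma>_def)
      also have "\<dots> = 2 ^ (card (A i) + 1) * 2 powr (real n * R + (\<Sum>j\<in>A i. real n * (J j K + \<delta>)) - (\<Sum>j\<in>A i. real n * (J j i - \<delta>)))"
        by (simp add: \<Gamma>_def powr_diff)
      also have "real n * R + (\<Sum>j\<in>A i. real n * (J j K + \<delta>)) - (\<Sum>j\<in>A i. real n * (J j i - \<delta>))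
          = real n * (R - (\<Sum>j\<in>A i. J j i - J j K) + 2 * real (card (A i)) * \<delta>)"
        by (simp add: sum_subtractf sum.distrib algebra_simps flip: sum_distrib_left)
      also have "2 ^ (card (A i) + 1) * 2 powr \<dots> \<le> 2 ^ (M + 1) * 2 powr (real n * (- \<delta>))"
      proof -
        have "real (card (A i)) * \<delta> \<le> real M * \<delta>"
          using cardM \<delta>(1) by (intro mult_right_mono) auto
        then have e: "R - (\<Sum>j\<in>A i. J j i - J j K) + 2 * real (card (A i)) * \<delta> \<le> - \<delta>"
          using gap[OF i] \<delta>(2) by linarith
        show ?thesis
          by (intro mult_left_mono[OF e] mult_mono power_increasing powr_mono) (use cardM in auto)
      qed
      also have "\<dots> = 2 ^ (M + 1) * r' ^ n"
        by (simp add: r'_def power_powr)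
      finally show ?thesis .
    qed
    have leak: "real (L j) powr (- s) / (s * ln 2) * info_moment (P j) j K s ^ n \<le> 1 / (s * ln 2) * r ^ n" if j: "j < M" for j
    proof -
      have "real (L j) powr (- s) * info_moment (P j) j K s ^ n
         \<le> (2 powr (real n * (J j K + \<delta>))) powr (- s) * (2 powr (s * (J j K + \<delta> / 2))) ^ n"
        using L(1)[OF j] s s2[OF j] P[OF j] j
        by (intro mult_mono power_mono powr_mono2') (auto simp: info_moment_nonneg)
      also have "\<dots> = 2 powr (real n * (J j K + \<delta>) * (- s) + real n * (s * (J j K + \<delta> / 2)))"
        by (simp only: powr_powr power_powr powr_add)
      also have "real n * (J j K + \<delta>) * (- s) + real n * (s * (J j K + \<delta> / 2)) = real n * (- (s * \<delta> / 2))"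
        by (simp add: algebra_simps)
      also have "2 powr \<dots> = r ^ n"
        by (simp add: r_def power_powr)
      finally have "real (L j) powr (- s) * info_moment (P j) j K s ^ n / (s * ln 2) \<le> r ^ n / (s * ln 2)"
        using s by (intro divide_right_mono) auto
      then show ?thesis by simp
    qed
    obtain e d where ed: "valid_encoder M n N e" "\<And>i. i < K \<Longrightarrow> err_prob M K n W N e d i \<le> b n"
      "equivocation M K n W N e \<ge> log 2 (real N) - b n"
    proof (rule rc.exists_code[of A \<Gamma> s s "b n"])
      show "(\<Sum>i<K. \<Gamma> i powr s * (\<Prod>j\<in>A i. info_moment (P j) j i (- s) ^ n) + real N * (\<Prod>j\<in>A i. real (L j)) / \<Gamma> i)
         + (\<Sum>j<M. real (L j) powr (- s) / (s * ln 2) * info_moment (P j) j K s ^ n) \<le> b n"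
        unfolding b_def using miss alarm leak by (intro add_mono sum_mono) auto
    qed (use A s in \<open>auto simp: \<Gamma>_def\<close>)
    have "log 2 (real N) \<ge> real n * R"
      using N(1) N_pos by (subst le_log_iff) auto
    then have "equivocation M K n W N e \<ge> real n * R - \<epsilon>"
      using ed(3) n(1) by linarith
    also have "real n * R - \<epsilon> \<ge> real n * (R - \<epsilon>)"
      using n(2) \<epsilon> by (simp add: algebra_simps)
    finally have "equivocation M K n W N e / real n \<ge> R - \<epsilon>"
      using n(2) by (simp add: field_simps)
    moreover have "\<forall>i<K. err_prob M K n W N e d i \<le> \<epsilon>"
      using ed(2) n(1) by (meson less_imp_le order.trans)
    ultimately show "\<exists>n>0. \<exists>enc dec. valid_encoder M n (num_msgs n R) enc \<and>
        (\<forall>i<K. err_prob M K n W (num_msgs n R) enc dec i \<le> \<epsilon>) \<and>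
        R - \<epsilon> \<le> equivocation M K n W (num_msgs n R) enc / real n"
      using ed(1) n(2) unfolding N_def by (intro exI[of _ n] exI[of _ e] exI[of _ d] conjI)
  qed
qed

section \<open>The upper bound on achievable rates\<close>

lemma achievable_le:
  assumes K: "K \<ge> 1" and ach: "achievable_common_secrecy_rate M K W R"
    and ub: "\<And>P. (\<forall>j<M. is_dist (P j)) \<Longrightarrow> secrecy_objective M K W P \<le> c"
  shows "R \<le> c"
proof -
  \<comment> \<open>The loss per letter. \<open>\<epsilon> * (\<bar>R\<bar> + 1)\<close> bounds
    \<open>\<epsilon> * log 2 N / n\<close>, with room for the rounding of \<open>N\<close> and for
    negative \<open>R\<close>; the other two terms do not grow with \<open>n\<close>.\<close>
  define E where "E \<epsilon> = \<epsilon> * (\<bar>R\<bar> + 1) - log 2 (1 - \<epsilon>) - \<epsilon> * log 2 \<epsilon>" for \<epsilon> :: real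
  have bound: "R - \<epsilon> - E \<epsilon> \<le> c" if \<epsilon>: "0 < \<epsilon>" "\<epsilon> < 1" for \<epsilon>
  proof -
    obtain n enc and dec :: "nat \<Rightarrow> (nat \<times> nat \<Rightarrow> 'y) \<Rightarrow> nat" where n: "n > 0"
      and enc: "valid_encoder M n (num_msgs n R) enc"
      and err: "\<And>i. i < K \<Longrightarrow> err_prob M K n W (num_msgs n R) enc dec i \<le> \<epsilon>"
      and eq: "equivocation M K n W (num_msgs n R) enc / real n \<ge> R - \<epsilon>"
      using ach \<epsilon>(1) unfolding achievable_common_secrecy_rate_def by blast
    define N where "N = num_msgs n R"
    have N_pos: "N > 0" by (simp add: N_def num_msgs_def)
    have "real N \<le> real (nat \<lceil>2 powr (real n * \<bar>R\<bar>)\<rceil>)"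
      unfolding N_def num_msgs_def
      by (intro of_nat_mono nat_mono ceiling_mono powr_mono mult_left_mono) auto
    also have "\<dots> \<le> 2 * 2 powr (real n * \<bar>R\<bar>)"
      by (intro nat_ceiling_bounds ge_one_powr_ge_zero) auto
    also have "\<dots> = 2 powr (real n * \<bar>R\<bar> + 1)"
      by (simp add: powr_add)
    finally have "log 2 (real N) \<le> real n * \<bar>R\<bar> + 1"
      using N_pos by (subst log_le_iff) auto
    also have "\<dots> \<le> real n * (\<bar>R\<bar> + 1)"
      using n by (simp add: algebra_simps)
    finally have logN: "log 2 (real N) \<le> real n * (\<bar>R\<bar> + 1)" .
    interpret wiretap_code M K W n N enc
      using n N_pos enc by unfold_locales (auto simp: N_def)
    have "R - \<epsilon> - E \<epsilon> \<le> (\<Sum>j<M. cmi (joint_XYiYe K W j i (pX_avg j)))" if i: "i < K" for i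
    proof -
      let ?X = "\<Sum>j<M. cmi (joint_XYiYe K W j i (pX_avg j))"
      have nonneg: "- log 2 (1 - \<epsilon>) - \<epsilon> * log 2 \<epsilon> \<ge> 0"
      proof -
        have "log 2 (1 - \<epsilon>) \<le> 0" "\<epsilon> * log 2 \<epsilon> \<le> 0"
          using \<epsilon> by (auto simp: mult_nonneg_nonpos)
        then show ?thesis by linarith
      qed
      have "real n * (R - \<epsilon>) \<le> equivocation M K n W N enc"
        using eq n by (simp add: N_def field_simps)
      also have "\<dots> \<le> real n * ?X - log 2 (1 - \<epsilon>) + \<epsilon> * log 2 (real N / \<epsilon>)"
        using equivocation_le[OF err[OF i, folded N_def] \<epsilon>] .
      also have "\<dots> = real n * ?X + \<epsilon> * log 2 (real N) + (- log 2 (1 - \<epsilon>) - \<epsilon> * log 2 \<epsilon>)"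
        using \<epsilon> N_pos by (simp add: log_divide algebra_simps)
      also have "\<dots> \<le> real n * ?X + \<epsilon> * (real n * (\<bar>R\<bar> + 1)) + real n * (- log 2 (1 - \<epsilon>) - \<epsilon> * log 2 \<epsilon>)"
        using logN \<epsilon> n nonneg by (intro add_mono mult_left_mono mult_le_cancel_right1[THEN iffD2]) auto
      also have "\<dots> = real n * (?X + E \<epsilon>)"
        by (simp add: E_def algebra_simps)
      finally have "R - \<epsilon> \<le> ?X + E \<epsilon>"
        using n by simp
      then show ?thesis by simp
    qed
    then have "R - \<epsilon> - E \<epsilon> \<le> secrecy_objective M K W pX_avg"
      unfolding secrecy_objective_def using K by (subst Min_ge_iff) (auto simp: lessThan_empty_iff)
    also have "\<dots> \<le> c"
      using is_dist_pX_avg by (intro ub) auto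
    finally show ?thesis .
  qed
  have "((\<lambda>\<epsilon>::real. \<epsilon> * log 2 \<epsilon>) \<longlongrightarrow> 0 * log 2 0) (at 0 within {0..})"
    using continuous_on_x_log_x unfolding continuous_on_def by (rule bspec) simp
  then have eta: "((\<lambda>\<epsilon>::real. \<epsilon> * log 2 \<epsilon>) \<longlongrightarrow> 0) (at_right 0)"
    by (intro tendsto_within_subset[where S = "{0..}" and T = "{0<..}"]) auto
  have "((\<lambda>\<epsilon>. R - \<epsilon> - (\<epsilon> * (\<bar>R\<bar> + 1) - log 2 (1 - \<epsilon>) - \<epsilon> * log 2 \<epsilon>)) \<longlongrightarrow> R - 0 - (0 * (\<bar>R\<bar> + 1) - log 2 (1 - 0) - 0)) (at_right 0)"
    by (intro tendsto_diff tendsto_mult tendsto_const tendsto_ident_at tendsto_log eta) auto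
  then have lim: "((\<lambda>\<epsilon>. R - \<epsilon> - E \<epsilon>) \<longlongrightarrow> R) (at_right 0)"
    by (simp add: E_def)
  show ?thesis
  proof (rule tendsto_upperbound[OF lim])
    show "\<forall>\<^sub>F \<epsilon> in at_right 0. R - \<epsilon> - E \<epsilon> \<le> c"
      using eventually_at_right_real[of 0 1] by (auto elim!: eventually_mono intro: bound)
  qed simp
qed

text \<open>A single message at block length 1. Besides nonemptiness it shows that every upper bound
  of the achievable rates is nonnegative, so that random codes are needed only for positive
  rates.\<close>

lemma zero_achievable: "achievable_common_secrecy_rate M K W 0"
  unfolding achievable_common_secrecy_rate_def
proof (intro allI impI)
  fix \<epsilon> :: real assume \<epsilon>: "\<epsilon> > 0"
  define enc :: "nat \<Rightarrow> (nat \<times> nat \<Rightarrow> 'x) \<Rightarrow> real" where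
    "enc w xs = of_bool (xs = restrict (\<lambda>_. undefined) ({..<M} \<times> {..<1}))" for w xs
  define dec :: "nat \<Rightarrow> (nat \<times> nat \<Rightarrow> 'y) \<Rightarrow> nat" where "dec i y = 1" for i y
  have N: "num_msgs 1 0 = 1" by (simp add: num_msgs_def)
  have enc: "valid_encoder M 1 1 enc"
  proof -
    have "(\<Sum>xs\<in>codewords M 1. enc w xs) = 1" for w
      unfolding enc_def by (subst sum.remove[of _ "restrict (\<lambda>_. undefined) ({..<M} \<times> {..<1})"]) (auto simp: codewords_def intro!: finite_PiE)
    then show ?thesis by (simp add: valid_encoder_def enc_def)
  qed
  have err: "err_prob M K 1 W 1 enc dec i = 0" for i
    by (simp add: err_prob_def dec_def)
  have eq: "equivocation M K 1 W 1 enc = 0"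
  proof -
    have "(\<Sum>w\<in>{1..1}. f w) = f 1" for f :: "nat \<Rightarrow> real" by simp
    then show ?thesis
      unfolding equivocation_def by (simp only:) (auto intro!: sum.neutral)
  qed
  show "\<exists>n>0. \<exists>enc dec. valid_encoder M n (num_msgs n 0) enc \<and>
        (\<forall>i<K. err_prob M K n W (num_msgs n 0) enc dec i \<le> \<epsilon>) \<and>
        0 - \<epsilon> \<le> equivocation M K n W (num_msgs n 0) enc / real n"
    using enc err eq \<epsilon> by (intro exI[of _ 1] conjI exI[of _ enc] exI[of _ dec]) (auto simp: N[simplified])
qed

lemma achievable_if_less_objective:
  assumes deg: "reversely_degraded M K W" and P: "\<And>j. j < M \<Longrightarrow> is_dist (P j)"
    and R: "R > 0" "R < secrecy_objective M K W P" and K: "K \<ge> 1"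
  shows "achievable_common_secrecy_rate M K W R"
proof -
  let ?c = "\<lambda>i j. cmi (joint_XYiYe K W j i (P j))"
  \<comment> \<open>The channels used by receiver \<open>i\<close> are selected by this equation; on
    all others \<open>cmi_degraded\<close> makes the conditional information 0, so nothing is
    lost.\<close>
  define A where "A i = {j. j < M \<and> ?c i j = mutual_info (P j) j i - mutual_info (P j) j K}" for i
  show ?thesis
  proof (rule achievable_if_less[OF P R(1)])
    fix i assume i: "i < K"
    show "A i \<subseteq> {..<M}" by (auto simp: A_def)
    have "R < (\<Sum>j<M. ?c i j)"
      using R(2) i K unfolding secrecy_objective_def by (subst (asm) Min_gr_iff) auto
    also have "\<dots> = (\<Sum>j\<in>A i. ?c i j)"
      using cmi_degraded[OF _ P i deg] by (intro sum.mono_neutral_right) (auto simp: A_def)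
    also have "\<dots> = (\<Sum>j\<in>A i. mutual_info (P j) j i - mutual_info (P j) j K)"
      by (intro sum.cong) (auto simp: A_def)
    finally show "R < (\<Sum>j\<in>A i. mutual_info (P j) j i - mutual_info (P j) j K)" .
  qed
qed

end

theorem theorem1:
  fixes W :: "('x::finite, 'y::finite) bchan" and M K :: nat
  assumes "M \<ge> 1" and "K \<ge> 1"
    and "valid_channel M K W"
    and "reversely_degraded M K W"
  shows "(\<exists>P. (\<forall>j<M. is_dist (P j)) \<and>
              secrecy_objective M K W P = common_secrecy_capacity M K W)
       \<and> (\<forall>P. (\<forall>j<M. is_dist (P j)) \<longrightarrow>
              secrecy_objective M K W P \<le> common_secrecy_capacity M K W)"
proof -
  interpret channel M K W
    using assms(3) by unfold_locales
  obtain P where P: "\<And>j. is_dist (P j)"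
    "\<And>P'. (\<forall>j<M. is_dist (P' j)) \<Longrightarrow> secrecy_objective M K W P' \<le> secrecy_objective M K W P"
    using secrecy_objective_attains_max[OF assms(2)] by blast
  let ?S = "{R. achievable_common_secrecy_rate M K W R}"
  have upper: "R \<le> secrecy_objective M K W P" if "R \<in> ?S" for R
    using achievable_le[OF assms(2)] that P(2) by blast
  have "common_secrecy_capacity M K W = secrecy_objective M K W P"
    unfolding common_secrecy_capacity_def
  proof (rule cSup_eq_non_empty[OF _ upper])
    show "?S \<noteq> {}" using zero_achievable by blast
    fix c assume c: "\<And>R. R \<in> ?S \<Longrightarrow> R \<le> c"
    then have c0: "0 \<le> c" using zero_achievable by blast
    show "secrecy_objective M K W P \<le> c"
    proof (rule ccontr)
      assume "\<not> secrecy_objective M K W P \<le> c"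
      \<comment> \<open>A rate strictly between the bound and the objective;
        \<open>R > c \<ge> 0\<close> gives the positivity that the random code requires.\<close>
      then obtain R where R: "c < R" "R < secrecy_objective M K W P"
        using dense not_le by metis
      then have "R \<in> ?S"
        using achievable_if_less_objective[OF assms(4) P(1) _ R(2) assms(2)] c0 by simp
      with c[OF this] R(1) show False by simp
    qed
  qed
  then show ?thesis using P by (intro conjI exI[of _ P]) auto
qed

end
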